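(* Let $\mathcal{D}$ be a codimension one distribution, with at most isolated singularities, on $\mathbb{P}_{\Delta}$. (1) If $\mathbb{P}_{\Delta}=\mathbb{P}^1\times\mathbb{P}^1\times\mathbb{P}^1$ and $\mathcal{D}$ is regular, then $\deg(\mathcal{D})\in\{(2,0,0),(0,2,0),(0,0,2)\}$. Then, in homogeneous coordinates, $\mathcal{D}$ is induced by $$\omega=z_{i1}\,dz_{i0}-z_{i0}\,dz_{i1},\quad\text{for some } i=1,2,3.$$ In particular $\mathcal{D}$ is integrable and admits a rational first integral. Moreover $\mathcal{D}$ is a natural fibration given by the projection $\pi_i:\mathbb{P}_{\Delta}\rightarrow\mathbb{P}^1$, for some $i=1,2,3$. (2) If $\mathbb{P}_{\Delta}=\mathbb{P}^2\times\mathbb{P}^1$ and $\mathcal{D}$ is regular, then $\deg(\mathcal{D})=(0,2)$. Then, in homogeneous coordinates, $\mathcal{D}$ is induced by $$\omega=z_{21}\,dz_{20}-z_{20}\,dz_{21}.$$ In particular $\mathcal{D}$ is integrable and admits a rational first integral. Moreover $\mathcal{D}$ is the natural fibration given by the projection $\pi_2:\mathbb{P}_{\Delta}\rightarrow\mathbb{P}^1$. (3) If $\mathbb{P}_{\Delta}=\mathbb{P}^2\times\mathbb{P}^2$, then $\mathrm{Sing}(\mathcal{D})\neq\varnothing$, that is, there are no regular distributions.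
   Context: On $X=\mathbb{P}^{n_1}\times\cdots\times\mathbb{P}^{n_k}$ use homogeneous coordinates $z_{i0},\ldots,z_{in_i}$ on the $i$th factor. The ring $\mathrm{S}=\mathbb{C}[z_{ij}]$ is $\mathbb{Z}^k$-graded with $\deg z_{ij}=e_i$, the $i$th standard basis vector. A codimension one distribution $\mathcal{D}$ of degree $d=(d_1,\ldots,d_k)\in\mathbb{Z}^k$ is a global section of $\Omega^1_X\otimes\mathcal{O}_X(d_1,\ldots,d_k)$, considered up to a nonzero constant factor. In homogeneous coordinates it is a polynomial form $\omega=\sum_{i,j}P_{ij}\,dz_{ij}$ with $P_{ij}$ multihomogeneous of degree $d-e_i$ and $i_{R_i}\omega=0$ for $R_i=\sum_jz_{ij}\frac{\partial}{\partial z_{ij}}$, $i=1,\ldots,k$. $\mathrm{Sing}(\mathcal{D})\subset X$ is the zero set of the section; $\mathcal{D}$ is regular if $\mathrm{Sing}(\mathcal{D})=\varnothing$. $\mathcal{D}$ is integrable if $\omega\wedge d\omega=0$. A rational first integral is a non-constant rational function $f$ on $X$ with $\omega\wedge df=0$. $\pi_i$ is the projection of $X$ to its $i$th factor. *)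

theory Defs
  imports
    "HOL-Analysis.Analysis"
    "HOL-Library.Poly_Mapping"
    "HOL-Computational_Algebra.Fraction_Field"
begin

section \<open>The coordinate ring\<close>

text \<open>
  \<open>Z i j\<close> is the \<open>j\<close>-th homogeneous coordinate on the \<open>i\<close>-th factor. Factors are numbered from
  \<open>0\<close>, so the \<open>z\<^sub>1\<^sub>j, z\<^sub>2\<^sub>j, \<dots>\<close> of the usual notation are \<open>Z 0 j, Z 1 j, \<dots>\<close>.
\<close>

datatype coord = Z (factor: nat) (pos: nat)

text \<open>
  The order only serves to make the polynomial ring an instance of \<open>idom\<close>. A pair type would not
  do, because the order on pairs loaded by HOL-Analysis is the componentwise one.
\<close>

instantiation coord :: linorder
begin

definition less_eq_coord :: "coord \<Rightarrow> coord \<Rightarrow> bool" where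
  "p \<le> q \<longleftrightarrow> factor p < factor q \<or> factor p = factor q \<and> pos p \<le> pos q"

definition less_coord :: "coord \<Rightarrow> coord \<Rightarrow> bool" where
  "p < q \<longleftrightarrow> factor p < factor q \<or> factor p = factor q \<and> pos p < pos q"

instance
  by standard (auto simp: less_eq_coord_def less_coord_def coord.expand)

end

type_synonym mpoly = "(coord \<Rightarrow>\<^sub>0 nat) \<Rightarrow>\<^sub>0 complex"

definition Const :: "complex \<Rightarrow> mpoly" where
  "Const c = Poly_Mapping.single 0 c"

definition Var :: "coord \<Rightarrow> mpoly" where
  "Var p = Poly_Mapping.single (Poly_Mapping.single p 1) 1"

definition eval_mpoly :: "(nat \<Rightarrow> nat \<Rightarrow> complex) \<Rightarrow> mpoly \<Rightarrow> complex" where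
  "eval_mpoly v P =
    (\<Sum>m\<in>Poly_Mapping.keys P. Poly_Mapping.lookup P m *
      (\<Prod>p\<in>Poly_Mapping.keys m. v (factor p) (pos p) ^ Poly_Mapping.lookup m p))"

definition pd_term :: "coord \<Rightarrow> (coord \<Rightarrow>\<^sub>0 nat) \<Rightarrow> complex \<Rightarrow> mpoly" where
  "pd_term p m a =
    Poly_Mapping.single (m - Poly_Mapping.single p 1) (of_nat (Poly_Mapping.lookup m p) * a)"

definition pd :: "coord \<Rightarrow> mpoly \<Rightarrow> mpoly" where
  "pd p P = (\<Sum>m\<in>Poly_Mapping.keys P. pd_term p m (Poly_Mapping.lookup P m))"

lemma pd_term_0 [simp]: "pd_term p m 0 = 0"
  by (simp add: pd_term_def)

lemma pd_term_add: "pd_term p m (a + b) = pd_term p m a + pd_term p m b"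
  by (simp add: pd_term_def single_add distrib_left)

lemma pd_superset:
  assumes "finite S" "Poly_Mapping.keys P \<subseteq> S"
  shows "pd p P = (\<Sum>m\<in>S. pd_term p m (Poly_Mapping.lookup P m))"
  unfolding pd_def
  by (rule sum.mono_neutral_left) (use assms in \<open>auto simp: in_keys_iff\<close>)

lemma pd_0 [simp]: "pd p 0 = 0"
  by (simp add: pd_def)

lemma pd_add: "pd p (P + Q) = pd p P + pd p Q"
proof -
  let ?S = "Poly_Mapping.keys P \<union> Poly_Mapping.keys Q"
  have "pd p (P + Q) = (\<Sum>m\<in>?S. pd_term p m (Poly_Mapping.lookup (P + Q) m))"
    by (rule pd_superset) (auto dest: subsetD[OF Poly_Mapping.keys_add])
  also have "\<dots> = (\<Sum>m\<in>?S. pd_term p m (Poly_Mapping.lookup P m))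
                + (\<Sum>m\<in>?S. pd_term p m (Poly_Mapping.lookup Q m))"
    by (simp add: lookup_add pd_term_add sum.distrib)
  also have "\<dots> = pd p P + pd p Q"
    by (simp add: pd_superset[of ?S P] pd_superset[of ?S Q])
  finally show ?thesis .
qed

lemma pd_sum: "pd p (\<Sum>a\<in>A. f a) = (\<Sum>a\<in>A. pd p (f a))"
  by (induction A rule: infinite_finite_induct) (simp_all add: pd_add)

lemma pd_single: "pd p (Poly_Mapping.single m a) = pd_term p m a"
  by (subst pd_superset[of "{m}"]) auto

lemma mpoly_eq_sum_single:
  fixes P :: mpoly
  shows "P = (\<Sum>m\<in>Poly_Mapping.keys P. Poly_Mapping.single m (Poly_Mapping.lookup P m))"
  by (rule poly_mapping_eqI) (auto simp: lookup_sum lookup_single when_def in_keys_iff)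

lemma pd_single_mult:
  "pd p (Poly_Mapping.single m a * Poly_Mapping.single n b) =
     pd p (Poly_Mapping.single m a) * Poly_Mapping.single n b +
     Poly_Mapping.single m a * pd p (Poly_Mapping.single n b)"
proof -
  let ?e = "Poly_Mapping.single p (1::nat)"
  have shift: "(m - ?e) + n = (m + n) - ?e" if "Poly_Mapping.lookup m p > 0"
    for m n :: "coord \<Rightarrow>\<^sub>0 nat"
    using that by (intro poly_mapping_eqI) (auto simp: lookup_add lookup_minus lookup_single when_def)
  have 1: "Poly_Mapping.single ((m - ?e) + n) (of_nat (Poly_Mapping.lookup m p) * a * b) =
        Poly_Mapping.single ((m + n) - ?e) (of_nat (Poly_Mapping.lookup m p) * a * b)"
    using shift[of m n] by (cases "Poly_Mapping.lookup m p = 0") auto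
  have 2: "Poly_Mapping.single (m + (n - ?e)) (a * (of_nat (Poly_Mapping.lookup n p) * b)) =
        Poly_Mapping.single ((m + n) - ?e) (of_nat (Poly_Mapping.lookup n p) * a * b)"
    using shift[of n m] by (cases "Poly_Mapping.lookup n p = 0") (auto simp: ac_simps)
  show ?thesis
    unfolding mult_single pd_single pd_term_def 1 2 single_add[symmetric] lookup_add
    by (simp add: algebra_simps)
qed

lemma pd_mult: "pd p (P * Q) = pd p P * Q + P * pd p Q"
proof -
  let ?s = "\<lambda>R m. Poly_Mapping.single m (Poly_Mapping.lookup R m) :: mpoly"
  let ?A = "Poly_Mapping.keys P" and ?B = "Poly_Mapping.keys Q"
  have "pd p ((\<Sum>m\<in>?A. ?s P m) * (\<Sum>n\<in>?B. ?s Q n)) =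
      pd p (\<Sum>m\<in>?A. ?s P m) * (\<Sum>n\<in>?B. ?s Q n) + (\<Sum>m\<in>?A. ?s P m) * pd p (\<Sum>n\<in>?B. ?s Q n)"
    unfolding sum_product pd_sum pd_single_mult sum.distrib ..
  then show ?thesis
    unfolding mpoly_eq_sum_single[symmetric] .
qed

lemma quotient_rule_respect:
  fixes F F' G G' :: "'r::comm_ring_1"
  assumes e: "F * G' = F' * G" and d: "DF * G' + F * DG' = DF' * G + F' * DG"
  shows "(DF * G - F * DG) * (G' * G') = (DF' * G' - F' * DG') * (G * G)"
proof -
  have "(DF * G - F * DG) * (G' * G') - (DF' * G' - F' * DG') * (G * G) =
      (DF * G' + F * DG' - (DF' * G + F' * DG)) * (G * G')
      - (F * G' - F' * G) * (DG' * G + DG * G')"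
    by (simp add: algebra_simps)
  then show ?thesis using e d by simp
qed

text \<open>The partial derivatives extended to the fraction field by the quotient rule.\<close>

lift_definition fract_pd :: "coord \<Rightarrow> mpoly fract \<Rightarrow> mpoly fract"
  is "\<lambda>p (F, G). (pd p F * G - F * pd p G, G * G)"
proof -
  fix p and x y :: "mpoly \<times> mpoly"
  obtain F G F' G' where xy: "x = (F, G)" "y = (F', G')" by (cases x, cases y) auto
  assume "fractrel x y"
  then have nz: "G \<noteq> 0" "G' \<noteq> 0" and e: "F * G' = F' * G" by (auto simp: xy)
  from e have "pd p (F * G') = pd p (F' * G)" by simp
  then have d: "pd p F * G' + F * pd p G' = pd p F' * G + F' * pd p G"
    by (simp add: pd_mult)
  have "(pd p F * G - F * pd p G) * (G' * G') = (pd p F' * G' - F' * pd p G') * (G * G)"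
    using e d by (rule quotient_rule_respect)
  with nz show "fractrel (case x of (F, G) \<Rightarrow> (pd p F * G - F * pd p G, G * G))
                        (case y of (F, G) \<Rightarrow> (pd p F * G - F * pd p G, G * G))"
    by (simp add: xy)
qed

lemma fract_pd_Fract:
  "G \<noteq> 0 \<Longrightarrow> fract_pd p (Fract F G) = Fract (pd p F * G - F * pd p G) (G * G)"
  by (simp add: Fract.abs_eq fract_pd.abs_eq)

section \<open>Products of projective spaces\<close>

text \<open>
  A list \<open>ns\<close> of dimensions stands for the product of the projective spaces of dimensions \<open>ns ! i\<close>,
  \<open>i < length ns\<close>. The affine space of dimension \<open>n + 1\<close> is the set of sequences vanishing beyond
  index \<open>n\<close>; a point of projective space is the class of its homogeneous coordinate vectors.
\<close>

definition nonzero_vectors :: "nat \<Rightarrow> (nat \<Rightarrow> complex) set" where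
  "nonzero_vectors n = {v. v \<noteq> (\<lambda>_. 0) \<and> (\<forall>j>n. v j = 0)}"

definition pclass :: "(nat \<Rightarrow> complex) \<Rightarrow> (nat \<Rightarrow> complex) set" where
  "pclass v = {(\<lambda>j. c * v j) | c. c \<noteq> 0}"

definition proj_space :: "nat \<Rightarrow> (nat \<Rightarrow> complex) set set" where
  "proj_space n = pclass ` nonzero_vectors n"

text \<open>The quotient topology.\<close>

definition proj_top :: "nat \<Rightarrow> (nat \<Rightarrow> complex) set topology" where
  "proj_top n = topology (\<lambda>U. U \<subseteq> proj_space n \<and> openin (top_of_set (nonzero_vectors n)) (\<Union>U))"

lemma pclass_self: "v \<in> pclass v"
  by (auto simp: pclass_def intro!: exI[of _ 1])

lemma pclass_eq:
  assumes "w \<in> pclass v" shows "pclass w = pclass v"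
proof -
  from assms obtain c where c: "c \<noteq> 0" "w = (\<lambda>j. c * v j)" by (auto simp: pclass_def)
  have "(\<lambda>j. d * v j) \<in> pclass w" if "d \<noteq> 0" for d
    unfolding pclass_def mem_Collect_eq
    by (rule exI[of _ "d / c"]) (use that c in auto)
  moreover have "(\<lambda>j. d * w j) \<in> pclass v" if "d \<noteq> 0" for d
    unfolding pclass_def mem_Collect_eq
    by (rule exI[of _ "d * c"]) (use that c in auto)
  ultimately show ?thesis by (auto simp: pclass_def)
qed

lemma proj_space_disjoint:
  "x \<in> proj_space n \<Longrightarrow> y \<in> proj_space n \<Longrightarrow> v \<in> x \<Longrightarrow> v \<in> y \<Longrightarrow> x = y"
  unfolding proj_space_def by (metis (no_types, lifting) imageE pclass_eq)

lemma openin_proj_top: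
  "openin (proj_top n) U \<longleftrightarrow> U \<subseteq> proj_space n \<and> openin (top_of_set (nonzero_vectors n)) (\<Union>U)"
proof -
  have "istopology (\<lambda>U. U \<subseteq> proj_space n \<and> openin (top_of_set (nonzero_vectors n)) (\<Union>U))"
    unfolding istopology_def
  proof (intro conjI allI impI; (elim conjE)?)
    fix S T assume *: "S \<subseteq> proj_space n" "T \<subseteq> proj_space n"
      and "openin (top_of_set (nonzero_vectors n)) (\<Union>S)" "openin (top_of_set (nonzero_vectors n)) (\<Union>T)"
    moreover have "\<Union>(S \<inter> T) = \<Union>S \<inter> \<Union>T"
      using * by (blast dest: proj_space_disjoint)
    ultimately show "openin (top_of_set (nonzero_vectors n)) (\<Union>(S \<inter> T))" by (simp add: openin_Int)
    show "S \<inter> T \<subseteq> proj_space n" using * by blast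
  next
    fix K :: "(nat \<Rightarrow> complex) set set set"
    assume K: "\<forall>S\<in>K. S \<subseteq> proj_space n \<and> openin (top_of_set (nonzero_vectors n)) (\<Union>S)"
    then show "\<Union>K \<subseteq> proj_space n" by blast
    have "\<Union>(\<Union>K) = \<Union>((\<lambda>S. \<Union>S) ` K)" by blast
    also have "openin (top_of_set (nonzero_vectors n)) \<dots>" using K by (intro openin_Union) auto
    finally show "openin (top_of_set (nonzero_vectors n)) (\<Union>(\<Union>K))" .
  qed
  then show ?thesis by (simp add: proj_top_def)
qed

definition mproj :: "nat list \<Rightarrow> (nat \<Rightarrow> (nat \<Rightarrow> complex) set) set" where
  "mproj ns = (\<Pi>\<^sub>E i\<in>{..<length ns}. proj_space (ns ! i))"

definition mproj_top :: "nat list \<Rightarrow> (nat \<Rightarrow> (nat \<Rightarrow> complex) set) topology" where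
  "mproj_top ns = product_topology (\<lambda>i. proj_top (ns ! i)) {..<length ns}"

definition projection :: "nat \<Rightarrow> (nat \<Rightarrow> (nat \<Rightarrow> complex) set) \<Rightarrow> (nat \<Rightarrow> complex) set" where
  "projection i x = x i"

text \<open>The systems of homogeneous coordinates of a point, and the point with given coordinates.\<close>

definition hom_coords ::
    "nat list \<Rightarrow> (nat \<Rightarrow> (nat \<Rightarrow> complex) set) \<Rightarrow> (nat \<Rightarrow> nat \<Rightarrow> complex) set" where
  "hom_coords ns x = {v. \<forall>i<length ns. v i \<in> x i}"

definition mpoint :: "nat list \<Rightarrow> (nat \<Rightarrow> nat \<Rightarrow> complex) \<Rightarrow> nat \<Rightarrow> (nat \<Rightarrow> complex) set" where
  "mpoint ns v = (\<lambda>i\<in>{..<length ns}. pclass (v i))"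

definition coords :: "nat list \<Rightarrow> coord set" where
  "coords ns = {Z i j | i j. i < length ns \<and> j \<le> ns ! i}"

text \<open>Multihomogeneous of multidegree \<open>e\<close>; for \<open>e\<close> with a negative entry only \<open>0\<close> qualifies.\<close>

definition multihom :: "nat list \<Rightarrow> int list \<Rightarrow> mpoly \<Rightarrow> bool" where
  "multihom ns e P \<longleftrightarrow>
    (\<forall>m\<in>Poly_Mapping.keys P. Poly_Mapping.keys m \<subseteq> coords ns \<and>
      (\<forall>i<length ns. int (\<Sum>j\<le>ns ! i. Poly_Mapping.lookup m (Z i j)) = e ! i))"

section \<open>Differential forms in homogeneous coordinates\<close>

text \<open>
  A 1-form with coefficients in a ring is the function giving the coefficient of \<open>dZ\<close> for each
  coordinate; 2-forms and 3-forms are likewise given by their (alternating) coefficients.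
\<close>

definition dZ :: "coord \<Rightarrow> coord \<Rightarrow> mpoly" where
  "dZ p = (\<lambda>q. if q = p then 1 else 0)"

definition wedge11 :: "(coord \<Rightarrow> 'r::comm_ring_1) \<Rightarrow> (coord \<Rightarrow> 'r) \<Rightarrow> coord \<Rightarrow> coord \<Rightarrow> 'r" where
  "wedge11 \<alpha> \<beta> p q = \<alpha> p * \<beta> q - \<alpha> q * \<beta> p"

definition wedge12 ::
    "(coord \<Rightarrow> 'r::comm_ring_1) \<Rightarrow> (coord \<Rightarrow> coord \<Rightarrow> 'r) \<Rightarrow> coord \<Rightarrow> coord \<Rightarrow> coord \<Rightarrow> 'r" where
  "wedge12 \<alpha> \<beta> p q r = \<alpha> p * \<beta> q r - \<alpha> q * \<beta> p r + \<alpha> r * \<beta> p q"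

definition ext_deriv :: "(coord \<Rightarrow> mpoly) \<Rightarrow> coord \<Rightarrow> coord \<Rightarrow> mpoly" where
  "ext_deriv \<omega> p q = pd p (\<omega> q) - pd q (\<omega> p)"

text \<open>
  The global sections of the sheaf of 1-forms twisted by \<open>d\<close>: the coefficient of \<open>dZ (Z i j)\<close> is
  multihomogeneous of degree \<open>d\<close> minus the \<open>i\<close>-th standard basis vector, and the contractions
  with the radial vector fields vanish.
\<close>

definition twisted_form :: "nat list \<Rightarrow> int list \<Rightarrow> (coord \<Rightarrow> mpoly) \<Rightarrow> bool" where
  "twisted_form ns d \<omega> \<longleftrightarrow>
    length d = length ns \<and>
    (\<forall>p. p \<notin> coords ns \<longrightarrow> \<omega> p = 0) \<and>
    (\<forall>i<length ns. \<forall>j\<le>ns ! i. multihom ns (d[i := d ! i - 1]) (\<omega> (Z i j))) \<and>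
    (\<forall>i<length ns. (\<Sum>j\<le>ns ! i. Var (Z i j) * \<omega> (Z i j)) = 0)"

section \<open>Codimension one distributions\<close>

text \<open>A distribution is the class of a twisted form up to nonzero constant factors.\<close>

definition induced_by :: "(coord \<Rightarrow> mpoly) \<Rightarrow> (coord \<Rightarrow> mpoly) set" where
  "induced_by \<omega> = {(\<lambda>p. Const c * \<omega> p) | c. c \<noteq> 0}"

definition codim1_distribution :: "nat list \<Rightarrow> int list \<Rightarrow> (coord \<Rightarrow> mpoly) set \<Rightarrow> bool" where
  "codim1_distribution ns d D \<longleftrightarrow> (\<exists>\<omega>. twisted_form ns d \<omega> \<and> D = induced_by \<omega>)"

definition Sing :: "nat list \<Rightarrow> (coord \<Rightarrow> mpoly) set \<Rightarrow> (nat \<Rightarrow> (nat \<Rightarrow> complex) set) set" where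
  "Sing ns D = {x \<in> mproj ns. \<forall>\<omega>\<in>D. \<forall>v\<in>hom_coords ns x. \<forall>p\<in>coords ns. eval_mpoly v (\<omega> p) = 0}"

definition isolated_singularities :: "nat list \<Rightarrow> (coord \<Rightarrow> mpoly) set \<Rightarrow> bool" where
  "isolated_singularities ns D \<longleftrightarrow> Sing ns D \<inter> mproj_top ns derived_set_of Sing ns D = {}"

definition regular :: "nat list \<Rightarrow> (coord \<Rightarrow> mpoly) set \<Rightarrow> bool" where
  "regular ns D \<longleftrightarrow> Sing ns D = {}"

definition integrable_distribution :: "(coord \<Rightarrow> mpoly) set \<Rightarrow> bool" where
  "integrable_distribution D \<longleftrightarrow> (\<forall>\<omega>\<in>D. wedge12 \<omega> (ext_deriv \<omega>) = (\<lambda>p q r. 0))"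

definition rational_functions :: "nat list \<Rightarrow> mpoly fract set" where
  "rational_functions ns =
    {Fract F G | F G e. length e = length ns \<and> multihom ns e F \<and> multihom ns e G \<and> G \<noteq> 0}"

definition rational_first_integral :: "nat list \<Rightarrow> (coord \<Rightarrow> mpoly) set \<Rightarrow> mpoly fract \<Rightarrow> bool" where
  "rational_first_integral ns D f \<longleftrightarrow>
    f \<in> rational_functions ns \<and> (\<forall>c. f \<noteq> Fract (Const c) 1) \<and>
    (\<forall>\<omega>\<in>D. wedge11 (\<lambda>p. Fract (\<omega> p) 1) (\<lambda>p. fract_pd p f) = (\<lambda>p q. 0))"

text \<open>The ratio of the \<open>l\<close>-th by the \<open>j\<close>-th homogeneous coordinate, a function on the \<open>j\<close>-th chart.\<close>

definition affine_coord :: "nat \<Rightarrow> nat \<Rightarrow> (nat \<Rightarrow> complex) set \<Rightarrow> complex" where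
  "affine_coord j l y = (THE r. \<forall>w\<in>y. r = w l / w j)"

text \<open>
  Tangent vectors of the product at the point with coordinates \<open>v\<close> are represented by vectors \<open>u\<close>
  of the ambient affine space at \<open>v\<close>. Such a \<open>u\<close> is in the kernel of the differential of the
  \<open>i\<close>-th projection iff the image under the projection of the curve with coordinates
  \<open>v + t u\<close> has velocity \<open>0\<close> at \<open>t = 0\<close> in the affine charts.
\<close>

definition in_kernel_dprojection ::
    "nat list \<Rightarrow> nat \<Rightarrow> (nat \<Rightarrow> nat \<Rightarrow> complex) \<Rightarrow> (nat \<Rightarrow> nat \<Rightarrow> complex) \<Rightarrow> bool" where
  "in_kernel_dprojection ns i v u \<longleftrightarrow>
    (\<forall>j\<le>ns ! i. v i j \<noteq> 0 \<longrightarrow> (\<forall>l\<le>ns ! i.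
      ((\<lambda>t. affine_coord j l (projection i (mpoint ns (\<lambda>a b. v a b + t * u a b))))
        has_field_derivative 0) (at 0)))"

definition tangent_to ::
    "nat list \<Rightarrow> (coord \<Rightarrow> mpoly) set \<Rightarrow> (nat \<Rightarrow> nat \<Rightarrow> complex) \<Rightarrow> (nat \<Rightarrow> nat \<Rightarrow> complex) \<Rightarrow> bool" where
  "tangent_to ns D v u \<longleftrightarrow>
    (\<forall>\<omega>\<in>D. (\<Sum>i<length ns. \<Sum>j\<le>ns ! i. eval_mpoly v (\<omega> (Z i j)) * u i j) = 0)"

text \<open>
  The distribution given by the fibration \<open>projection i\<close>: at every point its hyperplane is the
  tangent space of the fibre through that point, the kernel of the differential.
\<close>

definition is_projection_fibration :: "nat list \<Rightarrow> nat \<Rightarrow> (coord \<Rightarrow> mpoly) set \<Rightarrow> bool" where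
  "is_projection_fibration ns i D \<longleftrightarrow>
    (\<forall>x\<in>mproj ns. \<forall>v\<in>hom_coords ns x. \<forall>u. tangent_to ns D v u \<longleftrightarrow> in_kernel_dprojection ns i v u)"

end

theory Submission
  imports Defs
begin

text \<open>
  The proof replaces the top Chern class of the twisted cotangent bundle by a positivity argument of
  Griffiths. Let a twisted form of degree \<open>d\<close> have no zero, and let \<open>p\<close> be a point where its
  Fubini--Study norm is minimal. The covariant derivative at \<open>p\<close> maps the tangent space into the
  orthogonal complement of the value of the form, so it kills some tangent vector \<open>v \<noteq> 0\<close>. Along \<open>v\<close>
  the second variation of the norm is minus the curvature, which is nonnegative if all \<open>d\<^sub>i \<ge> 2\<close>
  and vanishes only if the form at \<open>p\<close> has a single nonzero block \<open>i\<close>, \<open>v\<close> points into the same factor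
  and \<open>d\<^sub>i = 2\<close>. Giving the blocks of degree 2 a large weight excludes this case as well
  whenever these blocks have a common zero. Only the case that all \<open>d\<^sub>i\<close> are 2 needs eliminations by hand: a
  resultant of two binary quadratics on the product of three lines, and the substitution of the
  kernel of a skew matrix if a factor is a plane. Finally a block of degree at most 1 vanishes
  identically, which leaves the degrees of the pencils.
\<close>

section \<open>Linear algebra\<close>

text \<open>Degree 2 is borderline because the cotangent bundle of a projective space, twisted by 2,
  is globally generated but not positive; on a line it is even trivial, and its constant section
  pulls back to the regular distributions that remain. The kernel exists because the bundle has the
  same rank as the dimension of the space, so losing one direction in the target is enough. A large
  weight helps because the minimum of the rescaled norm must again sit in a single block of degree
  2, where the weight enters in full, whereas at a common zero of these blocks it is invisible. If
  all degrees are 2, such a common zero is already a zero of the form, so the method becomes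
  circular; this is the obstacle behind the eliminations. Bundles are avoided: everything is
  computed in homogeneous coordinates on a product of unit spheres, and the blockwise scalings enter
  as orthogonality conditions, one for each factor.\<close>

lemma underdetermined_system:
  fixes M :: "'b \<Rightarrow> 'a \<Rightarrow> 'f::field"
  assumes "finite B" "finite A" "card B < card A"
  shows "\<exists>v. (\<exists>a\<in>A. v a \<noteq> 0) \<and> (\<forall>a. a \<notin> A \<longrightarrow> v a = 0) \<and> (\<forall>b\<in>B. (\<Sum>a\<in>A. M b a * v a) = 0)"
  using assms
proof (induction B arbitrary: A M rule: finite_induct)
  case empty
  then obtain a where "a \<in> A" by fastforce
  then show ?case by (intro exI[of _ "\<lambda>x. if x \<in> A then 1 else 0"]) auto
next
  case (insert b B)
  show ?case
  proof (cases "\<forall>a\<in>A. M b a = 0")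
    case True
    obtain v where "\<exists>a\<in>A. v a \<noteq> 0" "\<forall>a. a \<notin> A \<longrightarrow> v a = 0" "\<forall>b\<in>B. (\<Sum>a\<in>A. M b a * v a) = 0"
      using insert.IH[of A M] insert.prems insert.hyps by auto
    then show ?thesis using True by (intro exI[of _ v]) auto
  next
    case False
    then obtain a0 where a0: "a0 \<in> A" "M b a0 \<noteq> 0" by auto
    define A' where "A' = A - {a0}"
    have A: "finite A'" "a0 \<notin> A'" "A = insert a0 A'" using a0 insert.prems by (auto simp: A'_def)
    then have "card B < card A'" using insert.prems insert.hyps by auto
    from insert.IH[OF A(1) this, of "\<lambda>c a. M c a - M c a0 * M b a / M b a0"]
    obtain v where v: "\<exists>a\<in>A'. v a \<noteq> 0" "\<forall>a. a \<notin> A' \<longrightarrow> v a = 0"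
      "\<And>c. c \<in> B \<Longrightarrow> (\<Sum>a\<in>A'. (M c a - M c a0 * M b a / M b a0) * v a) = 0"
      by blast
    \<comment> \<open>Back substitution: the value at the pivot \<open>a0\<close> solves row
      \<open>b\<close>; the induction hypothesis was applied to the other rows with
      \<open>a0\<close> already eliminated.\<close>
    define w where "w = v(a0 := - (\<Sum>a\<in>A'. M b a * v a) / M b a0)"
    have S: "(\<Sum>a\<in>A. M c a * w a) = M c a0 * w a0 + (\<Sum>a\<in>A'. M c a * v a)" for c
    proof -
      have "(\<Sum>a\<in>A'. M c a * w a) = (\<Sum>a\<in>A'. M c a * v a)"
        by (rule sum.cong) (use A in \<open>auto simp: w_def\<close>)
      then show ?thesis using A by simp
    qed
    have "(\<Sum>a\<in>A. M b a * w a) = 0"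
      unfolding S using a0 by (simp add: w_def)
    moreover have "(\<Sum>a\<in>A. M c a * w a) = 0" if "c \<in> B" for c
    proof -
      have "0 = (\<Sum>a\<in>A'. M c a * v a) - M c a0 / M b a0 * (\<Sum>a\<in>A'. M b a * v a)"
        unfolding v(3)[OF that, symmetric]
        by (simp add: left_diff_distrib sum_subtractf sum_distrib_left mult.assoc)
      then show ?thesis unfolding S by (simp add: w_def)
    qed
    moreover have "\<exists>a\<in>A. w a \<noteq> 0" using v(1) A by (auto simp: w_def)
    moreover have "\<forall>a. a \<notin> A \<longrightarrow> w a = 0" using v(2) A by (auto simp: w_def)
    ultimately show ?thesis by (intro exI[of _ w]) auto
  qed
qed

lemma square_system:
  fixes M :: "'b \<Rightarrow> 'a \<Rightarrow> 'f::field"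
  assumes "finite B" "finite A" "card B \<le> card A" "b0 \<in> B" "w b0 \<noteq> 0"
    and dep: "\<And>a. a \<in> A \<Longrightarrow> (\<Sum>b\<in>B. w b * M b a) = 0"
  shows "\<exists>v. (\<exists>a\<in>A. v a \<noteq> 0) \<and> (\<forall>a. a \<notin> A \<longrightarrow> v a = 0) \<and> (\<forall>b\<in>B. (\<Sum>a\<in>A. M b a * v a) = 0)"
proof -
  have "card (B - {b0}) < card A" using assms by (meson card_Diff1_less le_trans not_le)
  then obtain v where v: "\<exists>a\<in>A. v a \<noteq> 0" "\<forall>a. a \<notin> A \<longrightarrow> v a = 0"
    "\<And>b. b \<in> B - {b0} \<Longrightarrow> (\<Sum>a\<in>A. M b a * v a) = 0"
    using underdetermined_system[of "B - {b0}" A M] assms by auto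
  have "0 = (\<Sum>a\<in>A. (\<Sum>b\<in>B. w b * M b a) * v a)" using dep by simp
  also have "\<dots> = (\<Sum>b\<in>B. w b * (\<Sum>a\<in>A. M b a * v a))"
    unfolding sum_distrib_left sum_distrib_right by (subst sum.swap) (simp add: mult.assoc)
  also have "\<dots> = w b0 * (\<Sum>a\<in>A. M b0 a * v a) + (\<Sum>b\<in>B - {b0}. w b * (\<Sum>a\<in>A. M b a * v a))"
    using assms by (simp add: sum.remove)
  also have "(\<Sum>b\<in>B - {b0}. w b * (\<Sum>a\<in>A. M b a * v a)) = 0"
    by (rule sum.neutral) (use v(3) in auto)
  finally have "(\<Sum>a\<in>A. M b0 a * v a) = 0" using assms by simp
  with v show ?thesis by (intro exI[of _ v]) (metis DiffI singletonD)
qed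

section \<open>Polynomial functions and multihomogeneous forms\<close>

text \<open>Functions are used instead of polynomials as algebraic objects: later constructions
  substitute polynomial maps for coordinates and freeze some coordinates, and both stay inside this
  class by induction.\<close>

inductive polyfun :: "(('a \<Rightarrow> complex) \<Rightarrow> complex) \<Rightarrow> bool" where
  polyfun_const: "polyfun (\<lambda>u. c)"
| polyfun_coord: "polyfun (\<lambda>u. u a)"
| polyfun_add: "polyfun f \<Longrightarrow> polyfun g \<Longrightarrow> polyfun (\<lambda>u. f u + g u)"
| polyfun_mult: "polyfun f \<Longrightarrow> polyfun g \<Longrightarrow> polyfun (\<lambda>u. f u * g u)"

lemma polyfun_sum: "(\<And>i. i \<in> I \<Longrightarrow> polyfun (f i)) \<Longrightarrow> polyfun (\<lambda>u. \<Sum>i\<in>I. f i u)"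
  by (induction I rule: infinite_finite_induct) (auto intro: polyfun.intros)

lemma polyfun_prod: "(\<And>i. i \<in> I \<Longrightarrow> polyfun (f i)) \<Longrightarrow> polyfun (\<lambda>u. \<Prod>i\<in>I. f i u)"
  by (induction I rule: infinite_finite_induct) (auto intro: polyfun.intros)

lemma polyfun_power: "polyfun f \<Longrightarrow> polyfun (\<lambda>u. f u ^ n)"
  by (induction n) (auto intro: polyfun.intros)

lemma polyfun_diff:
  assumes "polyfun f" "polyfun g" shows "polyfun (\<lambda>u. f u - g u)"
proof -
  have "polyfun (\<lambda>u. f u + (-1) * g u)" by (intro polyfun.intros assms)
  then show ?thesis by simp
qed

lemma polyfun_subst:
  assumes "polyfun f" "\<And>a. polyfun (g a)"
  shows "polyfun (\<lambda>u. f (\<lambda>a. g a u))"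
  using assms(1) by induction (auto intro: polyfun.intros assms(2))

lemma polyfun_If: "(b \<Longrightarrow> polyfun f) \<Longrightarrow> (\<not> b \<Longrightarrow> polyfun g) \<Longrightarrow> polyfun (\<lambda>u. if b then f u else g u)"
  by (cases b) auto

lemmas polyfun_intros =
  polyfun.intros polyfun_sum polyfun_prod polyfun_power polyfun_diff polyfun_If

lemma continuous_on_polyfun: "polyfun f \<Longrightarrow> continuous_on S f"
  by (induction rule: polyfun.induct)
    (blast intro: continuous_on_const continuous_on_add continuous_on_mult
      continuous_on_subset[OF continuous_on_product_coordinates])+

text \<open>The gradient \<open>g\<close> is chosen before the direction \<open>v\<close>, so the
  derivative is linear in \<open>v\<close> and can be fed into linear systems; only the remainder
  \<open>q\<close> depends on \<open>v\<close>. As a polynomial in a complex \<open>t\<close> it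
  allows both comparison of coefficients and bounds on the unit disc.\<close>

lemma polyfun_expansion:
  fixes f :: "('a \<Rightarrow> complex) \<Rightarrow> complex"
  assumes "polyfun f" "finite A"
  shows "\<exists>g. \<forall>v. (\<forall>a. a \<notin> A \<longrightarrow> v a = 0) \<longrightarrow>
    (\<exists>q. \<forall>t. f (\<lambda>a. p a + t * v a) = f p + t * (\<Sum>a\<in>A. g a * v a) + t\<^sup>2 * poly q t)"
  using assms(1)
proof induction
  case (polyfun_const c)
  show ?case by (intro exI[of _ "\<lambda>_. 0"] allI impI) (auto intro: exI[of _ 0])
next
  case (polyfun_coord b)
  have "(\<Sum>a\<in>A. (if a = b then 1 else 0) * v a) = v b" if "\<forall>a. a \<notin> A \<longrightarrow> v a = 0"
    for v :: "'a \<Rightarrow> complex"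
    using that assms(2) by (simp add: if_distribR sum.delta if_distrib cong: if_cong)
  then show ?case
    by (intro exI[of _ "\<lambda>a. if a = b then 1 else 0"] allI impI) (auto intro!: exI[of _ 0])
next
  case (polyfun_add f1 f2)
  then obtain g1 g2 where
    g1: "\<And>v. (\<forall>a. a \<notin> A \<longrightarrow> v a = 0) \<Longrightarrow>
      (\<exists>q. \<forall>t. f1 (\<lambda>a. p a + t * v a) = f1 p + t * (\<Sum>a\<in>A. g1 a * v a) + t\<^sup>2 * poly q t)" and
    g2: "\<And>v. (\<forall>a. a \<notin> A \<longrightarrow> v a = 0) \<Longrightarrow>
      (\<exists>q. \<forall>t. f2 (\<lambda>a. p a + t * v a) = f2 p + t * (\<Sum>a\<in>A. g2 a * v a) + t\<^sup>2 * poly q t)"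
    by blast
  show ?case
  proof (intro exI[of _ "\<lambda>a. g1 a + g2 a"] allI impI)
    fix v :: "'a \<Rightarrow> complex" assume v: "\<forall>a. a \<notin> A \<longrightarrow> v a = 0"
    obtain q1 q2 where
      "\<And>t. f1 (\<lambda>a. p a + t * v a) = f1 p + t * (\<Sum>a\<in>A. g1 a * v a) + t\<^sup>2 * poly q1 t"
      "\<And>t. f2 (\<lambda>a. p a + t * v a) = f2 p + t * (\<Sum>a\<in>A. g2 a * v a) + t\<^sup>2 * poly q2 t"
      using g1[OF v] g2[OF v] by blast
    then show "\<exists>q. \<forall>t. f1 (\<lambda>a. p a + t * v a) + f2 (\<lambda>a. p a + t * v a) =
        f1 p + f2 p + t * (\<Sum>a\<in>A. (g1 a + g2 a) * v a) + t\<^sup>2 * poly q t"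
      by (intro exI[of _ "q1 + q2"]) (auto simp: algebra_simps sum.distrib)
  qed
next
  case (polyfun_mult f1 f2)
  then obtain g1 g2 where
    g1: "\<And>v. (\<forall>a. a \<notin> A \<longrightarrow> v a = 0) \<Longrightarrow>
      (\<exists>q. \<forall>t. f1 (\<lambda>a. p a + t * v a) = f1 p + t * (\<Sum>a\<in>A. g1 a * v a) + t\<^sup>2 * poly q t)" and
    g2: "\<And>v. (\<forall>a. a \<notin> A \<longrightarrow> v a = 0) \<Longrightarrow>
      (\<exists>q. \<forall>t. f2 (\<lambda>a. p a + t * v a) = f2 p + t * (\<Sum>a\<in>A. g2 a * v a) + t\<^sup>2 * poly q t)"
    by blast
  show ?case
  proof (intro exI[of _ "\<lambda>a. g1 a * f2 p + f1 p * g2 a"] allI impI)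
    fix v :: "'a \<Rightarrow> complex" assume v: "\<forall>a. a \<notin> A \<longrightarrow> v a = 0"
    define L1 L2 where "L1 = (\<Sum>a\<in>A. g1 a * v a)" and "L2 = (\<Sum>a\<in>A. g2 a * v a)"
    obtain q1 q2 where q:
      "\<And>t. f1 (\<lambda>a. p a + t * v a) = f1 p + t * L1 + t\<^sup>2 * poly q1 t"
      "\<And>t. f2 (\<lambda>a. p a + t * v a) = f2 p + t * L2 + t\<^sup>2 * poly q2 t"
      using g1[OF v] g2[OF v] unfolding L1_def L2_def by blast
    have L: "(\<Sum>a\<in>A. (g1 a * f2 p + f1 p * g2 a) * v a) = L1 * f2 p + f1 p * L2"
      unfolding L1_def L2_def
      by (simp add: algebra_simps sum.distrib sum_distrib_left sum_distrib_right)
    \<comment> \<open>The terms of order at least 2 of the product, divided by the square of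
      \<open>t\<close>; the constant \<open>L1 * L2\<close> comes from the two linear terms.\<close>
    define q where "q = smult (f1 p) q2 + smult (f2 p) q1 + [:L1 * L2:]
      + [:0, L1:] * q2 + [:0, L2:] * q1 + [:0, 0, 1:] * (q1 * q2)"
    have "f1 (\<lambda>a. p a + t * v a) * f2 (\<lambda>a. p a + t * v a) =
        f1 p * f2 p + t * (L1 * f2 p + f1 p * L2) + t\<^sup>2 * poly q t" for t
      unfolding q q_def by (simp add: algebra_simps power2_eq_square)
    then show "\<exists>q. \<forall>t. f1 (\<lambda>a. p a + t * v a) * f2 (\<lambda>a. p a + t * v a) =
        f1 p * f2 p + t * (\<Sum>a\<in>A. (g1 a * f2 p + f1 p * g2 a) * v a) + t\<^sup>2 * poly q t"
      unfolding L by blast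
  qed
qed

text \<open>
  Coordinates are indexed by a set \<open>A\<close>; those with the same value of \<open>\<kappa>\<close> form a block, the homogeneous
  coordinates of one factor. The degree of a form in block \<open>k\<close> is \<open>m k\<close>.
\<close>

definition form :: "'a set \<Rightarrow> ('a \<Rightarrow> 'k) \<Rightarrow> ('k \<Rightarrow> nat) \<Rightarrow> (('a \<Rightarrow> complex) \<Rightarrow> complex) \<Rightarrow> bool" where
  "form A \<kappa> m f \<longleftrightarrow> polyfun f \<and> (\<forall>u. f (\<lambda>a. if a \<in> A then u a else 0) = f u) \<and>
    (\<forall>c u. f (\<lambda>a. c (\<kappa> a) * u a) = (\<Prod>k\<in>\<kappa> ` A. c k ^ m k) * f u)"

lemma formI:
  assumes "polyfun f" "\<And>u. f (\<lambda>a. if a \<in> A then u a else 0) = f u"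
    "\<And>c u. f (\<lambda>a. c (\<kappa> a) * u a) = (\<Prod>k\<in>\<kappa> ` A. c k ^ m k) * f u"
  shows "form A \<kappa> m f"
  using assms by (simp add: form_def)

lemma form_polyfun: "form A \<kappa> m f \<Longrightarrow> polyfun f"
  and form_restrict: "form A \<kappa> m f \<Longrightarrow> f (\<lambda>a. if a \<in> A then u a else 0) = f u"
  and form_scale: "form A \<kappa> m f \<Longrightarrow> f (\<lambda>a. c (\<kappa> a) * u a) = (\<Prod>k\<in>\<kappa> ` A. c k ^ m k) * f u"
  by (auto simp: form_def)

lemma form_cong:
  assumes "form A \<kappa> m f" "\<And>a. a \<in> A \<Longrightarrow> u a = w a"
  shows "f u = f w"
proof -
  have "(\<lambda>a. if a \<in> A then u a else 0) = (\<lambda>a. if a \<in> A then w a else 0)" using assms(2) by auto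
  then show ?thesis
    using form_restrict[OF assms(1), of u] form_restrict[OF assms(1), of w] by simp
qed

text \<open>This compact set contains homogeneous coordinates of every point of the product, and on
  it the sum of the squared moduli of the coefficients is the squared Fubini-Study norm, without
  denominators. Coordinates off \<open>A\<close> are set to 0, since otherwise they would be
  unbounded in the function space.\<close>

definition spheres :: "'a set \<Rightarrow> ('a \<Rightarrow> 'k) \<Rightarrow> ('a \<Rightarrow> complex) set" where
  "spheres A \<kappa> = {u. (\<forall>a. a \<notin> A \<longrightarrow> u a = 0) \<and>
    (\<forall>k\<in>\<kappa> ` A. (\<Sum>a | a \<in> A \<and> \<kappa> a = k. (cmod (u a))\<^sup>2) = 1)}"

text \<open>The condition for a vector to represent a point of the product of projective
  spaces.\<close>

definition blocks_nonzero :: "'a set \<Rightarrow> ('a \<Rightarrow> 'k) \<Rightarrow> ('a \<Rightarrow> complex) \<Rightarrow> bool" where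
  "blocks_nonzero A \<kappa> u \<longleftrightarrow> (\<forall>k\<in>\<kappa> ` A. \<exists>a\<in>A. \<kappa> a = k \<and> u a \<noteq> 0)"

lemma spheres_blocks_nonzero:
  assumes "u \<in> spheres A \<kappa>" shows "blocks_nonzero A \<kappa> u"
proof (rule ccontr)
  assume "\<not> blocks_nonzero A \<kappa> u"
  then obtain k where k: "k \<in> \<kappa> ` A" "\<And>a. a \<in> A \<Longrightarrow> \<kappa> a = k \<Longrightarrow> u a = 0"
    by (auto simp: blocks_nonzero_def)
  have "(\<Sum>a | a \<in> A \<and> \<kappa> a = k. (cmod (u a))\<^sup>2) = 0"
    by (rule sum.neutral) (simp add: k(2))
  moreover have "(\<Sum>a | a \<in> A \<and> \<kappa> a = k. (cmod (u a))\<^sup>2) = 1"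
    using assms k(1) unfolding spheres_def by blast
  ultimately show False by simp
qed

lemma blocks_nonzero_normalize:
  fixes \<kappa> :: "'a \<Rightarrow> 'k"
  assumes "finite A" "blocks_nonzero A \<kappa> u"
  shows "\<exists>c :: 'k \<Rightarrow> complex. (\<forall>k. c k \<noteq> 0) \<and> (\<lambda>a. if a \<in> A then c (\<kappa> a) * u a else 0) \<in> spheres A \<kappa>"
proof -
  define N where "N k = (\<Sum>a | a \<in> A \<and> \<kappa> a = k. (cmod (u a))\<^sup>2)" for k
  define c where "c k = (if k \<in> \<kappa> ` A then complex_of_real (1 / sqrt (N k)) else 1)" for k
  have N: "N k > 0" if "k \<in> \<kappa> ` A" for k
  proof -
    have "\<exists>a\<in>A. \<kappa> a = k \<and> u a \<noteq> 0" using assms(2) that unfolding blocks_nonzero_def by (rule bspec)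
    then obtain a where "a \<in> A" "\<kappa> a = k" "u a \<noteq> 0" by blast
    then show ?thesis unfolding N_def by (intro sum_pos2[of _ a]) (use assms(1) in auto)
  qed
  show ?thesis
  proof (intro exI[of _ c] conjI allI)
    show "c k \<noteq> 0" for k
      by (cases "k \<in> \<kappa> ` A") (use N[of k] in \<open>simp_all add: c_def\<close>)
    have "(\<Sum>a | a \<in> A \<and> \<kappa> a = k. (cmod (if a \<in> A then c (\<kappa> a) * u a else 0))\<^sup>2) = 1"
      if "k \<in> \<kappa> ` A" for k
    proof -
      have "(\<Sum>a | a \<in> A \<and> \<kappa> a = k. (cmod (if a \<in> A then c (\<kappa> a) * u a else 0))\<^sup>2) =
          (\<Sum>a | a \<in> A \<and> \<kappa> a = k. (cmod (u a))\<^sup>2 / N k)"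
        by (rule sum.cong) (use N that in \<open>auto simp: c_def norm_mult norm_divide power_mult_distrib power_divide less_imp_le\<close>)
      also have "\<dots> = 1" using N[OF that] by (simp add: N_def flip: sum_divide_distrib)
      finally show ?thesis .
    qed
    then show "(\<lambda>a. if a \<in> A then c (\<kappa> a) * u a else 0) \<in> spheres A \<kappa>"
      by (simp add: spheres_def)
  qed
qed

lemma spheres_nonempty:
  assumes "finite A" shows "spheres A \<kappa> \<noteq> {}"
proof -
  have "blocks_nonzero A \<kappa> (\<lambda>_. 1)" by (auto simp: blocks_nonzero_def)
  then show ?thesis using blocks_nonzero_normalize[OF assms] by blast
qed

lemma compact_spheres:
  fixes \<kappa> :: "'a \<Rightarrow> 'k"
  assumes "finite A" shows "compact (spheres A \<kappa>)"
proof -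
  \<comment> \<open>A product of closed unit discs over \<open>A\<close> and of points elsewhere:
    compact by Tychonoff, although the index type may be infinite.\<close>
  define P where "P = Pi\<^sub>E (UNIV :: 'a set) (\<lambda>a. if a \<in> A then cball (0::complex) 1 else {0})"
  have "compactin (product_topology (\<lambda>_. euclidean) UNIV) P"
    unfolding P_def compactin_PiE by simp
  then have "compact P" by (simp add: euclidean_product_topology)
  moreover have "closed (spheres A \<kappa>)"
  proof -
    have "spheres A \<kappa> = (\<Inter>a\<in>-A. {u. u a = 0}) \<inter>
        (\<Inter>k\<in>\<kappa> ` A. {u. (\<Sum>a | a \<in> A \<and> \<kappa> a = k. (cmod (u a))\<^sup>2) = 1})"
      by (auto simp: spheres_def)
    also have "closed \<dots>"
      by (intro closed_Int closed_INT ballI closed_Collect_eq continuous_on_sum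
          continuous_on_power continuous_on_norm continuous_on_const continuous_on_product_coordinates)
    finally show ?thesis .
  qed
  moreover have "spheres A \<kappa> \<subseteq> P"
  proof
    fix u assume u: "u \<in> spheres A \<kappa>"
    have "cmod (u a) \<le> 1" if "a \<in> A" for a
    proof -
      have "(cmod (u a))\<^sup>2 \<le> (\<Sum>b | b \<in> A \<and> \<kappa> b = \<kappa> a. (cmod (u b))\<^sup>2)"
        by (rule member_le_sum) (use that assms in auto)
      also have "\<dots> = 1" using u that by (auto simp: spheres_def)
      finally show ?thesis by (simp add: abs_square_le_1)
    qed
    then show "u \<in> P" using u by (auto simp: P_def spheres_def)
  qed
  ultimately show ?thesis using compact_Int_closed[of P "spheres A \<kappa>"] by (simp add: Int_absorb1)
qed

section \<open>Second variation at a minimum\<close>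

lemma norm_add_squared: "(cmod (x + y))\<^sup>2 = (cmod x)\<^sup>2 + (cmod y)\<^sup>2 + 2 * Re (y * cnj x)"
  by (simp add: cmod_power2 power2_sum algebra_simps)

lemma norm_parallelogram: "(cmod (x + y))\<^sup>2 + (cmod (x - y))\<^sup>2 = 2 * (cmod x)\<^sup>2 + 2 * (cmod y)\<^sup>2"
  using norm_add_squared[of x y] norm_add_squared[of x "-y"] by simp

lemma poly_bounded_on_disc:
  fixes q :: "complex poly"
  shows "\<exists>Q. \<forall>t. cmod t \<le> 1 \<longrightarrow> cmod (poly q t) \<le> Q"
proof -
  have "bounded (poly q ` cball 0 1)"
    by (intro compact_imp_bounded compact_continuous_image) (auto intro: continuous_intros)
  then obtain Q where "\<forall>x\<in>poly q ` cball 0 1. cmod x \<le> Q" unfolding bounded_iff by blast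
  then show ?thesis by (intro exI[of _ Q]) simp
qed

lemma one_add_sum_le_prod:
  fixes x :: "'k \<Rightarrow> real"
  assumes "\<And>k. k \<in> K \<Longrightarrow> x k \<ge> 0"
  shows "1 + (\<Sum>k\<in>K. x k) \<le> (\<Prod>k\<in>K. 1 + x k)"
  using assms
proof (induction K rule: infinite_finite_induct)
  case (insert k K)
  have "x k * 1 \<le> x k * (\<Prod>k\<in>K. 1 + x k)"
    using insert.prems by (intro mult_left_mono prod_ge_1) auto
  with insert show ?case by (simp add: algebra_simps)
qed auto

text \<open>In the sum over the four directions the odd powers of \<open>t\<close> cancel, and so
  does the mixed term of \<open>s\<close> with the quadratic coefficient, because the squares of the
  directions are 1, 1, -1, -1. At second order only the derivative \<open>l\<close> is left. The
  complex directions are essential: a real pair would retain the mixed term.\<close>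

lemma four_point_bound:
  fixes s l :: complex and q :: "complex poly"
  shows "\<exists>C. \<forall>r\<in>{0..1}. (\<Sum>\<zeta>\<in>{1, -1, \<i>, -\<i>}.
    (cmod (s + of_real r * \<zeta> * l + (of_real r * \<zeta>)\<^sup>2 * poly q (of_real r * \<zeta>)))\<^sup>2)
      \<le> 4 * (cmod s)\<^sup>2 + 4 * r\<^sup>2 * (cmod l)\<^sup>2 + C * r ^ 3"
proof -
  obtain c q1 where q: "q = pCons c q1" by (cases q)
  obtain Q where Q: "\<And>t. cmod t \<le> 1 \<Longrightarrow> cmod (poly q1 t) \<le> Q"
    using poly_bounded_on_disc by blast
  have Q0: "Q \<ge> 0" by (rule order_trans[OF norm_ge_zero Q[of 0]]) simp
  define G where "G t = s + t * l + t\<^sup>2 * c" for t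
  define B where "B = cmod s + cmod l + cmod c"
  have B0: "B \<ge> 0" by (simp add: B_def)
  have G: "cmod (G t) \<le> B" if "cmod t \<le> 1" for t
  proof -
    have "cmod (G t) \<le> cmod s + cmod (t * l) + cmod (t\<^sup>2 * c)"
      unfolding G_def by (intro norm_triangle_le add_mono order_refl)
    also have "\<dots> \<le> B" unfolding B_def norm_mult norm_power
      using that by (intro add_mono order_refl mult_left_le_one_le) (auto simp: power_le_one)
    finally show ?thesis .
  qed
  have one: "(cmod (s + t * l + t\<^sup>2 * poly q t))\<^sup>2 \<le> (cmod (G t))\<^sup>2 + (2 * B * Q + Q\<^sup>2) * r ^ 3"
    if t: "cmod t = r" "r \<le> 1" "r \<ge> 0" for t r
  proof -
    \<comment> \<open>Only the quadratic part \<open>G\<close> is averaged exactly. The rest has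
      order 3, and a uniform bound on the disc suffices for it.\<close>
    have e: "s + t * l + t\<^sup>2 * poly q t = G t + t ^ 3 * poly q1 t"
      by (simp add: q G_def algebra_simps power2_eq_square power3_eq_cube)
    have n: "cmod (t ^ 3 * poly q1 t) \<le> r ^ 3 * Q"
      using Q t by (auto simp: norm_mult norm_power intro!: mult_left_mono)
    have "cmod (s + t * l + t\<^sup>2 * poly q t) \<le> cmod (G t) + r ^ 3 * Q"
      unfolding e by (rule norm_triangle_mono[OF order_refl n])
    then have "(cmod (s + t * l + t\<^sup>2 * poly q t))\<^sup>2 \<le> (cmod (G t) + r ^ 3 * Q)\<^sup>2"
      by (intro power_mono) auto
    also have "\<dots> = (cmod (G t))\<^sup>2 + 2 * cmod (G t) * Q * r ^ 3 + (r ^ 3 * r ^ 3) * Q\<^sup>2"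
      by (simp add: power2_eq_square algebra_simps)
    also have "\<dots> \<le> (cmod (G t))\<^sup>2 + 2 * B * Q * r ^ 3 + (r ^ 3 * 1) * Q\<^sup>2"
      using t G[of t] Q0 B0 by (intro add_mono mult_mono order_refl) (auto simp: power_le_one)
    finally show ?thesis by (simp add: algebra_simps)
  qed
  have four: "(cmod (G r))\<^sup>2 + (cmod (G (-r)))\<^sup>2 + (cmod (G (r * \<i>)))\<^sup>2 + (cmod (G (-(r * \<i>))))\<^sup>2
    = 4 * (cmod s)\<^sup>2 + 4 * r\<^sup>2 * (cmod l)\<^sup>2 + 4 * r ^ 4 * (cmod c)\<^sup>2" for r :: real
  proof -
    define x where "x = complex_of_real r * l"
    define y where "y = (complex_of_real r)\<^sup>2 * c"
    \<comment> \<open>The parallelogram law applies to each opposite pair, and then once more to the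
      two centres \<open>s + y\<close> and \<open>s - y\<close>.\<close>
    have "G r = (s + y) + x" "G (-r) = (s + y) - x" "G (r * \<i>) = (s - y) + \<i> * x" "G (-(r * \<i>)) = (s - y) - \<i> * x"
      by (simp_all add: G_def x_def y_def power_mult_distrib)
    moreover have "(cmod (\<i> * x))\<^sup>2 = (cmod x)\<^sup>2" "(cmod x)\<^sup>2 = r\<^sup>2 * (cmod l)\<^sup>2" "(cmod y)\<^sup>2 = r ^ 4 * (cmod c)\<^sup>2"
      by (simp_all add: x_def y_def norm_mult norm_power power_mult_distrib)
    ultimately show ?thesis
      using norm_parallelogram[of "s + y" x] norm_parallelogram[of "s - y" "\<i> * x"] norm_parallelogram[of s y]
      by simp
  qed
  show ?thesis
  proof (intro exI[of _ "4 * (cmod c)\<^sup>2 + 4 * (2 * B * Q + Q\<^sup>2)"] ballI)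
    fix r :: real assume r: "r \<in> {0..1}"
    define F where "F t = (cmod (s + t * l + t\<^sup>2 * poly q t))\<^sup>2" for t
    have F: "F t \<le> (cmod (G t))\<^sup>2 + (2 * B * Q + Q\<^sup>2) * r ^ 3" if "cmod t = r" for t
      using one[OF that] r by (simp add: F_def)
    have "(\<Sum>\<zeta>\<in>{1, -1, \<i>, -\<i>}.
        (cmod (s + of_real r * \<zeta> * l + (of_real r * \<zeta>)\<^sup>2 * poly q (of_real r * \<zeta>)))\<^sup>2) =
        F r + F (-r) + F (r * \<i>) + F (-(r * \<i>))"
      by (simp add: F_def complex_eq_iff)
    also have "\<dots> \<le> 4 * (cmod s)\<^sup>2 + 4 * r\<^sup>2 * (cmod l)\<^sup>2 + 4 * r ^ 4 * (cmod c)\<^sup>2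
        + 4 * ((2 * B * Q + Q\<^sup>2) * r ^ 3)"
      unfolding four[symmetric]
      using F[of r] F[of "-r"] F[of "r * \<i>"] F[of "-(r * \<i>)"] r by (simp add: norm_mult)
    also have "4 * r ^ 4 * (cmod c)\<^sup>2 \<le> 4 * r ^ 3 * (cmod c)\<^sup>2"
      using r by (intro mult_right_mono mult_left_mono power_decreasing) auto
    finally show "(\<Sum>\<zeta>\<in>{1, -1, \<i>, -\<i>}.
        (cmod (s + of_real r * \<zeta> * l + (of_real r * \<zeta>)\<^sup>2 * poly q (of_real r * \<zeta>)))\<^sup>2)
        \<le> 4 * (cmod s)\<^sup>2 + 4 * r\<^sup>2 * (cmod l)\<^sup>2
          + (4 * (cmod c)\<^sup>2 + 4 * (2 * B * Q + Q\<^sup>2)) * r ^ 3"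
      by (simp add: algebra_simps)
  qed
qed

lemma first_order_bound:
  fixes s l :: complex and q :: "complex poly"
  shows "\<exists>C\<ge>0. \<forall>t. cmod t \<le> 1 \<longrightarrow>
    (cmod (s + t * l + t\<^sup>2 * poly q t))\<^sup>2 \<le> (cmod s)\<^sup>2 + 2 * Re (t * (l * cnj s)) + C * (cmod t)\<^sup>2"
proof -
  obtain Q where Q: "\<And>t. cmod t \<le> 1 \<Longrightarrow> cmod (poly q t) \<le> Q"
    using poly_bounded_on_disc by blast
  have Q0: "Q \<ge> 0" by (rule order_trans[OF norm_ge_zero Q[of 0]]) simp
  show ?thesis
  proof (intro exI[of _ "(cmod l + Q)\<^sup>2 + 2 * (Q * cmod s)"] conjI allI impI)
    fix t :: complex assume t: "cmod t \<le> 1"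
    define y where "y = t * l + t\<^sup>2 * poly q t"
    have "cmod y \<le> cmod t * cmod l + cmod t * (cmod t * cmod (poly q t))"
      unfolding y_def by (rule norm_triangle_le) (simp add: norm_mult norm_power power2_eq_square)
    also have "\<dots> \<le> cmod t * cmod l + cmod t * (1 * Q)"
      using t Q[OF t] by (intro add_mono mult_mono order_refl) auto
    finally have "cmod y \<le> cmod t * (cmod l + Q)" by (simp add: algebra_simps)
    from power_mono[OF this norm_ge_zero, of 2]
    have y: "(cmod y)\<^sup>2 \<le> (cmod t)\<^sup>2 * (cmod l + Q)\<^sup>2" by (simp add: power_mult_distrib)
    have "Re (t\<^sup>2 * poly q t * cnj s) \<le> cmod (t\<^sup>2 * poly q t * cnj s)" by (rule complex_Re_le_cmod)
    also have "\<dots> = (cmod t)\<^sup>2 * (cmod (poly q t) * cmod s)" by (simp add: norm_mult norm_power)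
    also have "\<dots> \<le> (cmod t)\<^sup>2 * (Q * cmod s)" using Q[OF t] by (intro mult_left_mono mult_right_mono) auto
    finally have "Re (y * cnj s) \<le> Re (t * (l * cnj s)) + (cmod t)\<^sup>2 * (Q * cmod s)"
      unfolding y_def distrib_right by (simp add: mult.assoc)
    with y show "(cmod (s + t * l + t\<^sup>2 * poly q t))\<^sup>2 \<le>
        (cmod s)\<^sup>2 + 2 * Re (t * (l * cnj s)) + ((cmod l + Q)\<^sup>2 + 2 * (Q * cmod s)) * (cmod t)\<^sup>2"
      using norm_add_squared[of s y] unfolding y_def[symmetric] add.assoc
      by (simp add: algebra_simps)
  qed (use Q0 in auto)
qed

text \<open>
  Following Griffiths, the minimum of the norm of a section is tested against a tangent
  vector \<open>v\<close> whose curve \<open>p + t v\<close>, rescaled blockwise, stays on the spheres; averaging over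
  \<open>t, -t, it, -it\<close> leaves the curvature, that is the degrees, against the first derivatives \<open>l\<close>.
\<close>

lemma second_variation:
  fixes f :: "'i \<Rightarrow> ('a \<Rightarrow> complex) \<Rightarrow> complex" and \<kappa> :: "'a \<Rightarrow> 'k"
  assumes fin: "finite A" "finite I"
    and p: "p \<in> spheres A \<kappa>"
    and min: "\<And>u. u \<in> spheres A \<kappa> \<Longrightarrow> (\<Sum>i\<in>I. (cmod (f i p))\<^sup>2) \<le> (\<Sum>i\<in>I. (cmod (f i u))\<^sup>2)"
    and form: "\<And>i. i \<in> I \<Longrightarrow> form A \<kappa> (m i) (f i)"
    and supp: "\<And>a. a \<notin> A \<Longrightarrow> v a = 0"
    and tangent: "\<And>k. k \<in> \<kappa> ` A \<Longrightarrow> (\<Sum>a | a \<in> A \<and> \<kappa> a = k. v a * cnj (p a)) = 0"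
    and expansion: "\<And>i t. i \<in> I \<Longrightarrow> f i (\<lambda>a. p a + t * v a) = f i p + t * l i + t\<^sup>2 * poly (q i) t"
  defines "N \<equiv> \<lambda>k. \<Sum>a | a \<in> A \<and> \<kappa> a = k. (cmod (v a))\<^sup>2"
  shows "(\<Sum>i\<in>I. l i * cnj (f i p)) = 0"
    and "(\<Sum>i\<in>I. (cmod (f i p))\<^sup>2 * (\<Sum>k\<in>\<kappa> ` A. real (m i k) * N k)) \<le> (\<Sum>i\<in>I. (cmod (l i))\<^sup>2)"
proof -
  define K where "K = \<kappa> ` A"
  have finK: "finite K" using fin by (simp add: K_def)
  define F where "F i t = f i (\<lambda>a. p a + t * v a)" for i t
  \<comment> \<open>Rescaling \<open>p + t * v\<close> to the spheres divides the squared norm of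
    the value by this factor, with \<open>x\<close> the squared modulus of \<open>t\<close>.\<close>
  define W where "W i x = (\<Prod>k\<in>K. (1 + x * N k) ^ m i k)" for i x
  define \<mu> where "\<mu> = (\<Sum>i\<in>I. (cmod (f i p))\<^sup>2)"
  have N0: "N k \<ge> 0" for k unfolding N_def by (intro sum_nonneg) auto
  have W1: "1 + x * (\<Sum>k\<in>K. real (m i k) * N k) \<le> W i x" if "x \<ge> 0" for i x
  proof -
    have "1 + (\<Sum>k\<in>K. x * (real (m i k) * N k)) \<le> (\<Prod>k\<in>K. 1 + x * (real (m i k) * N k))"
      by (rule one_add_sum_le_prod) (use that N0 in auto)
    also have "\<dots> \<le> W i x" unfolding W_def
    proof (intro prod_mono conjI)
      fix k assume "k \<in> K"
      show "1 + x * (real (m i k) * N k) \<le> (1 + x * N k) ^ m i k"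
        using Bernoulli_inequality[of "x * N k" "m i k"] that N0[of k]
        by (simp add: mult.commute mult.left_commute order_trans[of "-1" 0])
    qed (use that N0 in auto)
    finally show ?thesis by (simp add: sum_distrib_left)
  qed
  have M0: "(\<Sum>k\<in>K. real (m i k) * N k) \<ge> 0" for i using N0 by (intro sum_nonneg) auto
  have Wpos: "W i x \<ge> 1" if "x \<ge> 0" for i x
    using W1[OF that, of i] M0[of i] that mult_nonneg_nonneg[of x "\<Sum>k\<in>K. real (m i k) * N k"] by linarith
  \<comment> \<open>Orthogonality of \<open>v\<close> to \<open>p\<close> removes the cross term, so
    the norm of each block depends on \<open>t\<close> only through its modulus and one
    normalization serves all four directions.\<close>
  have blk: "(\<Sum>a | a \<in> A \<and> \<kappa> a = k. (cmod (p a + t * v a))\<^sup>2) = 1 + (cmod t)\<^sup>2 * N k"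
    if "k \<in> K" for k t
  proof -
    have "(\<Sum>a | a \<in> A \<and> \<kappa> a = k. (cmod (p a + t * v a))\<^sup>2) =
        (\<Sum>a | a \<in> A \<and> \<kappa> a = k. (cmod (p a))\<^sup>2) + (cmod t)\<^sup>2 * N k
        + 2 * Re (t * (\<Sum>a | a \<in> A \<and> \<kappa> a = k. v a * cnj (p a)))"
      unfolding norm_add_squared N_def
      by (simp add: sum.distrib sum_distrib_left norm_mult power_mult_distrib mult.assoc)
    moreover have "(\<Sum>a | a \<in> A \<and> \<kappa> a = k. (cmod (p a))\<^sup>2) = 1"
      using p that unfolding spheres_def K_def by blast
    ultimately show ?thesis using tangent that unfolding K_def by simp
  qed
  have main: "\<mu> \<le> (\<Sum>i\<in>I. (cmod (F i t))\<^sup>2 / W i ((cmod t)\<^sup>2))" for t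
  proof -
    define c where "c k = complex_of_real (1 / sqrt (1 + (cmod t)\<^sup>2 * N k))" for k
    define u where "u = (\<lambda>a. c (\<kappa> a) * (p a + t * v a))"
    have pos: "1 + (cmod t)\<^sup>2 * N k > 0" for k using N0[of k] by (simp add: add_pos_nonneg)
    have c2: "(cmod (c k))\<^sup>2 = 1 / (1 + (cmod t)\<^sup>2 * N k)" for k
      using pos[of k] by (simp add: c_def norm_divide power_divide)
    have "u \<in> spheres A \<kappa>"
    proof -
      have "(\<Sum>a | a \<in> A \<and> \<kappa> a = k. (cmod (u a))\<^sup>2) = 1" if "k \<in> K" for k
      proof -
        have "(\<Sum>a | a \<in> A \<and> \<kappa> a = k. (cmod (u a))\<^sup>2) =
            (\<Sum>a | a \<in> A \<and> \<kappa> a = k. (cmod (c k))\<^sup>2 * (cmod (p a + t * v a))\<^sup>2)"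
          by (rule sum.cong) (auto simp: u_def norm_mult power_mult_distrib)
        also have "\<dots> = (cmod (c k))\<^sup>2 * (1 + (cmod t)\<^sup>2 * N k)"
          unfolding sum_distrib_left[symmetric] blk[OF that] ..
        finally show ?thesis using pos[of k] by (simp add: c2)
      qed
      then show ?thesis using p supp unfolding spheres_def K_def u_def by simp
    qed
    then have "\<mu> \<le> (\<Sum>i\<in>I. (cmod (f i u))\<^sup>2)" unfolding \<mu>_def by (rule min)
    also have "\<dots> = (\<Sum>i\<in>I. (cmod (F i t))\<^sup>2 / W i ((cmod t)\<^sup>2))"
    proof (rule sum.cong[OF refl])
      fix i assume i: "i \<in> I"
      have "f i u = (\<Prod>k\<in>K. c k ^ m i k) * F i t"
        unfolding u_def F_def K_def by (rule form_scale[OF form[OF i]])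
      then have "(cmod (f i u))\<^sup>2 = (\<Prod>k\<in>K. ((cmod (c k))\<^sup>2) ^ m i k) * (cmod (F i t))\<^sup>2"
        by (simp add: norm_mult power_mult_distrib norm_power power_mult[symmetric] mult.commute
            prod_power_distrib flip: prod_norm)
      also have "(\<Prod>k\<in>K. ((cmod (c k))\<^sup>2) ^ m i k) = 1 / W i ((cmod t)\<^sup>2)"
        unfolding c2 W_def by (simp add: power_one_over prod_dividef)
      finally show "(cmod (f i u))\<^sup>2 = (cmod (F i t))\<^sup>2 / W i ((cmod t)\<^sup>2)" by simp
    qed
    finally show ?thesis .
  qed
  have F: "F i t = f i p + t * l i + t\<^sup>2 * poly (q i) t" if "i \<in> I" for i t
    unfolding F_def using expansion[OF that] .
  have main': "\<mu> \<le> (\<Sum>i\<in>I. (cmod (F i t))\<^sup>2)" for t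
  proof -
    have "(\<Sum>i\<in>I. (cmod (F i t))\<^sup>2 / W i ((cmod t)\<^sup>2)) \<le> (\<Sum>i\<in>I. (cmod (F i t))\<^sup>2)"
    proof (rule sum_mono)
      fix i
      show "(cmod (F i t))\<^sup>2 / W i ((cmod t)\<^sup>2) \<le> (cmod (F i t))\<^sup>2"
        using Wpos[of "(cmod t)\<^sup>2" i] by (simp add: divide_le_eq mult_le_cancel_left1)
    qed
    with main[of t] show ?thesis by linarith
  qed
  show "(\<Sum>i\<in>I. l i * cnj (f i p)) = 0"
  proof (rule ccontr)
    define S where "S = (\<Sum>i\<in>I. l i * cnj (f i p))"
    assume "(\<Sum>i\<in>I. l i * cnj (f i p)) \<noteq> 0"
    then have S: "cmod S > 0" by (simp add: S_def)
    have "\<forall>i. \<exists>C. C \<ge> 0 \<and> (\<forall>t. cmod t \<le> 1 \<longrightarrow>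
        (cmod (f i p + t * l i + t\<^sup>2 * poly (q i) t))\<^sup>2 \<le>
        (cmod (f i p))\<^sup>2 + 2 * Re (t * (l i * cnj (f i p))) + C * (cmod t)\<^sup>2)"
      using first_order_bound by auto
    from choice[OF this] obtain C where C: "\<And>i. C i \<ge> 0" "\<And>i t. cmod t \<le> 1 \<Longrightarrow>
        (cmod (f i p + t * l i + t\<^sup>2 * poly (q i) t))\<^sup>2 \<le>
        (cmod (f i p))\<^sup>2 + 2 * Re (t * (l i * cnj (f i p))) + C i * (cmod t)\<^sup>2"
      by blast
    define D where "D = (\<Sum>i\<in>I. C i)"
    have D0: "D \<ge> 0" unfolding D_def by (intro sum_nonneg C)
    \<comment> \<open>Step length for a move against the gradient: \<open>r * cmod S \<le> 1\<close>
      keeps \<open>t\<close> in the unit disc, and \<open>r * D < 1\<close> makes the quadratic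
      error smaller than the first-order gain.\<close>
    define r where "r = 1 / (1 + D + cmod S)"
    have pos: "1 + D + cmod S > 0" using D0 S by linarith
    have r: "r > 0" "r * cmod S \<le> 1" "r * D < 1" 
      unfolding r_def using D0 S pos by (simp_all add: divide_le_eq divide_less_eq add_pos_nonneg)
    define t where "t = - (of_real r * cnj S)"
    have t: "cmod t = r * cmod S" using r by (simp add: t_def norm_mult)
    have "\<mu> \<le> (\<Sum>i\<in>I. (cmod (f i p))\<^sup>2 + 2 * Re (t * (l i * cnj (f i p))) + C i * (cmod t)\<^sup>2)"
      by (rule order_trans[OF main'[of t]], rule sum_mono) (use F C(2)[of t] t r in simp)
    also have "\<dots> = \<mu> + 2 * Re (t * S) + D * (cmod t)\<^sup>2"
      by (simp add: sum.distrib \<mu>_def S_def D_def sum_distrib_left sum_distrib_right)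
    also have "Re (t * S) = - (r * (cmod S)\<^sup>2)"
      unfolding cmod_power2 by (simp add: t_def power2_eq_square algebra_simps)
    finally have "2 * (r * (cmod S)\<^sup>2) \<le> (r * D) * (r * (cmod S)\<^sup>2)"
      unfolding t by (simp add: power2_eq_square algebra_simps)
    also have "\<dots> < 1 * (r * (cmod S)\<^sup>2)" using r S by (intro mult_strict_right_mono) auto
    finally show False using r S by simp
  qed
  define M where "M i = (\<Sum>k\<in>K. real (m i k) * N k)" for i
  have "\<forall>i. \<exists>C. \<forall>r\<in>{0..1}. (\<Sum>\<zeta>\<in>{1, -1, \<i>, -\<i>}.
    (cmod (f i p + of_real r * \<zeta> * l i + (of_real r * \<zeta>)\<^sup>2 * poly (q i) (of_real r * \<zeta>)))\<^sup>2)
      \<le> 4 * (cmod (f i p))\<^sup>2 + 4 * r\<^sup>2 * (cmod (l i))\<^sup>2 + C * r ^ 3"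
    by (rule allI, rule four_point_bound)
  from choice[OF this] obtain C where C: "\<And>i r. r \<in> {0..1} \<Longrightarrow> (\<Sum>\<zeta>\<in>{1, -1, \<i>, -\<i>}.
    (cmod (f i p + of_real r * \<zeta> * l i + (of_real r * \<zeta>)\<^sup>2 * poly (q i) (of_real r * \<zeta>)))\<^sup>2)
      \<le> 4 * (cmod (f i p))\<^sup>2 + 4 * r\<^sup>2 * (cmod (l i))\<^sup>2 + C i * r ^ 3"
    by blast
  \<comment> \<open>The comparison at radius \<open>r\<close>, already divided by the square of
    \<open>r\<close>, so that the limit at 0 compares second derivatives.\<close>
  have key: "(\<Sum>i\<in>I. 4 * (cmod (f i p))\<^sup>2 * (M i / (1 + r\<^sup>2 * M i))) \<le>
      (\<Sum>i\<in>I. (4 * (cmod (l i))\<^sup>2 + \<bar>C i\<bar> * r))" if r: "r \<in> {0<..1}" for r :: real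
  proof -
    have r': "r \<in> {0..1}" using r by auto
    have "4 * \<mu> = (\<Sum>\<zeta>\<in>{1, -1, \<i>, -\<i>}. \<mu>)" by (simp add: complex_eq_iff)
    also have "\<dots> \<le> (\<Sum>\<zeta>\<in>{1, -1, \<i>, -\<i>}. (\<Sum>i\<in>I. (cmod (F i (of_real r * \<zeta>)))\<^sup>2 / W i (r\<^sup>2)))"
    proof (rule sum_mono)
      fix \<zeta> assume "\<zeta> \<in> {1, -1, \<i>, -\<i>}"
      then have "cmod (of_real r * \<zeta>) = r" using r by (auto simp: norm_mult)
      then show "\<mu> \<le> (\<Sum>i\<in>I. (cmod (F i (of_real r * \<zeta>)))\<^sup>2 / W i (r\<^sup>2))"
        using main[of "of_real r * \<zeta>"] by simp
    qed
    also have "\<dots> = (\<Sum>i\<in>I. (\<Sum>\<zeta>\<in>{1, -1, \<i>, -\<i>}. (cmod (F i (of_real r * \<zeta>)))\<^sup>2) / W i (r\<^sup>2))"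
      by (subst sum.swap) (simp only: sum_divide_distrib)
    also have "\<dots> \<le> (\<Sum>i\<in>I. 4 * (cmod (f i p))\<^sup>2 / (1 + r\<^sup>2 * M i) + (4 * r\<^sup>2 * (cmod (l i))\<^sup>2 + \<bar>C i\<bar> * r ^ 3))"
    proof (rule sum_mono)
      fix i assume i: "i \<in> I"
      have W: "1 \<le> W i (r\<^sup>2)" "1 + r\<^sup>2 * M i \<le> W i (r\<^sup>2)"
        using Wpos W1 by (auto simp: M_def)
      have M: "1 + r\<^sup>2 * M i > 0" using M0[of i] by (simp add: M_def add_pos_nonneg)
      have "(\<Sum>\<zeta>\<in>{1, -1, \<i>, -\<i>}. (cmod (F i (of_real r * \<zeta>)))\<^sup>2) / W i (r\<^sup>2) \<le>
          (4 * (cmod (f i p))\<^sup>2 + 4 * r\<^sup>2 * (cmod (l i))\<^sup>2 + C i * r ^ 3) / W i (r\<^sup>2)"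
        unfolding F[OF i] using C[OF r', of i] W by (intro divide_right_mono) auto
      also have "\<dots> \<le> (4 * (cmod (f i p))\<^sup>2 + (4 * r\<^sup>2 * (cmod (l i))\<^sup>2 + \<bar>C i\<bar> * r ^ 3)) / W i (r\<^sup>2)"
        using W r by (intro divide_right_mono) (auto simp: mult_right_mono)
      also have "\<dots> = 4 * (cmod (f i p))\<^sup>2 / W i (r\<^sup>2) + (4 * r\<^sup>2 * (cmod (l i))\<^sup>2 + \<bar>C i\<bar> * r ^ 3) / W i (r\<^sup>2)"
        by (rule add_divide_distrib)
      also have "\<dots> \<le> 4 * (cmod (f i p))\<^sup>2 / (1 + r\<^sup>2 * M i) + (4 * r\<^sup>2 * (cmod (l i))\<^sup>2 + \<bar>C i\<bar> * r ^ 3) / 1"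
        using W M r by (intro add_mono divide_left_mono) (auto intro!: mult_pos_pos add_nonneg_nonneg)
      finally show "(\<Sum>\<zeta>\<in>{1, -1, \<i>, -\<i>}. (cmod (F i (of_real r * \<zeta>)))\<^sup>2) / W i (r\<^sup>2) \<le>
          4 * (cmod (f i p))\<^sup>2 / (1 + r\<^sup>2 * M i) + (4 * r\<^sup>2 * (cmod (l i))\<^sup>2 + \<bar>C i\<bar> * r ^ 3)"
        by simp
    qed
    finally have "0 \<le> (\<Sum>i\<in>I. 4 * (cmod (f i p))\<^sup>2 / (1 + r\<^sup>2 * M i)
        + (4 * r\<^sup>2 * (cmod (l i))\<^sup>2 + \<bar>C i\<bar> * r ^ 3) - 4 * (cmod (f i p))\<^sup>2)"
      by (simp add: sum_subtractf \<mu>_def sum_distrib_left)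
    also have "\<dots> = (\<Sum>i\<in>I. r\<^sup>2 * ((4 * (cmod (l i))\<^sup>2 + \<bar>C i\<bar> * r)
        - 4 * (cmod (f i p))\<^sup>2 * (M i / (1 + r\<^sup>2 * M i))))"
    proof (rule sum.cong[OF refl])
      fix i
      have M: "1 + r\<^sup>2 * M i > 0" using M0[of i] by (simp add: M_def add_pos_nonneg)
      have "4 * (cmod (f i p))\<^sup>2 / (1 + r\<^sup>2 * M i) - 4 * (cmod (f i p))\<^sup>2 =
          - (r\<^sup>2 * (4 * (cmod (f i p))\<^sup>2 * (M i / (1 + r\<^sup>2 * M i))))"
        using M by (simp add: field_simps)
      then show "4 * (cmod (f i p))\<^sup>2 / (1 + r\<^sup>2 * M i)
        + (4 * r\<^sup>2 * (cmod (l i))\<^sup>2 + \<bar>C i\<bar> * r ^ 3) - 4 * (cmod (f i p))\<^sup>2 =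
        r\<^sup>2 * ((4 * (cmod (l i))\<^sup>2 + \<bar>C i\<bar> * r) - 4 * (cmod (f i p))\<^sup>2 * (M i / (1 + r\<^sup>2 * M i)))"
        by (simp add: algebra_simps power2_eq_square power3_eq_cube)
    qed
    finally show ?thesis
      using r by (simp add: sum_subtractf zero_le_mult_iff flip: sum_distrib_left)
  qed
  \<comment> \<open>The limit values are written with 0 in place of \<open>r\<close>, the form in
    which the limit rules for sums, products and quotients deliver them.\<close>
  have "(\<Sum>i\<in>I. 4 * (cmod (f i p))\<^sup>2 * (M i / (1 + 0\<^sup>2 * M i))) \<le> (\<Sum>i\<in>I. (4 * (cmod (l i))\<^sup>2 + \<bar>C i\<bar> * 0))"
  proof (rule tendsto_le[of "at_right (0::real)"])
    show "((\<lambda>r. \<Sum>i\<in>I. 4 * (cmod (l i))\<^sup>2 + \<bar>C i\<bar> * r) \<longlongrightarrow> (\<Sum>i\<in>I. 4 * (cmod (l i))\<^sup>2 + \<bar>C i\<bar> * 0)) (at_right 0)"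
      by (intro tendsto_intros)
    show "((\<lambda>r. \<Sum>i\<in>I. 4 * (cmod (f i p))\<^sup>2 * (M i / (1 + r\<^sup>2 * M i))) \<longlongrightarrow>
        (\<Sum>i\<in>I. 4 * (cmod (f i p))\<^sup>2 * (M i / (1 + 0\<^sup>2 * M i)))) (at_right 0)"
      by (intro tendsto_intros) auto
    show "\<forall>\<^sub>F r in at_right 0. (\<Sum>i\<in>I. 4 * (cmod (f i p))\<^sup>2 * (M i / (1 + r\<^sup>2 * M i)))
        \<le> (\<Sum>i\<in>I. 4 * (cmod (l i))\<^sup>2 + \<bar>C i\<bar> * r)"
      unfolding eventually_at_right_field using key by (intro exI[of _ 1]) auto
  qed auto
  then show "(\<Sum>i\<in>I. (cmod (f i p))\<^sup>2 * (\<Sum>k\<in>\<kappa> ` A. real (m i k) * N k)) \<le> (\<Sum>i\<in>I. (cmod (l i))\<^sup>2)"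
    by (simp add: M_def K_def mult.assoc flip: sum_distrib_left)
qed

section \<open>Common zeros of forms\<close>

text \<open>Moving along the coordinates of a block themselves only rescales them. Orthogonality to
  \<open>p\<close> in every block picks the horizontal representative of a tangent vector of the
  product.\<close>

definition tangent :: "'a set \<Rightarrow> ('a \<Rightarrow> 'k) \<Rightarrow> ('a \<Rightarrow> complex) \<Rightarrow> ('a \<Rightarrow> complex) \<Rightarrow> bool" where
  "tangent A \<kappa> p v \<longleftrightarrow> (\<forall>a. a \<notin> A \<longrightarrow> v a = 0) \<and>
    (\<forall>k\<in>\<kappa> ` A. (\<Sum>a | a \<in> A \<and> \<kappa> a = k. v a * cnj (p a)) = 0)"

text \<open>Serves both for systems of forms and for twisted 1-forms. In either case the direction
  \<open>v\<close> is found by linear algebra after the minimum is known, hence gradients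
  \<open>g\<close> that are fixed first and variation statements for every tangent
  \<open>v\<close>.\<close>

lemma minimizing_point:
  fixes f :: "'i \<Rightarrow> ('a \<Rightarrow> complex) \<Rightarrow> complex" and \<kappa> :: "'a \<Rightarrow> 'k"
  assumes fin: "finite A" "finite I"
    and form': "\<forall>i\<in>I. form A \<kappa> (m i) (f i)"
  shows "\<exists>p g. p \<in> spheres A \<kappa> \<and>
    (\<forall>u\<in>spheres A \<kappa>. (\<Sum>i\<in>I. (cmod (f i p))\<^sup>2) \<le> (\<Sum>i\<in>I. (cmod (f i u))\<^sup>2)) \<and>
    (\<forall>v. (\<forall>a. a \<notin> A \<longrightarrow> v a = 0) \<longrightarrow> (\<forall>i\<in>I. \<exists>q. \<forall>t.
      f i (\<lambda>a. p a + t * v a) = f i p + t * (\<Sum>a\<in>A. g i a * v a) + t\<^sup>2 * poly q t)) \<and>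
    (\<forall>v. tangent A \<kappa> p v \<longrightarrow> (\<Sum>i\<in>I. (\<Sum>a\<in>A. g i a * v a) * cnj (f i p)) = 0) \<and>
    (\<forall>v. tangent A \<kappa> p v \<longrightarrow>
      (\<Sum>i\<in>I. (cmod (f i p))\<^sup>2 * (\<Sum>k\<in>\<kappa> ` A. real (m i k) * (\<Sum>a | a \<in> A \<and> \<kappa> a = k. (cmod (v a))\<^sup>2)))
        \<le> (\<Sum>i\<in>I. (cmod (\<Sum>a\<in>A. g i a * v a))\<^sup>2))"
proof -
  have form: "form A \<kappa> (m i) (f i)" if "i \<in> I" for i using form' that by simp
  have "continuous_on (spheres A \<kappa>) (\<lambda>u. \<Sum>i\<in>I. (cmod (f i u))\<^sup>2)"
    by (intro continuous_on_sum continuous_on_power continuous_on_norm continuous_on_polyfun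
        form_polyfun[OF form])
  from continuous_attains_inf[OF compact_spheres[OF fin(1)] spheres_nonempty[OF fin(1)] this]
  obtain p where p: "p \<in> spheres A \<kappa>"
    "\<forall>u\<in>spheres A \<kappa>. (\<Sum>i\<in>I. (cmod (f i p))\<^sup>2) \<le> (\<Sum>i\<in>I. (cmod (f i u))\<^sup>2)"
    by blast
  have "\<forall>i\<in>I. \<exists>g. \<forall>v. (\<forall>a. a \<notin> A \<longrightarrow> v a = 0) \<longrightarrow>
    (\<exists>q. \<forall>t. f i (\<lambda>a. p a + t * v a) = f i p + t * (\<Sum>a\<in>A. g a * v a) + t\<^sup>2 * poly q t)"
    by (intro ballI polyfun_expansion fin form_polyfun[OF form])
  from bchoice[OF this] obtain g where g: "\<forall>i\<in>I. \<forall>v. (\<forall>a. a \<notin> A \<longrightarrow> v a = 0) \<longrightarrow>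
      (\<exists>q. \<forall>t. f i (\<lambda>a. p a + t * v a) = f i p + t * (\<Sum>a\<in>A. g i a * v a) + t\<^sup>2 * poly q t)"
    by (elim exE)
  have sv: "(\<Sum>i\<in>I. (\<Sum>a\<in>A. g i a * v a) * cnj (f i p)) = 0"
    "(\<Sum>i\<in>I. (cmod (f i p))\<^sup>2 * (\<Sum>k\<in>\<kappa> ` A. real (m i k) * (\<Sum>a | a \<in> A \<and> \<kappa> a = k. (cmod (v a))\<^sup>2)))
        \<le> (\<Sum>i\<in>I. (cmod (\<Sum>a\<in>A. g i a * v a))\<^sup>2)"
    if "tangent A \<kappa> p v" for v
  proof -
    have v: "a \<notin> A \<Longrightarrow> v a = 0"
      "k \<in> \<kappa> ` A \<Longrightarrow> (\<Sum>a | a \<in> A \<and> \<kappa> a = k. v a * cnj (p a)) = 0" for a k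
      using that unfolding tangent_def by (fast, fast)
    have "\<forall>i\<in>I. \<exists>q. \<forall>t. f i (\<lambda>a. p a + t * v a) = f i p + t * (\<Sum>a\<in>A. g i a * v a) + t\<^sup>2 * poly q t"
      using g v(1) by simp
    from bchoice[OF this] obtain q where
      "\<forall>i\<in>I. \<forall>t. f i (\<lambda>a. p a + t * v a) = f i p + t * (\<Sum>a\<in>A. g i a * v a) + t\<^sup>2 * poly (q i) t"
      by (elim exE)
    then have q: "f i (\<lambda>a. p a + t * v a) = f i p + t * (\<Sum>a\<in>A. g i a * v a) + t\<^sup>2 * poly (q i) t"
      if "i \<in> I" for i t using that by simp
    have min: "(\<Sum>i\<in>I. (cmod (f i p))\<^sup>2) \<le> (\<Sum>i\<in>I. (cmod (f i u))\<^sup>2)" if "u \<in> spheres A \<kappa>" for u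
      using p(2) that by (rule bspec)
    show "(\<Sum>i\<in>I. (\<Sum>a\<in>A. g i a * v a) * cnj (f i p)) = 0"
      by (rule second_variation(1)[OF fin p(1) min form v q])
    show "(\<Sum>i\<in>I. (cmod (f i p))\<^sup>2 * (\<Sum>k\<in>\<kappa> ` A. real (m i k) * (\<Sum>a | a \<in> A \<and> \<kappa> a = k. (cmod (v a))\<^sup>2)))
        \<le> (\<Sum>i\<in>I. (cmod (\<Sum>a\<in>A. g i a * v a))\<^sup>2)"
      by (rule second_variation(2)[OF fin p(1) min form v q])
  qed
  show ?thesis
    by (intro exI[of _ p] exI[of _ g] conjI p allI impI ballI sv) (use g p(2) in simp_all)
qed

text \<open>At a minimum of the norm the first variation makes one derivative redundant, so counting
  gives a nonzero tangent \<open>v\<close> killed by all derivatives, while positive degrees make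
  the second variation strictly negative along it. This replaces Bezout for at most as many
  hypersurfaces as the dimension.\<close>

lemma common_zero:
  fixes f :: "'i \<Rightarrow> ('a \<Rightarrow> complex) \<Rightarrow> complex" and \<kappa> :: "'a \<Rightarrow> 'k"
  assumes fin: "finite A" "finite I"
    and card: "card I + card (\<kappa> ` A) \<le> card A"
    and form: "\<forall>i\<in>I. form A \<kappa> (m i) (f i)"
    and pos: "\<And>i k. i \<in> I \<Longrightarrow> k \<in> \<kappa> ` A \<Longrightarrow> m i k \<ge> 1"
  shows "\<exists>u. blocks_nonzero A \<kappa> u \<and> (\<forall>i\<in>I. f i u = 0)"
proof (rule ccontr)
  assume nozero: "\<not> ?thesis"
  define K where "K = \<kappa> ` A"
  obtain p g where p: "p \<in> spheres A \<kappa>"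
    and first: "\<forall>v. tangent A \<kappa> p v \<longrightarrow> (\<Sum>i\<in>I. (\<Sum>a\<in>A. g i a * v a) * cnj (f i p)) = 0"
    and second: "\<forall>v. tangent A \<kappa> p v \<longrightarrow>
      (\<Sum>i\<in>I. (cmod (f i p))\<^sup>2 * (\<Sum>k\<in>\<kappa> ` A. real (m i k) * (\<Sum>a | a \<in> A \<and> \<kappa> a = k. (cmod (v a))\<^sup>2)))
        \<le> (\<Sum>i\<in>I. (cmod (\<Sum>a\<in>A. g i a * v a))\<^sup>2)"
    using minimizing_point[OF fin form] by (elim exE conjE)
  obtain i0 where i0: "i0 \<in> I" "f i0 p \<noteq> 0"
    using nozero spheres_blocks_nonzero[OF p] by blast
  \<comment> \<open>Rows from \<open>I\<close> are the derivatives of the forms; rows from the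
    blocks are the orthogonality conditions that make \<open>v\<close> tangent.\<close>
  define M :: "'i + 'k \<Rightarrow> 'a \<Rightarrow> complex" where
    "M = case_sum g (\<lambda>k a. if \<kappa> a = k then cnj (p a) else 0)"
  have "card ((I - {i0}) <+> K) < card A"
  proof -
    have "card (I - {i0}) < card I" using i0 fin by (intro card_Diff1_less)
    moreover have "card ((I - {i0}) <+> K) = card (I - {i0}) + card K"
      using fin by (simp add: card_Plus K_def)
    ultimately show ?thesis using card by (simp add: K_def)
  qed
  then obtain v where v: "\<exists>a\<in>A. v a \<noteq> 0" "\<And>a. a \<notin> A \<Longrightarrow> v a = 0"
    "\<And>b. b \<in> (I - {i0}) <+> K \<Longrightarrow> (\<Sum>a\<in>A. M b a * v a) = 0"
    using underdetermined_system[of "(I - {i0}) <+> K" A M] fin by (auto simp: K_def)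
  define l where "l i = (\<Sum>a\<in>A. g i a * v a)" for i
  define N where "N k = (\<Sum>a | a \<in> A \<and> \<kappa> a = k. (cmod (v a))\<^sup>2)" for k
  have N0: "N k \<ge> 0" for k by (auto simp: N_def intro: sum_nonneg)
  have tangent: "(\<Sum>a | a \<in> A \<and> \<kappa> a = k. v a * cnj (p a)) = 0" if "k \<in> \<kappa> ` A" for k
  proof -
    have "(\<Sum>a\<in>A. M (Inr k) a * v a) = 0" by (rule v(3)) (use that in \<open>auto simp: K_def\<close>)
    also have "(\<Sum>a\<in>A. M (Inr k) a * v a) = (\<Sum>a\<in>A. if \<kappa> a = k then v a * cnj (p a) else 0)"
      by (rule sum.cong) (auto simp: M_def)
    finally show ?thesis by (simp add: sum.inter_filter[OF fin(1)])
  qed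
  then have tangent_v: "tangent A \<kappa> p v" using v(2) by (simp add: tangent_def)
  have l0: "l i = 0" if "i \<in> I - {i0}" for i
    using v(3)[of "Inl i"] that by (simp add: M_def l_def InlI)
  have "0 = (\<Sum>i\<in>I. l i * cnj (f i p))" using first tangent_v by (simp add: l_def)
  also have "\<dots> = l i0 * cnj (f i0 p) + (\<Sum>i\<in>I - {i0}. l i * cnj (f i p))"
    using i0 fin by (simp add: sum.remove)
  also have "\<dots> = l i0 * cnj (f i0 p)" using l0 by simp
  \<comment> \<open>The dropped derivative vanishes too: it is the only term left in the first
    variation, with the nonzero factor \<open>cnj (f i0 p)\<close>.\<close>
  finally have "l i = 0" if "i \<in> I" for i using l0 that i0 by (cases "i = i0") auto
  then have le: "(\<Sum>i\<in>I. (cmod (f i p))\<^sup>2 * (\<Sum>k\<in>K. real (m i k) * N k)) \<le> 0"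
    using second[rule_format, OF tangent_v] by (simp add: l_def N_def K_def)
  have nonneg: "0 \<le> (cmod (f i p))\<^sup>2 * (\<Sum>k\<in>K. real (m i k) * N k)" for i
    using N0 by (intro mult_nonneg_nonneg sum_nonneg) auto
  have "0 < (\<Sum>a\<in>A. (cmod (v a))\<^sup>2)"
    using v(1) fin by (auto intro!: sum_pos2)
  also have "\<dots> = (\<Sum>k\<in>K. N k)"
    unfolding N_def K_def by (rule sum.group[symmetric]) (use fin in auto)
  also have "\<dots> \<le> (\<Sum>k\<in>K. real (m i0 k) * N k)"
  proof (rule sum_mono)
    fix k assume "k \<in> K"
    then show "N k \<le> real (m i0 k) * N k"
      using pos[OF i0(1), of k] N0[of k] by (simp add: K_def mult_le_cancel_right1)
  qed
  finally have "0 < (cmod (f i0 p))\<^sup>2 * (\<Sum>k\<in>K. real (m i0 k) * N k)" using i0 by simp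
  also have "\<dots> \<le> (\<Sum>i\<in>I. (cmod (f i p))\<^sup>2 * (\<Sum>k\<in>K. real (m i k) * N k))"
    by (rule member_le_sum) (use i0 fin nonneg in auto)
  finally show False using le by simp
qed

section \<open>Zeros of twisted forms\<close>

text \<open>
  The subtraction is truncated: degree 0 in a block is treated like degree 1, which is harmless as
  both force the block to vanish.
\<close>

definition twisted :: "'a set \<Rightarrow> ('a \<Rightarrow> 'k) \<Rightarrow> ('k \<Rightarrow> nat) \<Rightarrow> ('a \<Rightarrow> ('a \<Rightarrow> complex) \<Rightarrow> complex) \<Rightarrow> bool" where
  "twisted A \<kappa> d s \<longleftrightarrow> (\<forall>a\<in>A. form A \<kappa> (\<lambda>k. if k = \<kappa> a then d k - 1 else d k) (s a)) \<and>
    (\<forall>k\<in>\<kappa> ` A. \<forall>u. (\<Sum>a | a \<in> A \<and> \<kappa> a = k. u a * s a u) = 0)"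

lemma twisted_form_component:
  "twisted A \<kappa> d s \<Longrightarrow> a \<in> A \<Longrightarrow> form A \<kappa> (\<lambda>k. if k = \<kappa> a then d k - 1 else d k) (s a)"
  by (auto simp: twisted_def)

lemma twisted_radial:
  "twisted A \<kappa> d s \<Longrightarrow> k \<in> \<kappa> ` A \<Longrightarrow> (\<Sum>a | a \<in> A \<and> \<kappa> a = k. u a * s a u) = 0"
  by (auto simp: twisted_def)

lemma complex_cauchy_schwarz:
  "(cmod (\<Sum>a\<in>S. x a * y a))\<^sup>2 \<le> (\<Sum>a\<in>S. (cmod (x a))\<^sup>2) * (\<Sum>a\<in>S. (cmod (y a))\<^sup>2)"
proof -
  have "cmod (\<Sum>a\<in>S. x a * y a) \<le> (\<Sum>a\<in>S. cmod (x a) * cmod (y a))"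
    by (rule order_trans[OF norm_sum]) (simp add: norm_mult)
  then have "(cmod (\<Sum>a\<in>S. x a * y a))\<^sup>2 \<le> (\<Sum>a\<in>S. cmod (x a) * cmod (y a))\<^sup>2"
    by (intro power_mono) auto
  also have "\<dots> \<le> (\<Sum>a\<in>S. (cmod (x a))\<^sup>2) * (\<Sum>a\<in>S. (cmod (y a))\<^sup>2)"
    by (rule Cauchy_Schwarz_ineq_sum)
  finally show ?thesis .
qed

text \<open>The coefficients are tied by one radial relation per block, so the norm lives on the
  bundle of forms killed by the radial fields rather than on a sum of line bundles. There the
  covariant derivative of block \<open>k\<close> along \<open>v\<close> is \<open>l\<close>
  corrected by \<open>S k v\<close> times \<open>cnj p\<close>. If it vanishes, the second variation
  leaves the sum of \<open>\<sigma> k * (D - 2 * N k)\<close>: one \<open>N k\<close> is lost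
  because the coefficients have degree \<open>d k - 1\<close> in their own block, the other through
  the correction.\<close>

lemma twisted_minimum:
  fixes s :: "'a \<Rightarrow> ('a \<Rightarrow> complex) \<Rightarrow> complex" and \<kappa> :: "'a \<Rightarrow> 'k"
  assumes fin: "finite A" and tw: "twisted A \<kappa> d s"
    and d2: "\<And>k. k \<in> \<kappa> ` A \<Longrightarrow> d k \<ge> 2"
    and nozero: "\<And>u. u \<in> spheres A \<kappa> \<Longrightarrow> \<exists>a\<in>A. s a u \<noteq> 0"
  shows "\<exists>p\<in>spheres A \<kappa>.
    (\<forall>u\<in>spheres A \<kappa>. (\<Sum>a\<in>A. (cmod (s a p))\<^sup>2) \<le> (\<Sum>a\<in>A. (cmod (s a u))\<^sup>2)) \<and>
    (\<exists>k\<in>\<kappa> ` A. d k = 2 \<and> (\<forall>a\<in>A. \<kappa> a \<noteq> k \<longrightarrow> s a p = 0))"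
proof -
  define K where "K = \<kappa> ` A"
  define B where "B k = {a. a \<in> A \<and> \<kappa> a = k}" for k
  have finB: "finite (B k)" for k using fin by (simp add: B_def)
  have finK: "finite K" using fin by (simp add: K_def)
  have BA: "a \<in> A" "\<kappa> a = k" if "a \<in> B k" for a k using that by (auto simp: B_def)
  obtain p g where p: "p \<in> spheres A \<kappa>"
    and min: "\<forall>u\<in>spheres A \<kappa>. (\<Sum>a\<in>A. (cmod (s a p))\<^sup>2) \<le> (\<Sum>a\<in>A. (cmod (s a u))\<^sup>2)"
    and expansion: "\<forall>v. (\<forall>a. a \<notin> A \<longrightarrow> v a = 0) \<longrightarrow> (\<forall>i\<in>A. \<exists>q. \<forall>t.
      s i (\<lambda>a. p a + t * v a) = s i p + t * (\<Sum>a\<in>A. g i a * v a) + t\<^sup>2 * poly q t)"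
    and first: "\<forall>v. tangent A \<kappa> p v \<longrightarrow> (\<Sum>i\<in>A. (\<Sum>a\<in>A. g i a * v a) * cnj (s i p)) = 0"
    and second: "\<forall>v. tangent A \<kappa> p v \<longrightarrow>
      (\<Sum>i\<in>A. (cmod (s i p))\<^sup>2 * (\<Sum>k\<in>\<kappa> ` A. real (if k = \<kappa> i then d k - 1 else d k) *
        (\<Sum>a | a \<in> A \<and> \<kappa> a = k. (cmod (v a))\<^sup>2)))
        \<le> (\<Sum>i\<in>A. (cmod (\<Sum>a\<in>A. g i a * v a))\<^sup>2)"
    using minimizing_point[OF fin fin conjunct1[OF tw[unfolded twisted_def]]] by (elim exE conjE)
  define l where "l i v = (\<Sum>a\<in>A. g i a * v a)" for i v
  define S where "S k v = (\<Sum>a\<in>B k. s a p * v a)" for k v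
  obtain a0 where a0: "a0 \<in> A" "s a0 p \<noteq> 0" using nozero[OF p] by blast
  have unit: "(\<Sum>a\<in>B k. p a * cnj (p a)) = 1" if "k \<in> K" for k
  proof -
    have "(\<Sum>a\<in>B k. (cmod (p a))\<^sup>2) = 1"
      using p that unfolding spheres_def K_def B_def by blast
    moreover have "complex_of_real (\<Sum>a\<in>B k. (cmod (p a))\<^sup>2) = (\<Sum>a\<in>B k. p a * cnj (p a))"
      by (simp only: of_real_sum complex_norm_square)
    ultimately show ?thesis by simp
  qed
  have ps: "(\<Sum>a\<in>B k. p a * s a p) = 0" if "k \<in> K" for k
    using twisted_radial[OF tw] that by (simp add: K_def B_def)
  have radial: "(\<Sum>a\<in>B k. p a * l a v) = - S k v"
    if k: "k \<in> K" and v: "\<And>a. a \<notin> A \<Longrightarrow> v a = 0" for k v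
  proof -
    have "\<forall>i\<in>A. \<exists>q. \<forall>t. s i (\<lambda>a. p a + t * v a) = s i p + t * l i v + t\<^sup>2 * poly q t"
      using expansion v unfolding l_def by simp
    from bchoice[OF this] obtain q where
      q: "\<And>i t. i \<in> A \<Longrightarrow> s i (\<lambda>a. p a + t * v a) = s i p + t * l i v + t\<^sup>2 * poly (q i) t"
      by blast
    \<comment> \<open>The radial relation along the line \<open>p + t * v\<close>, as a polynomial
      in \<open>t\<close>; its linear coefficient is the differentiated relation.\<close>
    define R where "R = (\<Sum>a\<in>B k. [:p a, v a:] * pCons (s a p) (pCons (l a v) (q a)))"
    have "poly R t = 0" for t
    proof -
      have "poly R t = (\<Sum>a\<in>B k. (p a + t * v a) * s a (\<lambda>a. p a + t * v a))"
        unfolding R_def poly_sum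
        by (rule sum.cong) (auto simp: q BA algebra_simps power2_eq_square)
      also have "\<dots> = 0"
        using twisted_radial[OF tw, of k "\<lambda>a. p a + t * v a"] k by (simp add: K_def B_def)
      finally show ?thesis .
    qed
    then have "R = 0" by (simp add: poly_all_0_iff_0[symmetric])
    then have "coeff R 1 = 0" by simp
    then have "(\<Sum>a\<in>B k. s a p * v a + l a v * p a) = 0"
      by (simp add: R_def coeff_sum mult.commute)
    then show ?thesis by (simp add: sum.distrib S_def mult.commute eq_neg_iff_add_eq_0 add.commute)
  qed
  \<comment> \<open>The orthogonal projection of the basis vector at \<open>b\<close> to the tangent
    space: its part along \<open>p\<close> in the block of \<open>b\<close> is removed.\<close>
  define col where "col b = (\<lambda>b'. if b' \<in> A then
    (if b' = b then 1 else 0) - (if \<kappa> b' = \<kappa> b then cnj (p b) * p b' else 0) else 0)" for b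
  define T where "T b k = S k (col b) + (if k = \<kappa> b then cnj (p b) else 0)" for b k
  \<comment> \<open>The covariant derivative, extended by sending the radial component in each block
    to \<open>cnj p\<close>, which spans the orthogonal complement of the fibre there. The matrix is
    thus square without a choice of bases, and its kernel is that of the covariant
    derivative.\<close>
  define M where "M a b = l a (col b) + T b (\<kappa> a) * cnj (p a)" for a b
  have col_supp: "a \<notin> A \<Longrightarrow> col b a = 0" for a b by (simp add: col_def)
  have col_tangent': "(\<Sum>a | a \<in> A \<and> \<kappa> a = k. col b a * cnj (p a)) = 0"
    if "k \<in> \<kappa> ` A" "b \<in> A" for k b
  proof -
    have "(\<Sum>a\<in>B k. col b a * cnj (p a)) =
        (\<Sum>a\<in>B k. if a = b then cnj (p b) else 0) -
        (if k = \<kappa> b then cnj (p b) * (\<Sum>a\<in>B k. p a * cnj (p a)) else 0)"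
      unfolding sum_distrib_left if_distrib[of "\<lambda>x. _ - x"] sum_subtractf[symmetric]
      by (auto simp: col_def BA algebra_simps intro!: sum.cong)
    also have "\<dots> = 0"
      using unit[of k] that finB[of k] by (auto simp: B_def K_def)
    finally show ?thesis by (simp add: B_def)
  qed
  have col_tangent: "tangent A \<kappa> p (col b)" if "b \<in> A" for b
    using col_supp col_tangent' that unfolding tangent_def by simp
  \<comment> \<open>The conjugate values of the form give a left kernel vector: on the part with
    \<open>l\<close> by the first variation, on the part with \<open>T\<close> by the radial
    relation at \<open>p\<close>.\<close>
  have dep: "(\<Sum>a\<in>A. cnj (s a p) * M a b) = 0" if b: "b \<in> A" for b
  proof -
    have "(\<Sum>a\<in>A. cnj (s a p) * M a b) =
        (\<Sum>a\<in>A. l a (col b) * cnj (s a p)) + (\<Sum>a\<in>A. T b (\<kappa> a) * cnj (p a * s a p))"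
      unfolding M_def sum.distrib[symmetric] by (rule sum.cong) (auto simp: algebra_simps)
    also have "(\<Sum>a\<in>A. l a (col b) * cnj (s a p)) = 0"
      unfolding l_def using first col_tangent[OF b] by simp
    also have "(\<Sum>a\<in>A. T b (\<kappa> a) * cnj (p a * s a p)) =
        (\<Sum>k\<in>K. \<Sum>a\<in>B k. T b (\<kappa> a) * cnj (p a * s a p))"
      unfolding B_def K_def by (rule sum.group[symmetric]) (use fin in auto)
    also have "\<dots> = (\<Sum>k\<in>K. T b k * cnj (\<Sum>a\<in>B k. p a * s a p))"
      unfolding cnj_sum sum_distrib_left by (intro sum.cong) (auto simp: BA)
    also have "\<dots> = 0" using ps by simp
    finally show ?thesis by simp
  qed
  obtain v where v: "\<exists>a\<in>A. v a \<noteq> 0" "\<And>a. a \<notin> A \<Longrightarrow> v a = 0"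
    "\<And>a. a \<in> A \<Longrightarrow> (\<Sum>b\<in>A. M a b * v b) = 0"
    using square_system[of A A a0 "\<lambda>a. cnj (s a p)" M] fin a0 dep by auto
  define \<tau> where "\<tau> k = (\<Sum>b\<in>B k. cnj (p b) * v b)" for k
  define z where "z a = (\<Sum>b\<in>A. col b a * v b)" for a
  have z_supp: "z a = 0" if "a \<notin> A" for a using col_supp[OF that] by (simp add: z_def)
  have z: "z a = v a - \<tau> (\<kappa> a) * p a" if a: "a \<in> A" for a
  proof -
    have "z a = (\<Sum>b\<in>A. if b = a then v b else 0) - (\<Sum>b\<in>A. if \<kappa> b = \<kappa> a then cnj (p b) * v b * p a else 0)"
      unfolding z_def sum_subtractf[symmetric]
      by (rule sum.cong) (use a in \<open>auto simp: col_def algebra_simps\<close>)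
    also have "\<dots> = v a - \<tau> (\<kappa> a) * p a"
      unfolding \<tau>_def B_def sum_distrib_right unfolding sum.inter_filter[OF fin] using a fin by simp
    finally show ?thesis .
  qed
  have lz: "l a z = (\<Sum>b\<in>A. l a (col b) * v b)" for a
    unfolding l_def z_def sum_distrib_left sum_distrib_right
    by (subst sum.swap) (simp add: mult.assoc)
  have Sz: "S k z = (\<Sum>b\<in>A. S k (col b) * v b)" for k
    unfolding S_def z_def sum_distrib_left sum_distrib_right
    by (subst sum.swap) (simp add: mult.assoc)
  have Mz: "l a z + (S (\<kappa> a) z + \<tau> (\<kappa> a)) * cnj (p a) = 0" if a: "a \<in> A" for a
  proof -
    have "\<tau> (\<kappa> a) = (\<Sum>b\<in>A. (if \<kappa> a = \<kappa> b then cnj (p b) else 0) * v b)"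
      unfolding \<tau>_def B_def sum.inter_filter[OF fin] by (rule sum.cong) auto
    then have "l a z + (S (\<kappa> a) z + \<tau> (\<kappa> a)) * cnj (p a) = (\<Sum>b\<in>A. M a b * v b)"
      unfolding lz Sz M_def T_def
      by (simp only: sum.distrib[symmetric] sum_distrib_right) (simp add: algebra_simps)
    then show ?thesis using v(3)[OF a] by simp
  qed
  \<comment> \<open>Pairing the kernel equation with \<open>p\<close> cancels the covariant part,
    which lies in the fibre, and isolates the radial component of \<open>v\<close>; hence the kernel
    vector is tangent.\<close>
  have \<tau>0: "\<tau> k = 0" if k: "k \<in> K" for k
  proof -
    have "0 = (\<Sum>a\<in>B k. p a * (l a z + (S k z + \<tau> k) * cnj (p a)))"
      by (rule sum.neutral[symmetric]) (use Mz BA in fastforce)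
    also have "\<dots> = (\<Sum>a\<in>B k. p a * l a z) + (S k z + \<tau> k) * (\<Sum>a\<in>B k. p a * cnj (p a))"
      unfolding sum_distrib_left sum.distrib[symmetric]
      by (rule sum.cong) (auto simp: algebra_simps)
    also have "\<dots> = \<tau> k" using radial[OF k z_supp] unit[OF k] by simp
    finally show ?thesis by simp
  qed
  have zv: "z = v"
  proof
    fix a show "z a = v a"
      using z[of a] z_supp[of a] v(2)[of a] \<tau>0[of "\<kappa> a"] by (cases "a \<in> A") (auto simp: K_def)
  qed
  have lv: "l a v = - (S (\<kappa> a) v * cnj (p a))" if "a \<in> A" for a
    using Mz[OF that] \<tau>0[of "\<kappa> a"] that by (simp add: zv K_def eq_neg_iff_add_eq_0)
  have tangent: "(\<Sum>a | a \<in> A \<and> \<kappa> a = k. v a * cnj (p a)) = 0" if "k \<in> \<kappa> ` A" for k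
    using \<tau>0[of k] that by (simp add: \<tau>_def K_def B_def mult.commute)
  then have tangent_v: "tangent A \<kappa> p v" using v(2) unfolding tangent_def by simp
  define N where "N k = (\<Sum>a\<in>B k. (cmod (v a))\<^sup>2)" for k
  define \<sigma> where "\<sigma> k = (\<Sum>a\<in>B k. (cmod (s a p))\<^sup>2)" for k
  define D where "D = (\<Sum>k\<in>K. real (d k) * N k)"
  have N0: "N k \<ge> 0" and \<sigma>0: "\<sigma> k \<ge> 0" for k by (auto simp: N_def \<sigma>_def intro: sum_nonneg)
  have grp: "(\<Sum>a\<in>A. h a) = (\<Sum>k\<in>K. \<Sum>a\<in>B k. h a)" for h :: "'a \<Rightarrow> real"
    unfolding B_def K_def by (rule sum.group[symmetric]) (use fin in auto)
  \<comment> \<open>Here \<open>d k0 \<ge> 2\<close> keeps the truncated subtraction exact.\<close>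
  have deg: "(\<Sum>k\<in>K. real (if k = k0 then d k - 1 else d k) * N k) = D - N k0" if k0: "k0 \<in> K" for k0
  proof -
    have "real (d k0 - Suc 0) = real (d k0) - 1" using d2[of k0] k0 by (simp add: K_def of_nat_diff)
    then have "(\<Sum>k\<in>K. real (if k = k0 then d k - 1 else d k) * N k) =
        (\<Sum>k\<in>K. real (d k) * N k - (if k = k0 then N k else 0))"
      by (intro sum.cong) (auto simp: algebra_simps)
    then show ?thesis using finK k0 by (simp add: sum_subtractf D_def)
  qed
  have "(\<Sum>k\<in>K. \<sigma> k * (D - N k)) = (\<Sum>k\<in>K. \<Sum>a\<in>B k. (cmod (s a p))\<^sup>2 * (D - N (\<kappa> a)))"
    unfolding \<sigma>_def sum_distrib_right by (intro sum.cong) (auto simp: BA)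
  also have "\<dots> = (\<Sum>a\<in>A. (cmod (s a p))\<^sup>2 * (D - N (\<kappa> a)))" by (rule grp[symmetric])
  also have "\<dots> = (\<Sum>a\<in>A. (cmod (s a p))\<^sup>2 * (\<Sum>k\<in>K. real (if k = \<kappa> a then d k - 1 else d k) * N k))"
  proof (rule sum.cong[OF refl])
    fix a assume "a \<in> A"
    then have "\<kappa> a \<in> K" by (simp add: K_def)
    from deg[OF this] show "(cmod (s a p))\<^sup>2 * (D - N (\<kappa> a)) =
        (cmod (s a p))\<^sup>2 * (\<Sum>k\<in>K. real (if k = \<kappa> a then d k - 1 else d k) * N k)" by simp
  qed
  also have "\<dots> \<le> (\<Sum>a\<in>A. (cmod (l a v))\<^sup>2)"
    using second[rule_format, OF tangent_v] by (simp add: l_def K_def N_def B_def)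
  also have "\<dots> = (\<Sum>k\<in>K. \<Sum>a\<in>B k. (cmod (l a v))\<^sup>2)" by (rule grp)
  \<comment> \<open>On the kernel of the covariant derivative \<open>l\<close> is just the
    correction, so its norm in block \<open>k\<close> is that of \<open>S k v\<close>, as
    \<open>p\<close> has norm 1 there; Cauchy-Schwarz bounds it.\<close>
  also have "\<dots> \<le> (\<Sum>k\<in>K. \<sigma> k * N k)"
  proof (rule sum_mono)
    fix k assume k: "k \<in> K"
    have "(\<Sum>a\<in>B k. (cmod (l a v))\<^sup>2) = (cmod (S k v))\<^sup>2 * (\<Sum>a\<in>B k. (cmod (p a))\<^sup>2)"
      unfolding sum_distrib_left by (rule sum.cong) (auto simp: BA lv norm_mult power_mult_distrib)
    also have "(\<Sum>a\<in>B k. (cmod (p a))\<^sup>2) = 1"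
      using p k unfolding spheres_def K_def B_def by blast
    finally show "(\<Sum>a\<in>B k. (cmod (l a v))\<^sup>2) \<le> \<sigma> k * N k"
      using complex_cauchy_schwarz[of "\<lambda>a. s a p" v "B k"] by (simp add: S_def \<sigma>_def N_def)
  qed
  finally have "(\<Sum>k\<in>K. \<sigma> k * (D - N k)) - (\<Sum>k\<in>K. \<sigma> k * N k) \<le> 0" by simp
  then have le: "(\<Sum>k\<in>K. \<sigma> k * (D - 2 * N k)) \<le> 0"
    unfolding sum_subtractf[symmetric] by (simp add: algebra_simps)
  \<comment> \<open>With all degrees at least 2, both terms of this splitting are nonnegative, so a
    nonpositive total forces each of them to vanish wherever \<open>\<sigma> k\<close> is
    nonzero.\<close>
  have D_split: "D - 2 * N k = (real (d k) - 2) * N k + (\<Sum>j\<in>K - {k}. real (d j) * N j)"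
    if "k \<in> K" for k
    unfolding D_def using that finK by (simp add: sum.remove algebra_simps)
  have nn1: "(real (d k) - 2) * N k \<ge> 0" if "k \<in> K" for k
    using d2[of k] that N0[of k] by (simp add: K_def)
  have nn2: "(\<Sum>j\<in>K - {k}. real (d j) * N j) \<ge> 0" for k using N0 by (auto intro: sum_nonneg)
  have nn: "\<sigma> k * (D - 2 * N k) \<ge> 0" if "k \<in> K" for k
    unfolding D_split[OF that] using nn1[OF that] nn2 \<sigma>0 by simp
  have zero: "(\<Sum>k\<in>K. \<sigma> k * (D - 2 * N k)) = 0" using le by (intro antisym sum_nonneg nn)
  have eq0: "\<sigma> k * (D - 2 * N k) = 0" if "k \<in> K" for k
    by (rule sum_nonneg_0[OF finK nn zero that])
  have props: "(d k - 2 = 0 \<or> N k = 0) \<and> (\<forall>j\<in>K - {k}. N j = 0)" if k: "k \<in> K" "\<sigma> k \<noteq> 0" for k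
  proof -
    have "(real (d k) - 2) * N k + (\<Sum>j\<in>K - {k}. real (d j) * N j) = 0"
      using eq0[OF k(1)] k(2) D_split[OF k(1)] by simp
    then have *: "(real (d k) - 2) * N k = 0" "(\<Sum>j\<in>K - {k}. real (d j) * N j) = 0"
      using nn1[OF k(1)] nn2[of k] by linarith+
    have "real (d j) * N j = 0" if "j \<in> K - {k}" for j
      by (rule sum_nonneg_0[OF _ _ *(2) that]) (use finK N0 in auto)
    moreover have "real (d j) \<noteq> 0" if "j \<in> K - {k}" for j
      using d2[of j] that by (simp add: K_def)
    ultimately have "N j = 0" if "j \<in> K - {k}" for j
      using that by (meson mult_eq_0_iff)
    with *(1) show ?thesis by auto
  qed
  obtain a1 where a1: "a1 \<in> A" "v a1 \<noteq> 0" using v(1) by blast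
  have Npos: "N (\<kappa> a1) > 0"
    unfolding N_def by (rule sum_pos2[of _ a1]) (use a1 finB in \<open>auto simp: B_def\<close>)
  have \<sigma>a: "\<sigma> (\<kappa> a) \<noteq> 0" if "a \<in> A" "s a p \<noteq> 0" for a
  proof -
    have "\<sigma> (\<kappa> a) > 0"
      unfolding \<sigma>_def by (rule sum_pos2[of _ a]) (use that finB in \<open>auto simp: B_def\<close>)
    then show ?thesis by simp
  qed
  \<comment> \<open>The vector \<open>v\<close> is nonzero in the factor of \<open>a1\<close>. A
    nonzero block of the form forces \<open>v\<close> to vanish in all other factors, so it can only
    be the block of \<open>a1\<close>.\<close>
  have only: "\<kappa> a = \<kappa> a1" if "a \<in> A" "s a p \<noteq> 0" for a
  proof (rule ccontr)
    assume "\<kappa> a \<noteq> \<kappa> a1"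
    moreover have "\<forall>j\<in>K - {\<kappa> a}. N j = 0" using props[OF _ \<sigma>a[OF that]] that by (simp add: K_def)
    ultimately have "N (\<kappa> a1) = 0" using a1 by (simp add: K_def)
    then show False using Npos by simp
  qed
  have "\<kappa> a0 \<in> K" using a0 by (simp add: K_def)
  then have "d (\<kappa> a0) - 2 = 0"
    using props[OF _ \<sigma>a[OF a0]] only[OF a0] Npos by auto
  then have "d (\<kappa> a0) = 2" using d2[of "\<kappa> a0"] a0 by auto
  moreover have "\<forall>a\<in>A. \<kappa> a \<noteq> \<kappa> a0 \<longrightarrow> s a p = 0" using only only[OF a0] by metis
  ultimately show ?thesis using p min a0(1) by blast
qed

definition has_zero :: "'a set \<Rightarrow> ('a \<Rightarrow> 'k) \<Rightarrow> ('a \<Rightarrow> ('a \<Rightarrow> complex) \<Rightarrow> complex) \<Rightarrow> bool" where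
  "has_zero A \<kappa> s \<longleftrightarrow> (\<exists>u. blocks_nonzero A \<kappa> u \<and> (\<forall>a\<in>A. s a u = 0))"

lemma form_cmult: "form A \<kappa> m f \<Longrightarrow> form A \<kappa> m (\<lambda>u. c * f u)"
  unfolding form_def by (auto intro: polyfun.intros simp: mult.left_commute)

text \<open>
  At a minimum of the norm exactly one block survives, and it has degree 2. Scaling up the blocks
  of degree 2 rules such points out as soon as these blocks have a common zero.
\<close>

lemma twisted_has_zero:
  fixes s :: "'a \<Rightarrow> ('a \<Rightarrow> complex) \<Rightarrow> complex" and \<kappa> :: "'a \<Rightarrow> 'k"
  assumes fin: "finite A" and tw: "twisted A \<kappa> d s"
    and d2: "\<And>k. k \<in> \<kappa> ` A \<Longrightarrow> d k \<ge> 2"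
    and u0: "blocks_nonzero A \<kappa> u0" "\<And>a. a \<in> A \<Longrightarrow> d (\<kappa> a) = 2 \<Longrightarrow> s a u0 = 0"
  shows "has_zero A \<kappa> s"
proof (rule ccontr)
  assume "\<not> has_zero A \<kappa> s"
  then have nz: "\<exists>a\<in>A. s a u \<noteq> 0" if "u \<in> spheres A \<kappa>" for u
    using spheres_blocks_nonzero[OF that] unfolding has_zero_def by blast
  obtain c where u1: "(\<lambda>a. if a \<in> A then c (\<kappa> a) * u0 a else 0) \<in> spheres A \<kappa>"
    using blocks_nonzero_normalize[OF fin u0(1)] by blast
  define u1 where "u1 = (\<lambda>a. if a \<in> A then c (\<kappa> a) * u0 a else 0)"
  have u1: "u1 \<in> spheres A \<kappa>" using u1 by (simp add: u1_def)
  have s_u1: "s a u1 = 0" if "a \<in> A" "d (\<kappa> a) = 2" for a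
  proof -
    note F = twisted_form_component[OF tw that(1)]
    have "s a u1 = s a (\<lambda>a. c (\<kappa> a) * u0 a)" by (rule form_cong[OF F]) (simp add: u1_def)
    then show ?thesis using form_scale[OF F, of c u0] u0(2)[OF that] by simp
  qed
  define \<Phi> where "\<Phi> u = (\<Sum>a\<in>A. (cmod (s a u))\<^sup>2)" for u
  obtain p0 where p0: "p0 \<in> spheres A \<kappa>" "\<And>u. u \<in> spheres A \<kappa> \<Longrightarrow> \<Phi> p0 \<le> \<Phi> u"
    using twisted_minimum[OF fin tw d2 nz] unfolding \<Phi>_def by blast
  have pos: "\<Phi> p0 > 0"
    using nz[OF p0(1)] fin unfolding \<Phi>_def by (auto intro!: sum_pos2)
  \<comment> \<open>Large enough for the rescaled norm at a point carried by one block of degree 2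
    to exceed the norm at \<open>u1\<close>, where these blocks vanish and the rescaling has no
    effect. The maximum with 1 ensures \<open>w \<le> w\<^sup>2\<close>.\<close>
  define w where "w = max 1 ((\<Phi> u1 + 1) / \<Phi> p0)"
  have w: "w \<ge> 1" "w * \<Phi> p0 \<ge> \<Phi> u1 + 1"
    using pos by (auto simp: w_def max_def field_simps)
  define s' where "s' a u = (if d (\<kappa> a) = 2 then complex_of_real w else 1) * s a u" for a u
  have tw': "twisted A \<kappa> d s'"
    unfolding twisted_def
  proof (intro conjI ballI allI)
    fix a assume "a \<in> A"
    then show "form A \<kappa> (\<lambda>k. if k = \<kappa> a then d k - 1 else d k) (s' a)"
      unfolding s'_def[abs_def] by (intro form_cmult twisted_form_component[OF tw])
  next
    fix k u assume k: "k \<in> \<kappa> ` A"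
    have "(\<Sum>a | a \<in> A \<and> \<kappa> a = k. u a * s' a u) =
        (if d k = 2 then complex_of_real w else 1) * (\<Sum>a | a \<in> A \<and> \<kappa> a = k. u a * s a u)"
      unfolding sum_distrib_left by (rule sum.cong) (auto simp: s'_def)
    then show "(\<Sum>a | a \<in> A \<and> \<kappa> a = k. u a * s' a u) = 0"
      using twisted_radial[OF tw k] by simp
  qed
  have nz': "\<exists>a\<in>A. s' a u \<noteq> 0" if "u \<in> spheres A \<kappa>" for u
    using nz[OF that] w(1) by (auto simp: s'_def)
  obtain p k where p: "p \<in> spheres A \<kappa>"
    "\<And>u. u \<in> spheres A \<kappa> \<Longrightarrow> (\<Sum>a\<in>A. (cmod (s' a p))\<^sup>2) \<le> (\<Sum>a\<in>A. (cmod (s' a u))\<^sup>2)"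
    and k: "d k = 2" "\<And>a. a \<in> A \<Longrightarrow> \<kappa> a \<noteq> k \<Longrightarrow> s' a p = 0"
    using twisted_minimum[OF fin tw' d2 nz'] by blast
  have "w * \<Phi> p0 \<le> w\<^sup>2 * \<Phi> p0" using w(1) pos by (simp add: power2_eq_square)
  also have "\<dots> \<le> w\<^sup>2 * \<Phi> p" using p0(2)[OF p(1)] by (simp add: mult_left_mono)
  also have "\<dots> = (\<Sum>a\<in>A. (cmod (s' a p))\<^sup>2)"
    unfolding \<Phi>_def sum_distrib_left
  proof (rule sum.cong[OF refl])
    fix a assume a: "a \<in> A"
    show "w\<^sup>2 * (cmod (s a p))\<^sup>2 = (cmod (s' a p))\<^sup>2"
      using k(1) k(2)[OF a] w(1) by (cases "\<kappa> a = k") (auto simp: s'_def norm_mult power_mult_distrib split: if_splits)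
  qed
  also have "\<dots> \<le> (\<Sum>a\<in>A. (cmod (s' a u1))\<^sup>2)" by (rule p(2)[OF u1])
  also have "\<dots> \<le> \<Phi> u1"
    unfolding \<Phi>_def by (rule sum_mono) (use s_u1 in \<open>auto simp: s'_def\<close>)
  finally show False using w(2) by simp
qed

section \<open>Fixing and scaling single blocks\<close>

text \<open>Restriction to a slice: the blocks outside \<open>K'\<close> are frozen at
  \<open>w\<close>. Their scalars are taken to be 1 in the homogeneity, so the degrees in the
  remaining blocks are kept.\<close>

lemma form_merge:
  fixes \<kappa> :: "'a \<Rightarrow> 'k"
  assumes "finite A" and F: "form A \<kappa> m f"
  shows "form {a \<in> A. \<kappa> a \<in> K'} \<kappa> m (\<lambda>u. f (\<lambda>b. if \<kappa> b \<in> K' then u b else w b))"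
proof (rule formI)
  show "polyfun (\<lambda>u. f (\<lambda>b. if \<kappa> b \<in> K' then u b else w b))"
    using form_polyfun[OF F] by (rule polyfun_subst) (intro polyfun_intros)
  fix u
  show "f (\<lambda>b. if \<kappa> b \<in> K' then if b \<in> {a \<in> A. \<kappa> a \<in> K'} then u b else 0 else w b) =
      f (\<lambda>b. if \<kappa> b \<in> K' then u b else w b)"
    by (rule form_cong[OF F]) simp
  fix c :: "'k \<Rightarrow> complex"
  define c' where "c' k = (if k \<in> K' then c k else 1)" for k
  have "(\<lambda>b. if \<kappa> b \<in> K' then c (\<kappa> b) * u b else w b) =
      (\<lambda>b. c' (\<kappa> b) * (if \<kappa> b \<in> K' then u b else w b))"
    by (auto simp: c'_def)
  then have "f (\<lambda>b. if \<kappa> b \<in> K' then c (\<kappa> b) * u b else w b) =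
      (\<Prod>k\<in>\<kappa> ` A. c' k ^ m k) * f (\<lambda>b. if \<kappa> b \<in> K' then u b else w b)"
    by (simp only: form_scale[OF F, of c' "\<lambda>b. if \<kappa> b \<in> K' then u b else w b"])
  also have "(\<Prod>k\<in>\<kappa> ` A. c' k ^ m k) = (\<Prod>k\<in>\<kappa> ` {a \<in> A. \<kappa> a \<in> K'}. c k ^ m k)"
    by (rule prod.mono_neutral_cong_right) (use assms(1) in \<open>auto simp: c'_def\<close>)
  finally show "f (\<lambda>b. if \<kappa> b \<in> K' then c (\<kappa> b) * u b else w b) =
      (\<Prod>k\<in>\<kappa> ` {a \<in> A. \<kappa> a \<in> K'}. c k ^ m k) * f (\<lambda>b. if \<kappa> b \<in> K' then u b else w b)" .
qed

lemma twisted_merge: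
  assumes "finite A" and tw: "twisted A \<kappa> d s"
  shows "twisted {a \<in> A. \<kappa> a \<in> K'} \<kappa> d (\<lambda>a u. s a (\<lambda>b. if \<kappa> b \<in> K' then u b else w b))"
  unfolding twisted_def
proof (intro conjI ballI allI)
  fix a assume "a \<in> {a \<in> A. \<kappa> a \<in> K'}"
  then show "form {a \<in> A. \<kappa> a \<in> K'} \<kappa> (\<lambda>k. if k = \<kappa> a then d k - 1 else d k)
      (\<lambda>u. s a (\<lambda>b. if \<kappa> b \<in> K' then u b else w b))"
    by (intro form_merge assms(1) twisted_form_component[OF tw]) simp
next
  fix k u assume "k \<in> \<kappa> ` {a \<in> A. \<kappa> a \<in> K'}"
  then have k: "k \<in> K'" "k \<in> \<kappa> ` A" by auto
  show "(\<Sum>a | a \<in> {a \<in> A. \<kappa> a \<in> K'} \<and> \<kappa> a = k. u a * s a (\<lambda>b. if \<kappa> b \<in> K' then u b else w b)) = 0"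
    unfolding twisted_radial[OF tw k(2), of "\<lambda>b. if \<kappa> b \<in> K' then u b else w b", symmetric]
    by (rule sum.cong) (use k in auto)
qed

lemma has_zero_merge:
  assumes "has_zero {a \<in> A. \<kappa> a \<in> K'} \<kappa> (\<lambda>a u. s a (\<lambda>b. if \<kappa> b \<in> K' then u b else w b))"
    and w: "blocks_nonzero A \<kappa> w"
    and zero: "\<And>a u. a \<in> A \<Longrightarrow> \<kappa> a \<notin> K' \<Longrightarrow> s a u = 0"
  shows "has_zero A \<kappa> s"
proof -
  obtain u where u: "blocks_nonzero {a \<in> A. \<kappa> a \<in> K'} \<kappa> u"
    "\<forall>a\<in>{a \<in> A. \<kappa> a \<in> K'}. s a (\<lambda>b. if \<kappa> b \<in> K' then u b else w b) = 0"
    using assms(1) unfolding has_zero_def by (elim exE conjE)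
  have "blocks_nonzero A \<kappa> (\<lambda>b. if \<kappa> b \<in> K' then u b else w b)"
    unfolding blocks_nonzero_def
  proof
    fix k assume k: "k \<in> \<kappa> ` A"
    show "\<exists>a\<in>A. \<kappa> a = k \<and> (if \<kappa> a \<in> K' then u a else w a) \<noteq> 0"
    proof (cases "k \<in> K'")
      case True
      then have "k \<in> \<kappa> ` {a \<in> A. \<kappa> a \<in> K'}" using k by auto
      then have "\<exists>a\<in>{a \<in> A. \<kappa> a \<in> K'}. \<kappa> a = k \<and> u a \<noteq> 0"
        by (rule bspec[OF u(1)[unfolded blocks_nonzero_def]])
      then show ?thesis by auto
    next
      case False
      have "\<exists>a\<in>A. \<kappa> a = k \<and> w a \<noteq> 0" using k by (rule bspec[OF w[unfolded blocks_nonzero_def]])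
      then show ?thesis using False by auto
    qed
  qed
  moreover have "s a (\<lambda>b. if \<kappa> b \<in> K' then u b else w b) = 0" if "a \<in> A" for a
    using u(2) zero that by (cases "\<kappa> a \<in> K'") auto
  ultimately show ?thesis unfolding has_zero_def by blast
qed

lemma blocks_nonzero_one: "blocks_nonzero A \<kappa> (\<lambda>_. 1)"
  by (auto simp: blocks_nonzero_def)

lemma blocks_nonzero_change_block:
  assumes "blocks_nonzero A \<kappa> w" "\<And>a. a \<in> A \<Longrightarrow> \<kappa> a \<noteq> k \<Longrightarrow> u a = w a"
    "a \<in> A" "\<kappa> a = k" "u a \<noteq> 0"
  shows "blocks_nonzero A \<kappa> u"
  unfolding blocks_nonzero_def
proof
  fix j assume j: "j \<in> \<kappa> ` A"
  show "\<exists>a\<in>A. \<kappa> a = j \<and> u a \<noteq> 0"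
  proof (cases "j = k")
    case False
    have "\<exists>a\<in>A. \<kappa> a = j \<and> w a \<noteq> 0" using j by (rule bspec[OF assms(1)[unfolded blocks_nonzero_def]])
    then obtain a where "a \<in> A" "\<kappa> a = j" "w a \<noteq> 0" by blast
    then show ?thesis using assms(2)[of a] False by auto
  qed (use assms in auto)
qed

text \<open>The smallest case of \<open>common_zero\<close>, a single form on one projective space
  of positive dimension, applied to the slice through \<open>w\<close>.\<close>

lemma form_zero_in_block:
  assumes fin: "finite A" and F: "form A \<kappa> m f"
    and k: "card {a \<in> A. \<kappa> a = k} \<ge> 2" "m k \<ge> 1"
  shows "\<exists>u. (\<exists>a\<in>A. \<kappa> a = k \<and> u a \<noteq> 0) \<and> (\<forall>a. \<kappa> a \<noteq> k \<longrightarrow> u a = w a) \<and> f u = 0"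
proof -
  let ?A = "{a \<in> A. \<kappa> a \<in> {k}}"
  have "{a \<in> A. \<kappa> a = k} \<noteq> {}" using k(1) by (intro notI) (simp only: card.empty)
  then have img: "\<kappa> ` ?A = {k}" by auto
  have "\<exists>u. blocks_nonzero ?A \<kappa> u \<and> (\<forall>i\<in>{()}. f (\<lambda>b. if \<kappa> b \<in> {k} then u b else w b) = 0)"
  proof (rule common_zero)
    show "card {()} + card (\<kappa> ` ?A) \<le> card ?A" unfolding img using k(1) by simp
    show "\<forall>i\<in>{()}. form ?A \<kappa> m (\<lambda>u. f (\<lambda>b. if \<kappa> b \<in> {k} then u b else w b))"
      using form_merge[OF fin F] by blast
  qed (use fin k(2) in auto)
  then obtain u where u: "blocks_nonzero ?A \<kappa> u" "f (\<lambda>b. if \<kappa> b = k then u b else w b) = 0" by auto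
  have "\<exists>a\<in>?A. \<kappa> a = k \<and> u a \<noteq> 0"
    using u(1) unfolding blocks_nonzero_def img by blast
  with u(2) show ?thesis by (intro exI[of _ "\<lambda>b. if \<kappa> b = k then u b else w b"]) auto
qed

lemma form_scale_block:
  assumes "finite A" "form A \<kappa> m f" "k \<in> \<kappa> ` A"
  shows "f (\<lambda>a. if \<kappa> a = k then c * u a else u a) = c ^ m k * f u"
proof -
  have "(\<lambda>a. if \<kappa> a = k then c * u a else u a) = (\<lambda>a. (if \<kappa> a = k then c else 1) * u a)" by auto
  then have "f (\<lambda>a. if \<kappa> a = k then c * u a else u a) =
      (\<Prod>j\<in>\<kappa> ` A. (if j = k then c else 1) ^ m j) * f u"
    using form_scale[OF assms(2), of "\<lambda>j. if j = k then c else 1" u] by simp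
  also have "(\<Prod>j\<in>\<kappa> ` A. (if j = k then c else 1) ^ m j) = (\<Prod>j\<in>\<kappa> ` A. if j = k then c ^ m j else 1)"
    by (rule prod.cong) auto
  also have "\<dots> = c ^ m k" using assms by simp
  finally show ?thesis .
qed

text \<open>Scaling block \<open>k\<close> by 0 does not change the value, because 0 to the power 0
  is 1, and it makes the two arguments equal on \<open>A\<close>.\<close>

lemma form_degree_0_in_block:
  assumes "finite A" "form A \<kappa> m f" "k \<in> \<kappa> ` A" "m k = 0"
    and "\<And>a. a \<in> A \<Longrightarrow> \<kappa> a \<noteq> k \<Longrightarrow> u a = w a"
  shows "f u = f w"
proof -
  have "f u = f (\<lambda>a. if \<kappa> a = k then 0 else u a)"
    using form_scale_block[OF assms(1,2,3), of 0 u] assms(4) by (simp cong: if_cong)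
  also have "\<dots> = f (\<lambda>a. if \<kappa> a = k then 0 else w a)"
    by (rule form_cong[OF assms(2)]) (use assms(5) in auto)
  also have "\<dots> = f w" using form_scale_block[OF assms(1,2,3), of 0 w] assms(4) by (simp cong: if_cong)
  finally show ?thesis .
qed

text \<open>Homogeneity of degree 1 kills the constant and the higher terms of the expansion at the
  point whose block is 0, so only the gradient remains.\<close>

lemma form_degree_1_in_block:
  assumes fin: "finite A" and F: "form A \<kappa> m f" and k: "k \<in> \<kappa> ` A" "m k = 1"
  shows "f u = (\<Sum>b | b \<in> A \<and> \<kappa> b = k. u b * f (\<lambda>a. if \<kappa> a = k then (if a = b then 1 else 0) else u a))"
proof -
  let ?B = "{b. b \<in> A \<and> \<kappa> b = k}"
  have finB: "finite ?B" using fin by simp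
  define p where "p = (\<lambda>a. if \<kappa> a = k then 0 else u a)"
  obtain g where g: "\<And>v. (\<forall>a. a \<notin> ?B \<longrightarrow> v a = 0) \<Longrightarrow>
    (\<exists>q. \<forall>t. f (\<lambda>a. p a + t * v a) = f p + t * (\<Sum>a\<in>?B. g a * v a) + t\<^sup>2 * poly q t)"
    using polyfun_expansion[OF form_polyfun[OF F] finB, of p] by blast
  have lin: "f (\<lambda>a. p a + v a) = (\<Sum>a\<in>?B. g a * v a)" if v: "\<forall>a. a \<notin> ?B \<longrightarrow> v a = 0" for v
  proof -
    obtain q where q: "\<And>t. f (\<lambda>a. p a + t * v a) = f p + t * (\<Sum>a\<in>?B. g a * v a) + t\<^sup>2 * poly q t"
      using g[OF v] by blast
    have s: "f (\<lambda>a. p a + t * v a) = t * f (\<lambda>a. p a + v a)" for t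
    proof -
      have "(\<lambda>a. p a + t * v a) = (\<lambda>a. if \<kappa> a = k then t * (p a + v a) else p a + v a)"
        using v by (auto simp: p_def)
      then show ?thesis using form_scale_block[OF fin F k(1), of t "\<lambda>a. p a + v a"] k(2) by simp
    qed
    have "poly (pCons (f p) (pCons ((\<Sum>a\<in>?B. g a * v a) - f (\<lambda>a. p a + v a)) q)) t = 0" for t
      using q[of t] s[of t] by (simp add: algebra_simps power2_eq_square)
    then have "pCons (f p) (pCons ((\<Sum>a\<in>?B. g a * v a) - f (\<lambda>a. p a + v a)) q) = 0"
      using poly_all_0_iff_0 by blast
    then show ?thesis by simp
  qed
  have e: "f (\<lambda>a. if \<kappa> a = k then (if a = b then 1 else 0) else u a) = g b" if b: "b \<in> ?B" for b
  proof -
    have "f (\<lambda>a. if \<kappa> a = k then (if a = b then 1 else 0) else u a) = f (\<lambda>a. p a + (if a = b then 1 else 0))"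
      by (rule form_cong[OF F]) (use b in \<open>auto simp: p_def\<close>)
    also have "\<dots> = (\<Sum>a\<in>?B. g a * (if a = b then 1 else 0))" by (rule lin) (use b in auto)
    also have "\<dots> = (\<Sum>a\<in>?B. if a = b then g a else 0)" by (rule sum.cong) auto
    also have "\<dots> = g b" using b finB by simp
    finally show ?thesis .
  qed
  have "f u = f (\<lambda>a. p a + (if a \<in> ?B then u a else 0))"
    by (rule form_cong[OF F]) (auto simp: p_def)
  also have "\<dots> = (\<Sum>a\<in>?B. g a * (if a \<in> ?B then u a else 0))" by (rule lin) auto
  also have "\<dots> = (\<Sum>b\<in>?B. u b * f (\<lambda>a. if \<kappa> a = k then (if a = b then 1 else 0) else u a))"
    by (rule sum.cong) (auto simp: e)
  finally show ?thesis .
qed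

text \<open>A coefficient has degree 0 in its own block, so the block may be replaced by a unit
  vector; there the radial relation consists of this coefficient alone.\<close>

lemma twisted_degree_le_1:
  assumes fin: "finite A" and tw: "twisted A \<kappa> d s" and a: "a \<in> A" "d (\<kappa> a) \<le> 1"
  shows "s a u = 0"
proof -
  let ?k = "\<kappa> a"
  define w where "w = (\<lambda>b. if \<kappa> b = ?k then (if b = a then 1 else 0) else u b)"
  have k: "?k \<in> \<kappa> ` A" using a by simp
  have "s a u = s a w"
    by (rule form_degree_0_in_block[OF fin twisted_form_component[OF tw a(1)] k])
       (use a in \<open>auto simp: w_def\<close>)
  also have "s a w = (\<Sum>b | b \<in> A \<and> \<kappa> b = ?k. w b * s b w)"
    by (subst sum.remove[of _ a]) (use fin a in \<open>auto simp: w_def intro!: sum.neutral[symmetric]\<close>)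
  also have "\<dots> = 0" by (rule twisted_radial[OF tw k])
  finally show ?thesis .
qed

section \<open>Blocks of dimension one and two\<close>

lemma line_radial:
  assumes tw: "twisted A \<kappa> d s" and blk: "{e. e \<in> A \<and> \<kappa> e = k} = {a, b}" "a \<noteq> b"
  shows "u a * s a u + u b * s b u = 0"
proof -
  have "a \<in> A" "\<kappa> a = k" using blk(1) by blast+
  then have "k \<in> \<kappa> ` A" by blast
  from twisted_radial[OF tw this, of u] show ?thesis unfolding blk(1) using blk(2) by simp
qed

text \<open>On a line block of degree 2 the radial relation leaves the coefficients
  \<open>h * u b\<close> and \<open>- h * u a\<close> with \<open>h\<close> depending only on the
  other blocks. Vanishing of the block is therefore the single equation \<open>h = 0\<close>, and
  \<open>h\<close> is the value of \<open>s a\<close> at the point (0, 1) of the line.\<close>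

lemma line_vanish:
  assumes fin: "finite A" and tw: "twisted A \<kappa> d s"
    and blk: "{e. e \<in> A \<and> \<kappa> e = k} = {a, b}" "a \<noteq> b" and d: "d k = 2"
    and w: "s a (w(a := 0, b := 1)) = 0" "\<And>e. e \<in> A \<Longrightarrow> \<kappa> e \<noteq> k \<Longrightarrow> u e = w e"
  shows "s a u = 0" "s b u = 0"
proof -
  have ab: "a \<in> A" "\<kappa> a = k" "b \<in> A" "\<kappa> b = k" using blk(1) by blast+
  then have k: "k \<in> \<kappa> ` A" by blast
  note rad = line_radial[OF tw blk]
  have lin: "s e u = u a * s e (w(a := 1, b := 0)) + u b * s e (w(a := 0, b := 1))"
    "s e (w(a := 1, b := 1)) = s e (w(a := 1, b := 0)) + s e (w(a := 0, b := 1))"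
    if e: "e \<in> A" "\<kappa> e = k" for e
  proof -
    note F = twisted_form_component[OF tw e(1)]
    have B: "e' = a \<or> e' = b" if "e' \<in> A" "\<kappa> e' = k" for e' using blk(1) that by blast
    have lin: "s e v = v a * s e (w(a := 1, b := 0)) + v b * s e (w(a := 0, b := 1))"
      if v: "\<And>e. e \<in> A \<Longrightarrow> \<kappa> e \<noteq> k \<Longrightarrow> v e = w e" for v
    proof -
      have "s e v = (\<Sum>b | b \<in> A \<and> \<kappa> b = k. v b * s e (\<lambda>a. if \<kappa> a = k then (if a = b then 1 else 0) else v a))"
        by (rule form_degree_1_in_block[OF fin F k]) (use d e in simp)
      also have "\<dots> = v a * s e (\<lambda>e. if \<kappa> e = k then (if e = a then 1 else 0) else v e)
          + v b * s e (\<lambda>e. if \<kappa> e = k then (if e = b then 1 else 0) else v e)"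
        unfolding blk(1) using blk(2) by simp
      also have "s e (\<lambda>e. if \<kappa> e = k then (if e = a then 1 else 0) else v e) = s e (w(a := 1, b := 0))"
        by (rule form_cong[OF F]) (use B v ab blk(2) in auto)
      also have "s e (\<lambda>e. if \<kappa> e = k then (if e = b then 1 else 0) else v e) = s e (w(a := 0, b := 1))"
        by (rule form_cong[OF F]) (use B v ab blk(2) in auto)
      finally show ?thesis .
    qed
    show "s e u = u a * s e (w(a := 1, b := 0)) + u b * s e (w(a := 0, b := 1))"
      by (rule lin) (use w(2) in auto)
    show "s e (w(a := 1, b := 1)) = s e (w(a := 1, b := 0)) + s e (w(a := 0, b := 1))"
      by (subst lin) (use ab blk(2) in auto)
  qed
  have 1: "s a (w(a := 1, b := 0)) = 0" using rad[of "w(a := 1, b := 0)"] blk(2) by simp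
  have 2: "s b (w(a := 0, b := 1)) = 0" using rad[of "w(a := 0, b := 1)"] blk(2) by simp
  have 3: "s b (w(a := 1, b := 0)) = 0"
    using rad[of "w(a := 1, b := 1)"] lin(2)[OF ab(1,2)] lin(2)[OF ab(3,4)] 1 2 w(1) blk(2) by simp
  show "s a u = 0" "s b u = 0"
    using lin(1)[OF ab(1,2)] lin(1)[OF ab(3,4)] 1 2 3 w(1) by simp_all
qed

text \<open>At the point (0, 1) of the line the radial relation forces \<open>s b\<close> to vanish,
  so a single form of positive degree in block \<open>j\<close> is left, and it has a zero along
  \<open>j\<close>.\<close>

lemma line_zero_along_block:
  assumes fin: "finite A" and tw: "twisted A \<kappa> d s"
    and blk: "{e. e \<in> A \<and> \<kappa> e = k} = {a, b}" "a \<noteq> b"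
    and j: "j \<noteq> k" "card {e \<in> A. \<kappa> e = j} \<ge> 2" "d j \<ge> 1"
  shows "\<exists>u. (\<exists>e\<in>A. \<kappa> e = j \<and> u e \<noteq> 0) \<and> (\<forall>e. \<kappa> e \<noteq> j \<longrightarrow> u e = w e) \<and>
    s a (u(a := 0, b := 1)) = 0 \<and> s b (u(a := 0, b := 1)) = 0"
proof -
  have ab: "a \<in> A" "\<kappa> a = k" "\<kappa> b = k" using blk(1) by blast+
  obtain v where v: "\<exists>e\<in>A. \<kappa> e = j \<and> v e \<noteq> 0"
    "\<And>e. \<kappa> e \<noteq> j \<Longrightarrow> v e = (w(a := 0, b := 1)) e" "s a v = 0"
    using form_zero_in_block[OF fin twisted_form_component[OF tw ab(1)] j(2), of "w(a := 0, b := 1)"]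
      j ab by auto
  \<comment> \<open>The coordinates \<open>a\<close> and \<open>b\<close> go back to their values in
    \<open>w\<close>, so that only block \<open>j\<close> has moved.\<close>
  define u where "u = v(a := w a, b := w b)"
  have uv: "u(a := 0, b := 1) = v"
    using v(2)[of a] v(2)[of b] ab j(1) blk(2) by (auto simp: u_def fun_eq_iff)
  have "s b v = 0" using line_radial[OF tw blk, of v] v(2)[of a] v(2)[of b] ab j(1) blk(2) v(3) by simp
  moreover have "\<exists>e\<in>A. \<kappa> e = j \<and> u e \<noteq> 0" using v(1) ab j(1) by (auto simp: u_def)
  moreover have "\<forall>e. \<kappa> e \<noteq> j \<longrightarrow> u e = w e" using v(2) by (simp add: u_def)
  ultimately show ?thesis using v(3) unfolding uv[symmetric] by blast
qed

text \<open>The equation of a line block of degree 2 does not involve its own line. So the equation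
  for \<open>i\<close> is solved along \<open>j\<close>, then that for \<open>j\<close> along
  \<open>i\<close>, and the second move does not disturb the first equation.\<close>

lemma two_lines_has_zero:
  assumes fin: "finite A" and tw: "twisted A \<kappa> d s" and d2: "\<And>k. k \<in> \<kappa> ` A \<Longrightarrow> d k \<ge> 2"
    and i: "{e. e \<in> A \<and> \<kappa> e = i} = {a, b}" "a \<noteq> b"
    and j: "{e. e \<in> A \<and> \<kappa> e = j} = {a', b'}" "a' \<noteq> b'" and ij: "i \<noteq> j"
    and other: "\<And>k. k \<in> \<kappa> ` A \<Longrightarrow> k \<noteq> i \<Longrightarrow> k \<noteq> j \<Longrightarrow> d k \<noteq> 2"
  shows "has_zero A \<kappa> s"
proof -
  have "a \<in> A" "\<kappa> a = i" "a' \<in> A" "\<kappa> a' = j" using i(1) j(1) by blast+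
  then have ij_in: "i \<in> \<kappa> ` A" "j \<in> \<kappa> ` A" by blast+
  have card: "card {e \<in> A. \<kappa> e = i} \<ge> 2" "card {e \<in> A. \<kappa> e = j} \<ge> 2"
    unfolding i(1) j(1) using i(2) j(2) by simp_all
  have d1: "d i \<ge> 1" "d j \<ge> 1" using d2[OF ij_in(1)] d2[OF ij_in(2)] by simp_all
  obtain v where v: "\<exists>e\<in>A. \<kappa> e = j \<and> v e \<noteq> 0" "\<forall>e. \<kappa> e \<noteq> j \<longrightarrow> v e = 1"
    "s a (v(a := 0, b := 1)) = 0"
    using line_zero_along_block[OF fin tw i ij[symmetric] card(2) d1(2), of "\<lambda>_. 1"] by blast
  obtain u where u: "\<exists>e\<in>A. \<kappa> e = i \<and> u e \<noteq> 0" "\<forall>e. \<kappa> e \<noteq> i \<longrightarrow> u e = v e"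
    "s a' (u(a' := 0, b' := 1)) = 0"
    using line_zero_along_block[OF fin tw j ij card(1) d1(1), of v] by blast
  show ?thesis
  proof (rule twisted_has_zero[OF fin tw d2])
    show "blocks_nonzero A \<kappa> u"
    proof -
      have "blocks_nonzero A \<kappa> v"
        using v blocks_nonzero_change_block[OF blocks_nonzero_one, of A \<kappa> j v] by blast
      then show ?thesis using u blocks_nonzero_change_block[of A \<kappa> v i u] by blast
    qed
    fix e assume e: "e \<in> A" "d (\<kappa> e) = 2"
    then have "\<kappa> e = i \<or> \<kappa> e = j" using other[of "\<kappa> e"] by blast
    then consider "\<kappa> e = i" "e = a \<or> e = b" | "\<kappa> e = j" "e = a' \<or> e = b'"
      using i(1) j(1) e(1) by blast
    then show "s e u = 0"
    proof cases
      case 1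
      then show ?thesis using line_vanish[OF fin tw i _ v(3), of u] u(2) e(2) by auto
    next
      case 2
      then show ?thesis using line_vanish[OF fin tw j _ u(3), of u] e(2) by auto
    qed
  qed
qed

text \<open>Block \<open>j\<close> only has to supply room for a zero of the one equation of line
  \<open>i\<close>; its own degree differs from 2, so the weights take care of it.\<close>

lemma line_and_block_has_zero:
  assumes fin: "finite A" and tw: "twisted A \<kappa> d s" and d2: "\<And>k. k \<in> \<kappa> ` A \<Longrightarrow> d k \<ge> 2"
    and i: "{e. e \<in> A \<and> \<kappa> e = i} = {a, b}" "a \<noteq> b"
    and j: "i \<noteq> j" "card {e \<in> A. \<kappa> e = j} \<ge> 2" "d j \<ge> 1"
    and other: "\<And>k. k \<in> \<kappa> ` A \<Longrightarrow> k \<noteq> i \<Longrightarrow> d k \<noteq> 2"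
  shows "has_zero A \<kappa> s"
proof -
  obtain v where v: "\<exists>e\<in>A. \<kappa> e = j \<and> v e \<noteq> 0" "\<forall>e. \<kappa> e \<noteq> j \<longrightarrow> v e = 1"
    "s a (v(a := 0, b := 1)) = 0"
    using line_zero_along_block[OF fin tw i j(1)[symmetric] j(2,3), of "\<lambda>_. 1"] by blast
  show ?thesis
  proof (rule twisted_has_zero[OF fin tw d2])
    show "blocks_nonzero A \<kappa> v"
      using v blocks_nonzero_change_block[OF blocks_nonzero_one, of A \<kappa> j v] by blast
    fix e assume e: "e \<in> A" "d (\<kappa> e) = 2"
    then have "\<kappa> e = i" using other[of "\<kappa> e"] by blast
    moreover from this have "e = a \<or> e = b" using i(1) e(1) by blast
    ultimately show "s e v = 0" using line_vanish[OF fin tw i _ v(3), of v] e(2) by auto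
  qed
qed

text \<open>With all other blocks zero, a degree above 2 gives a zero already on a slice where only
  the line varies, and a positive degree in another block \<open>j\<close> lets both coefficients at
  (0, 1) vanish somewhere along \<open>j\<close>.\<close>

lemma line_only_degree:
  assumes fin: "finite A" and tw: "twisted A \<kappa> d s"
    and i: "{e. e \<in> A \<and> \<kappa> e = i} = {a, b}" "a \<noteq> b" and di: "d i \<ge> 2"
    and zero: "\<And>e u. e \<in> A \<Longrightarrow> \<kappa> e \<noteq> i \<Longrightarrow> s e u = 0"
    and nz: "\<not> has_zero A \<kappa> s"
  shows "d i = 2"
    and "\<And>j. j \<noteq> i \<Longrightarrow> card {e \<in> A. \<kappa> e = j} \<ge> 2 \<Longrightarrow> d j = 0"
proof -
  have ab: "a \<in> A" "\<kappa> a = i" "b \<in> A" "\<kappa> b = i" using i(1) by blast+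
  show "d i = 2"
  proof (rule ccontr)
    assume d: "d i \<noteq> 2"
    \<comment> \<open>On the slice no block has degree 2, so the premise about a common zero holds
      vacuously at the point with all coordinates 1.\<close>
    have "has_zero {e \<in> A. \<kappa> e \<in> {i}} \<kappa> (\<lambda>e u. s e (\<lambda>b. if \<kappa> b \<in> {i} then u b else 1))"
      by (rule twisted_has_zero[OF _ twisted_merge[OF fin tw] _ blocks_nonzero_one])
         (use fin di d in auto)
    then have "has_zero A \<kappa> s" by (rule has_zero_merge[OF _ blocks_nonzero_one]) (use zero in auto)
    with nz show False ..
  qed
  show "d j = 0" if j: "j \<noteq> i" "card {e \<in> A. \<kappa> e = j} \<ge> 2" for j
  proof (rule ccontr)
    assume "d j \<noteq> 0"
    then have "d j \<ge> 1" by simp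
    from line_zero_along_block[OF fin tw i j this, of "\<lambda>_. 1"]
    obtain v where v: "\<exists>e\<in>A. \<kappa> e = j \<and> v e \<noteq> 0" "\<forall>e. \<kappa> e \<noteq> j \<longrightarrow> v e = 1"
      "s a (v(a := 0, b := 1)) = 0" "s b (v(a := 0, b := 1)) = 0"
      by blast
    have "blocks_nonzero A \<kappa> v"
      using v blocks_nonzero_change_block[OF blocks_nonzero_one, of A \<kappa> j v] by blast
    then have "blocks_nonzero A \<kappa> (v(a := 0, b := 1))"
      by (rule blocks_nonzero_change_block[of _ _ _ i _ b]) (use ab in auto)
    moreover have "s e (v(a := 0, b := 1)) = 0" if "e \<in> A" for e
      using zero[OF that] v(3,4) i(1) that by (cases "\<kappa> e = i") auto
    ultimately show False using nz unfolding has_zero_def by blast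
  qed
qed

text \<open>
  The skew matrix of a plane block of degree 2 acts as the cross product with its kernel vector
  \<open>(P, Q, R)\<close>.
\<close>

lemma plane_cross_product:
  assumes fin: "finite A" and tw: "twisted A \<kappa> d s"
    and blk: "{e. e \<in> A \<and> \<kappa> e = k} = {a, b, c}" "a \<noteq> b" "a \<noteq> c" "b \<noteq> c" and d: "d k = 2"
    and w: "\<And>e. e \<in> A \<Longrightarrow> \<kappa> e \<noteq> k \<Longrightarrow> u e = w e"
  defines "P \<equiv> s b (w(a := 0, b := 0, c := 1))"
    and "Q \<equiv> - s a (w(a := 0, b := 0, c := 1))"
    and "R \<equiv> s a (w(a := 0, b := 1, c := 0))"
  shows "s a u = u b * R - u c * Q" "s b u = u c * P - u a * R" "s c u = u a * Q - u b * P"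
proof -
  have abc: "a \<in> A" "\<kappa> a = k" "b \<in> A" "\<kappa> b = k" "c \<in> A" "\<kappa> c = k"
    using blk(1) by blast+
  then have k: "k \<in> \<kappa> ` A" by blast
  have ne: "b \<noteq> a" "c \<noteq> a" "c \<noteq> b" using blk by auto
  have rad: "v a * s a v + v b * s b v + v c * s c v = 0" for v
    using twisted_radial[OF tw k, of v] unfolding blk(1) using blk(2-4) by (simp add: add.assoc)
  define x1 x2 x3 where "x1 = w(a := 1, b := 0, c := 0)" and "x2 = w(a := 0, b := 1, c := 0)"
    and "x3 = w(a := 0, b := 0, c := 1)"
  have lin: "s e v = v a * s e x1 + v b * s e x2 + v c * s e x3"
    if e: "e \<in> A" "\<kappa> e = k" and v: "\<And>e. e \<in> A \<Longrightarrow> \<kappa> e \<noteq> k \<Longrightarrow> v e = w e" for e v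
  proof -
    note F = twisted_form_component[OF tw e(1)]
    have B: "e' = a \<or> e' = b \<or> e' = c" if "e' \<in> A" "\<kappa> e' = k" for e' using blk(1) that by blast
    have "s e v = (\<Sum>b | b \<in> A \<and> \<kappa> b = k. v b * s e (\<lambda>a. if \<kappa> a = k then (if a = b then 1 else 0) else v a))"
      by (rule form_degree_1_in_block[OF fin F k]) (use d e in simp)
    also have "\<dots> = v a * s e (\<lambda>e. if \<kappa> e = k then (if e = a then 1 else 0) else v e)
        + v b * s e (\<lambda>e. if \<kappa> e = k then (if e = b then 1 else 0) else v e)
        + v c * s e (\<lambda>e. if \<kappa> e = k then (if e = c then 1 else 0) else v e)"
      unfolding blk(1) using blk(2-4) by simp
    also have "s e (\<lambda>e. if \<kappa> e = k then (if e = a then 1 else 0) else v e) = s e x1"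
      unfolding x1_def by (rule form_cong[OF F]) (use B v abc blk(2-4) in auto)
    also have "s e (\<lambda>e. if \<kappa> e = k then (if e = b then 1 else 0) else v e) = s e x2"
      unfolding x2_def by (rule form_cong[OF F]) (use B v abc blk(2-4) in auto)
    also have "s e (\<lambda>e. if \<kappa> e = k then (if e = c then 1 else 0) else v e) = s e x3"
      unfolding x3_def by (rule form_cong[OF F]) (use B v abc blk(2-4) in auto)
    finally show ?thesis .
  qed
  have x: "x1 a = 1" "x1 b = 0" "x1 c = 0" "x2 a = 0" "x2 b = 1" "x2 c = 0" "x3 a = 0" "x3 b = 0" "x3 c = 1"
    using blk(2-4) ne by (auto simp: x1_def x2_def x3_def)
  have diag: "s a x1 = 0" "s b x2 = 0" "s c x3 = 0"
    using rad[of x1] rad[of x2] rad[of x3] by (simp_all add: x)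
  \<comment> \<open>Polarization: the radial relation at a sum of two basis vectors gives the skew
    symmetry of the linear coefficients.\<close>
  have skew: "s b x1 = - s a x2" "s c x1 = - s a x3" "s c x2 = - s b x3"
  proof -
    have out: "(w(a := p, b := q, c := r)) e = w e" if "\<kappa> e \<noteq> k" for e p q r
      using that abc by auto
    show "s b x1 = - s a x2"
      using rad[of "w(a := 1, b := 1, c := 0)"] lin[OF abc(1,2), of "w(a := 1, b := 1, c := 0)"]
        lin[OF abc(3,4), of "w(a := 1, b := 1, c := 0)"] out diag blk(2-4) ne
      by (simp add: eq_neg_iff_add_eq_0 add.commute)
    show "s c x1 = - s a x3"
      using rad[of "w(a := 1, b := 0, c := 1)"] lin[OF abc(1,2), of "w(a := 1, b := 0, c := 1)"]
        lin[OF abc(5,6), of "w(a := 1, b := 0, c := 1)"] out diag blk(2-4) ne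
      by (simp add: eq_neg_iff_add_eq_0 add.commute)
    show "s c x2 = - s b x3"
      using rad[of "w(a := 0, b := 1, c := 1)"] lin[OF abc(3,4), of "w(a := 0, b := 1, c := 1)"]
        lin[OF abc(5,6), of "w(a := 0, b := 1, c := 1)"] out diag blk(2-4) ne
      by (simp add: eq_neg_iff_add_eq_0 add.commute)
  qed
  have PQR: "P = s b x3" "Q = - s a x3" "R = s a x2" by (simp_all add: P_def Q_def R_def x2_def x3_def)
  note L = lin[of _ u, OF _ _ w]
  show "s a u = u b * R - u c * Q" "s b u = u c * P - u a * R" "s c u = u a * Q - u b * P"
    using L[OF abc(1,2)] L[OF abc(3,4)] L[OF abc(5,6)] diag skew unfolding PQR by simp_all
qed

text \<open>A skew matrix of size 3 is singular, so over a fixed point of the other factors the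
  block vanishes somewhere on the plane: at \<open>(P, Q, R)\<close>, or everywhere if this vector
  is 0.\<close>

lemma plane_has_zero:
  assumes fin: "finite A" and tw: "twisted A \<kappa> d s" and d2: "\<And>k. k \<in> \<kappa> ` A \<Longrightarrow> d k \<ge> 2"
    and blk: "{e. e \<in> A \<and> \<kappa> e = k} = {a, b, c}" "a \<noteq> b" "a \<noteq> c" "b \<noteq> c"
    and other: "\<And>j. j \<in> \<kappa> ` A \<Longrightarrow> j \<noteq> k \<Longrightarrow> d j \<noteq> 2"
  shows "has_zero A \<kappa> s"
proof -
  have abc: "a \<in> A" "\<kappa> a = k" "b \<in> A" "\<kappa> b = k" "c \<in> A" "\<kappa> c = k" using blk(1) by blast+
  define P Q R where "P = s b ((\<lambda>_. 1)(a := 0, b := 0, c := 1))"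
    and "Q = - s a ((\<lambda>_. 1)(a := 0, b := 0, c := 1))"
    and "R = s a ((\<lambda>_. 1)(a := 0, b := 1, c := 0))"
  define u where "u = (if P = 0 \<and> Q = 0 \<and> R = 0 then (\<lambda>_. 1) else (\<lambda>_. 1)(a := P, b := Q, c := R))"
  show ?thesis
  proof (rule twisted_has_zero[OF fin tw d2])
    have u1: "u e = 1" if "e \<noteq> a" "e \<noteq> b" "e \<noteq> c" for e using that by (simp add: u_def)
    have "u a \<noteq> 0 \<or> u b \<noteq> 0 \<or> u c \<noteq> 0" using blk(2-4) by (auto simp: u_def)
    then show "blocks_nonzero A \<kappa> u"
      using blocks_nonzero_change_block[OF blocks_nonzero_one, of A \<kappa> k u] abc u1 by metis
    fix e assume e: "e \<in> A" "d (\<kappa> e) = 2"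
    then have "\<kappa> e = k" using other[of "\<kappa> e"] by blast
    then have dk: "d k = 2" and e': "e = a \<or> e = b \<or> e = c" using e blk(1) by blast+
    have "u e = 1" if "e \<in> A" "\<kappa> e \<noteq> k" for e using u1 that abc by metis
    note pc = plane_cross_product[OF fin tw blk dk, of u "\<lambda>_. 1", OF this, folded P_def Q_def R_def]
    show "s e u = 0"
    proof (cases "P = 0 \<and> Q = 0 \<and> R = 0")
      case True
      then show ?thesis using pc e' by auto
    next
      case False
      then have "u a = P" "u b = Q" "u c = R" using blk(2-4) by (auto simp: u_def)
      then show ?thesis using pc e' by auto
    qed
  qed
qed

section \<open>The borderline degrees\<close>

lemma form_mult:
  "form A \<kappa> m f \<Longrightarrow> form A \<kappa> n g \<Longrightarrow> form A \<kappa> (\<lambda>k. m k + n k) (\<lambda>u. f u * g u)"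
  unfolding form_def by (auto intro: polyfun.intros simp: power_add prod.distrib algebra_simps)

lemma form_diff: "form A \<kappa> m f \<Longrightarrow> form A \<kappa> m g \<Longrightarrow> form A \<kappa> m (\<lambda>u. f u - g u)"
  unfolding form_def by (auto intro: polyfun_diff simp: algebra_simps)

lemma form_degree_cong:
  assumes "form A \<kappa> m f" "\<And>k. k \<in> \<kappa> ` A \<Longrightarrow> m k = n k"
  shows "form A \<kappa> n f"
proof -
  have "(\<Prod>k\<in>\<kappa> ` A. c k ^ m k) = (\<Prod>k\<in>\<kappa> ` A. c k ^ n k)" for c :: "'b \<Rightarrow> complex"
    using assms(2) by (intro prod.cong) auto
  then show ?thesis using assms(1) unfolding form_def by simp
qed

lemma form_add_blocks:
  fixes \<kappa> :: "'a \<Rightarrow> 'k"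
  assumes "finite A" and F: "form {a \<in> A. \<kappa> a \<in> K1} \<kappa> m f" and "K1 \<subseteq> K2"
  shows "form {a \<in> A. \<kappa> a \<in> K2} \<kappa> (\<lambda>k. if k \<in> K1 then m k else 0) f"
proof (rule formI)
  show "polyfun f" by (rule form_polyfun[OF F])
  show "f (\<lambda>a. if a \<in> {a \<in> A. \<kappa> a \<in> K2} then u a else 0) = f u" for u
    by (rule form_cong[OF F]) (use assms(3) in auto)
  fix c :: "'k \<Rightarrow> complex" and u
  have "(\<Prod>k\<in>\<kappa> ` {a \<in> A. \<kappa> a \<in> K2}. c k ^ (if k \<in> K1 then m k else 0)) =
      (\<Prod>k\<in>\<kappa> ` {a \<in> A. \<kappa> a \<in> K1}. c k ^ m k)"
    by (rule prod.mono_neutral_cong_right) (use assms in auto)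
  then show "f (\<lambda>a. c (\<kappa> a) * u a) =
      (\<Prod>k\<in>\<kappa> ` {a \<in> A. \<kappa> a \<in> K2}. c k ^ (if k \<in> K1 then m k else 0)) * f u"
    using form_scale[OF F, of c u] by simp
qed

section \<open>Binary quadratics and their resultant\<close>

lemma poly_eq_off_0:
  fixes p q :: "complex poly"
  assumes "\<And>t. t \<noteq> 0 \<Longrightarrow> poly p t = poly q t"
  shows "p = q"
proof -
  have "poly ([:0, 1:] * (p - q)) t = 0" for t using assms[of t] by (cases "t = 0") auto
  then have "[:0, 1:] * (p - q) = 0" using poly_all_0_iff_0 by blast
  then show ?thesis by simp
qed

text \<open>Each affine chart of the line turns \<open>f\<close> into a polynomial in one variable,
  and homogeneity relates the two by inversion of \<open>t\<close>; this bounds the degree by 2. The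
  coefficients are recovered from the values at (1, 0), (0, 1) and (1, 1).\<close>

lemma form_degree_2_on_line:
  assumes fin: "finite A" and F: "form A \<kappa> m f" and m: "m k = 2"
    and blk: "{e. e \<in> A \<and> \<kappa> e = k} = {a, b}" "a \<noteq> b"
  shows "f (w(a := x, b := y)) = f (w(a := 1, b := 0)) * x\<^sup>2 +
    (f (w(a := 1, b := 1)) - f (w(a := 1, b := 0)) - f (w(a := 0, b := 1))) * (x * y) +
    f (w(a := 0, b := 1)) * y\<^sup>2"
proof -
  have ab: "a \<in> A" "\<kappa> a = k" "b \<in> A" "\<kappa> b = k" using blk(1) by blast+
  then have k: "k \<in> \<kappa> ` A" by blast
  have B: "e = a \<or> e = b" if "e \<in> A" "\<kappa> e = k" for e using blk(1) that by blast
  define h where "h x y = f (w(a := x, b := y))" for x y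
  have hom: "h (c * x) (c * y) = c\<^sup>2 * h x y" for c x y
  proof -
    have "h (c * x) (c * y) = f (\<lambda>e. if \<kappa> e = k then c * (w(a := x, b := y)) e else (w(a := x, b := y)) e)"
      unfolding h_def by (rule form_cong[OF F]) (use B ab in auto)
    then show ?thesis unfolding form_scale_block[OF fin F k] m h_def .
  qed
  have "\<exists>Q. \<forall>t. f (\<lambda>a. p a + t * (if a = e then 1 else 0)) = poly Q t" for p e
  proof -
    have "finite {e}" by simp
    from polyfun_expansion[OF form_polyfun[OF F] this, of p] obtain g where
      g: "\<forall>v. (\<forall>a. a \<notin> {e} \<longrightarrow> v a = 0) \<longrightarrow>
        (\<exists>q. \<forall>t. f (\<lambda>a. p a + t * v a) = f p + t * (\<Sum>a\<in>{e}. g a * v a) + t\<^sup>2 * poly q t)"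
      by (elim exE)
    have "\<exists>q. \<forall>t. f (\<lambda>a. p a + t * (if a = e then 1 else 0)) =
        f p + t * (\<Sum>a\<in>{e}. g a * (if a = e then 1 else 0)) + t\<^sup>2 * poly q t"
      by (rule g[rule_format]) simp
    then obtain q where "\<And>t. f (\<lambda>a. p a + t * (if a = e then 1 else 0)) =
        f p + t * (\<Sum>a\<in>{e}. g a * (if a = e then 1 else 0)) + t\<^sup>2 * poly q t"
      by blast
    then show ?thesis
      by (intro exI[of _ "pCons (f p) (pCons (g e) q)"]) (simp add: algebra_simps power2_eq_square)
  qed
  note ex = this
  have "(\<lambda>e. (w(a := 1, b := 0)) e + t * (if e = b then 1 else 0)) = w(a := 1, b := t)"
    "(\<lambda>e. (w(a := 0, b := 1)) e + t * (if e = a then 1 else 0)) = w(a := t, b := 1)" for t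
    using blk(2) by (auto simp: fun_eq_iff)
  then obtain Q Q' where Q: "\<And>t. h 1 t = poly Q t" and Q': "\<And>t. h t 1 = poly Q' t"
    using ex[of "w(a := 1, b := 0)" b] ex[of "w(a := 0, b := 1)" a] unfolding h_def by auto
  have swap: "poly Q' t = t\<^sup>2 * poly Q (inverse t)" if "t \<noteq> 0" for t
    using hom[of t 1 "inverse t"] that by (simp add: Q Q')
  have deg: "degree Q \<le> 2"
  proof (rule ccontr)
    assume n: "\<not> degree Q \<le> 2"
    \<comment> \<open>Were the degree larger than 2, the reflected polynomial would be divisible by
      its variable, but its constant term is the leading coefficient of \<open>Q\<close>.\<close>
    have "reflect_poly Q = monom 1 (degree Q - 2) * Q'"
    proof (rule poly_eq_off_0)
      fix t :: complex assume t: "t \<noteq> 0"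
      have "degree Q = (degree Q - 2) + 2" using n by simp
      then have "t ^ degree Q = t ^ (degree Q - 2) * t\<^sup>2" by (metis power_add)
      then show "poly (reflect_poly Q) t = poly (monom 1 (degree Q - 2) * Q') t"
        using t by (simp add: poly_reflect_poly_nz poly_monom swap)
    qed
    then have "coeff (reflect_poly Q) 0 = coeff (monom 1 (degree Q - 2) * Q') 0" by simp
    then have "lead_coeff Q = 0" using n by (simp add: coeff_mult)
    then show False using n by simp
  qed
  define c0 c1 c2 where "c0 = coeff Q 0" and "c1 = coeff Q 1" and "c2 = coeff Q 2"
  have Qeq: "Q = [:c0, c1, c2:]"
  proof (rule poly_eqI)
    fix n show "coeff Q n = coeff [:c0, c1, c2:] n"
      using deg by (cases "n \<le> 2")
        (auto simp: c0_def c1_def c2_def coeff_pCons coeff_eq_0 numeral_2_eq_2 le_Suc_eq split: nat.split)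
  qed
  have "Q' = [:c2, c1, c0:]"
  proof (rule poly_eq_off_0)
    fix t :: complex assume "t \<noteq> 0"
    then show "poly Q' t = poly [:c2, c1, c0:] t"
      unfolding swap[OF \<open>t \<noteq> 0\<close>] Qeq by (simp add: field_simps power2_eq_square)
  qed
  then have h01: "h 0 1 = c2" using Q'[of 0] by simp
  have h: "h x y = c0 * x\<^sup>2 + c1 * (x * y) + c2 * y\<^sup>2" for x y
  proof (cases "x = 0")
    case True
    then show ?thesis using hom[of y 0 1] by (simp add: h01)
  next
    case False
    have "h x y = x\<^sup>2 * (c0 + y / x * (c1 + y / x * c2))"
      using hom[of x 1 "y / x"] False by (simp add: Q Qeq)
    also have "\<dots> = c0 * x\<^sup>2 + c1 * (x * y) + c2 * y\<^sup>2"
      using False by (simp add: field_simps power2_eq_square)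
    finally show ?thesis .
  qed
  show ?thesis using h[of x y] h[of 1 0] h[of 0 1] h[of 1 1] unfolding h_def by simp
qed

lemma binary_quadratic_root:
  fixes b0 b1 b2 :: complex
  shows "\<exists>x y. (x \<noteq> 0 \<or> y \<noteq> 0) \<and> b0 * x\<^sup>2 + b1 * (x * y) + b2 * y\<^sup>2 = 0"
proof (cases "b0 = 0")
  case True
  then show ?thesis by (intro exI[of _ 1] exI[of _ 0]) simp
next
  case False
  define D where "D = csqrt (b1\<^sup>2 - 4 * b0 * b2)"
  have D: "D * D = b1 * b1 - 4 * b0 * b2"
    using power2_csqrt[of "b1\<^sup>2 - 4 * b0 * b2"] by (simp add: D_def power2_eq_square)
  have "b0 * (D - b1)\<^sup>2 + b1 * ((D - b1) * (2 * b0)) + b2 * (2 * b0)\<^sup>2 =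
      b0 * (D * D - b1 * b1 + 4 * b0 * b2)"
    by (simp add: power2_eq_square algebra_simps)
  also have "\<dots> = 0" unfolding D by simp
  finally show ?thesis using False by (intro exI[of _ "D - b1"] exI[of _ "2 * b0"]) simp
qed

text \<open>The triple \<open>l\<close>, \<open>- m\<close>, \<open>n\<close> is the cross product
  of the coefficient vectors, so it solves both equations in place of \<open>x\<^sup>2\<close>,
  \<open>x * y\<close>, \<open>y\<^sup>2\<close>. Vanishing of the resultant puts it on the conic of
  such triples, and then \<open>x = l\<close>, \<open>y = - m\<close> is a root, or (0, 1) if
  \<open>l = 0\<close>. If the cross product is 0, the quadratics are proportional and share a
  root.\<close>

lemma binary_quadratics_common_root:
  fixes b0 b1 b2 c0 c1 c2 :: complex
  assumes res: "(b0 * c2 - b2 * c0) * (b0 * c2 - b2 * c0) - (b0 * c1 - b1 * c0) * (b1 * c2 - b2 * c1) = 0"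
  shows "\<exists>x y. (x \<noteq> 0 \<or> y \<noteq> 0) \<and> b0 * x\<^sup>2 + b1 * (x * y) + b2 * y\<^sup>2 = 0 \<and>
    c0 * x\<^sup>2 + c1 * (x * y) + c2 * y\<^sup>2 = 0"
proof -
  define l m n where "l = b1 * c2 - b2 * c1" and "m = b0 * c2 - b2 * c0" and "n = b0 * c1 - b1 * c0"
  have b: "b0 * l - b1 * m + b2 * n = 0" and c: "c0 * l - c1 * m + c2 * n = 0"
    by (simp_all add: l_def m_def n_def algebra_simps)
  have r: "m * m = n * l" using res by (simp add: l_def m_def n_def)
  consider "l \<noteq> 0" | "l = 0" "n \<noteq> 0" | "l = 0" "n = 0" by blast
  then show ?thesis
  proof cases
    case 1
    have "b0 * l\<^sup>2 + b1 * (l * - m) + b2 * (- m)\<^sup>2 = l * (b0 * l - b1 * m + b2 * n)"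
      "c0 * l\<^sup>2 + c1 * (l * - m) + c2 * (- m)\<^sup>2 = l * (c0 * l - c1 * m + c2 * n)"
      using r by (simp_all add: power2_eq_square algebra_simps)
    then show ?thesis using 1 unfolding b c by (intro exI[of _ l] exI[of _ "-m"]) simp
  next
    case 2
    then have "m = 0" using r by simp
    then show ?thesis using 2 b c by (intro exI[of _ 0] exI[of _ 1]) simp
  next
    case 3
    then have "m = 0" using r by simp
    show ?thesis
    proof (cases "b0 = 0 \<and> b1 = 0 \<and> b2 = 0")
      case True
      then show ?thesis using binary_quadratic_root[of c0 c1 c2] by simp
    next
      case False
      obtain x y where xy: "x \<noteq> 0 \<or> y \<noteq> 0" "b0 * x\<^sup>2 + b1 * (x * y) + b2 * y\<^sup>2 = 0"
        using binary_quadratic_root by blast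
      define S where "S = c0 * x\<^sup>2 + c1 * (x * y) + c2 * y\<^sup>2"
      have z: "b1 * c2 = b2 * c1" "b0 * c2 = b2 * c0" "b0 * c1 = b1 * c0"
        using 3 \<open>m = 0\<close> by (simp_all add: l_def m_def n_def)
      have "b0 * S = c0 * (b0 * x\<^sup>2 + b1 * (x * y) + b2 * y\<^sup>2)"
        "b1 * S = c1 * (b0 * x\<^sup>2 + b1 * (x * y) + b2 * y\<^sup>2)"
        "b2 * S = c2 * (b0 * x\<^sup>2 + b1 * (x * y) + b2 * y\<^sup>2)"
        unfolding S_def distrib_left mult.assoc[symmetric]
        using z by (simp_all add: mult.commute)
      then have "S = 0" using xy(2) False by auto
      then show ?thesis using xy unfolding S_def by blast
    qed
  qed
qed

text \<open>
  With all degrees equal to 2 the three blocks are given by biquadratic forms in two blocks each;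
  the first block is eliminated by the resultant of the other two forms.
\<close>

lemma three_lines_degree_2_has_zero:
  assumes fin: "finite A" and tw: "twisted A \<kappa> d s" and K: "\<kappa> ` A = {i, j, k}"
    and ijk: "i \<noteq> j" "i \<noteq> k" "j \<noteq> k" and d: "d i = 2" "d j = 2" "d k = 2"
    and i: "{e. e \<in> A \<and> \<kappa> e = i} = {a, b}" "a \<noteq> b"
    and j: "{e. e \<in> A \<and> \<kappa> e = j} = {a', b'}" "a' \<noteq> b'"
    and k: "{e. e \<in> A \<and> \<kappa> e = k} = {a'', b''}" "a'' \<noteq> b''"
  shows "has_zero A \<kappa> s"
proof -
  have ab: "a \<in> A" "\<kappa> a = i" "b \<in> A" "\<kappa> b = i" using i(1) by blast+
  have ab': "a' \<in> A" "\<kappa> a' = j" "b' \<in> A" "\<kappa> b' = j" using j(1) by blast+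
  have ab'': "a'' \<in> A" "\<kappa> a'' = k" "b'' \<in> A" "\<kappa> b'' = k" using k(1) by blast+
  note ab_all = ab ab' ab''
  have cases: "e = a \<or> e = b \<or> e = a' \<or> e = b' \<or> e = a'' \<or> e = b''" if "e \<in> A" for e
  proof -
    have "\<kappa> e = i \<or> \<kappa> e = j \<or> \<kappa> e = k" using K that by blast
    then show ?thesis using i(1) j(1) k(1) that by blast
  qed
  note F = twisted_form_component[OF tw ab(1)]
  note F' = twisted_form_component[OF tw ab'(1)]
  note F'' = twisted_form_component[OF tw ab''(1)]
  let ?A = "{e \<in> A. \<kappa> e \<in> {j, k}}"
  have "?A = {e. e \<in> A \<and> \<kappa> e = j} \<union> {e. e \<in> A \<and> \<kappa> e = k}" by auto
  then have A': "?A = {a', b', a'', b''}" unfolding j(1) k(1) by auto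
  have img: "\<kappa> ` ?A = {j, k}" unfolding A' using ab' ab'' by simp
  have distinct: "a' \<noteq> a''" "a' \<noteq> b''" "b' \<noteq> a''" "b' \<noteq> b''" using ab_all ijk by auto
  have cardA: "card ?A = 4" unfolding A' using j(2) k(2) distinct by simp
  \<comment> \<open>Each block is represented by its one coefficient at the point (0, 1) of its own
    line. In \<open>B\<close> and \<open>C\<close> the coordinates of the first line are the
    parameters \<open>x\<close>, \<open>y\<close>, and one line is left as variable.\<close>
  define f where "f u = s a (\<lambda>e. if \<kappa> e \<in> {j, k} then u e else ((\<lambda>_. 0)(b := 1)) e)" for u
  define B where "B x y u = s a' (\<lambda>e. if \<kappa> e \<in> {k} then u e else ((\<lambda>_. 0)(b' := 1, a := x, b := y)) e)" for x y u
  define C where "C x y u = s a'' (\<lambda>e. if \<kappa> e \<in> {j} then u e else ((\<lambda>_. 0)(b'' := 1, a := x, b := y)) e)" for x y u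
  have ff: "form ?A \<kappa> (\<lambda>_. 2) f"
    unfolding f_def[abs_def]
    by (rule form_degree_cong[OF form_merge[OF fin F]], unfold img) (use ab ijk d in auto)
  have fB: "form ?A \<kappa> (\<lambda>l. if l = k then 2 else 0) (B x y)" for x y
    unfolding B_def[abs_def]
    by (rule form_degree_cong[OF form_add_blocks[OF fin form_merge[OF fin F']]], simp, unfold img)
       (use ab' ijk d in auto)
  have fC: "form ?A \<kappa> (\<lambda>l. if l = j then 2 else 0) (C x y)" for x y
    unfolding C_def[abs_def]
    by (rule form_degree_cong[OF form_add_blocks[OF fin form_merge[OF fin F'']]], simp, unfold img)
       (use ab'' ijk d in auto)
  \<comment> \<open>The mixed coefficient of \<open>B x y u\<close> as a quadratic in
    \<open>x\<close>, \<open>y\<close>, as in \<open>form_degree_2_on_line\<close>.\<close>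
  define B1 where "B1 u = B 1 1 u - B 1 0 u - B 0 1 u" for u
  define C1 where "C1 u = C 1 1 u - C 1 0 u - C 0 1 u" for u
  have fB1: "form ?A \<kappa> (\<lambda>l. if l = k then 2 else 0) B1"
    unfolding B1_def[abs_def] by (intro form_diff fB)
  have fC1: "form ?A \<kappa> (\<lambda>l. if l = j then 2 else 0) C1"
    unfolding C1_def[abs_def] by (intro form_diff fC)
  define R where "R u = (B 1 0 u * C 0 1 u - B 0 1 u * C 1 0 u) * (B 1 0 u * C 0 1 u - B 0 1 u * C 1 0 u)
    - (B 1 0 u * C1 u - B1 u * C 1 0 u) * (B1 u * C 0 1 u - B 0 1 u * C1 u)" for u
  have fR: "form ?A \<kappa> (\<lambda>_. 4) R"
    unfolding R_def[abs_def]
    by (rule form_degree_cong, (rule form_diff form_mult fB fC fB1 fC1)+, unfold img) (use ijk in auto)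
  \<comment> \<open>Each product of a \<open>B\<close> and a \<open>C\<close> has degree 2 on both
    remaining lines, so the resultant has degree 4 on each; with \<open>f\<close> these are two
    forms of positive degree on a product of two lines.\<close>
  have "\<exists>u. blocks_nonzero ?A \<kappa> u \<and> (\<forall>t\<in>{True, False}. (if t then f else R) u = 0)"
  proof (rule common_zero[where m = "\<lambda>t _. if t then 2 else 4"])
    show "card {True, False} + card (\<kappa> ` ?A) \<le> card ?A" unfolding img cardA using ijk by simp
    show "\<forall>t\<in>{True, False}. form ?A \<kappa> (\<lambda>_. if t then 2 else 4) (if t then f else R)" using ff fR by simp
  qed (use fin in auto)
  then obtain u where u: "blocks_nonzero ?A \<kappa> u" "f u = 0" "R u = 0" by auto
  from binary_quadratics_common_root[OF u(3)[unfolded R_def]]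
  obtain x y where xy: "x \<noteq> 0 \<or> y \<noteq> 0"
    "B 1 0 u * x\<^sup>2 + B1 u * (x * y) + B 0 1 u * y\<^sup>2 = 0"
    "C 1 0 u * x\<^sup>2 + C1 u * (x * y) + C 0 1 u * y\<^sup>2 = 0"
    by blast
  define v where "v = (\<lambda>e. if \<kappa> e \<in> {j, k} then u e else if e = a then x else if e = b then y else 0)"
  have "s a (v(a := 0, b := 1)) = f u"
    unfolding f_def by (rule form_cong[OF F]) (use cases ab_all ijk i(2) in \<open>auto simp: v_def\<close>)
  then have sa: "s a (v(a := 0, b := 1)) = 0" using u(2) by simp
  have eqB: "s a' (v(a' := 0, b' := 1, a := p, b := q)) = B p q u" for p q
    unfolding B_def
  proof (rule form_cong[OF F'])
    fix e assume "e \<in> A"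
    from cases[OF this] show "(v(a' := 0, b' := 1, a := p, b := q)) e = (if \<kappa> e \<in> {k} then u e
        else ((\<lambda>_. 0)(b' := 1, a := p, b := q)) e)"
      using ab_all ijk i(2) j(2) k(2) by (elim disjE) (auto simp: v_def)
  qed
  have eqC: "s a'' (v(a'' := 0, b'' := 1, a := p, b := q)) = C p q u" for p q
    unfolding C_def
  proof (rule form_cong[OF F''])
    fix e assume "e \<in> A"
    from cases[OF this] show "(v(a'' := 0, b'' := 1, a := p, b := q)) e = (if \<kappa> e \<in> {j} then u e
        else ((\<lambda>_. 0)(b'' := 1, a := p, b := q)) e)"
      using ab_all ijk i(2) j(2) k(2) by (elim disjE) (auto simp: v_def)
  qed
  have va: "v a = x" "v b = y" using ab ijk i(2) by (auto simp: v_def)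
  have "s a' (v(a' := 0, b' := 1, a := x, b := y)) = 0"
    using form_degree_2_on_line[OF fin F' _ i, of "v(a' := 0, b' := 1)" x y] xy(2) d ijk ab'
    unfolding eqB B1_def by simp
  moreover have "v(a' := 0, b' := 1, a := x, b := y) = v(a' := 0, b' := 1)"
    using va ab_all ijk by (auto simp: fun_eq_iff)
  ultimately have sa': "s a' (v(a' := 0, b' := 1)) = 0" by simp
  have "s a'' (v(a'' := 0, b'' := 1, a := x, b := y)) = 0"
    using form_degree_2_on_line[OF fin F'' _ i, of "v(a'' := 0, b'' := 1)" x y] xy(3) d ijk ab''
    unfolding eqC C1_def by simp
  moreover have "v(a'' := 0, b'' := 1, a := x, b := y) = v(a'' := 0, b'' := 1)"
    using va ab_all ijk by (auto simp: fun_eq_iff)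
  ultimately have sa'': "s a'' (v(a'' := 0, b'' := 1)) = 0" by simp
  have "blocks_nonzero A \<kappa> v"
    unfolding blocks_nonzero_def
  proof
    fix l assume l: "l \<in> \<kappa> ` A"
    show "\<exists>e\<in>A. \<kappa> e = l \<and> v e \<noteq> 0"
    proof (cases "l = i")
      case True
      then show ?thesis using va xy(1) ab by metis
    next
      case False
      then have "l \<in> \<kappa> ` ?A" using l unfolding img K by blast
      then have "\<exists>e\<in>?A. \<kappa> e = l \<and> u e \<noteq> 0" by (rule bspec[OF u(1)[unfolded blocks_nonzero_def]])
      then show ?thesis by (auto simp: v_def)
    qed
  qed
  moreover have "s e v = 0" if "e \<in> A" for e
    using cases[OF that] line_vanish[OF fin tw i d(1) sa, of v] line_vanish[OF fin tw j d(2) sa', of v]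
      line_vanish[OF fin tw k d(3) sa'', of v] by auto
  ultimately show ?thesis unfolding has_zero_def by blast
qed


text \<open>
  Here the block of \<open>k\<close> is \<open>u \<times> x\<close> for a vector \<open>x\<close> of quadratic forms on the other block \<open>l\<close>. Substituting
  \<open>x\<close> for the coordinates of block \<open>k\<close> leaves a twisted form of degree \<open>2 * 2 + 2\<close> on block \<open>l\<close> alone.
\<close>

lemma plane_and_block_degree_2_has_zero:
  assumes fin: "finite A" and tw: "twisted A \<kappa> d s" and K: "\<kappa> ` A = {k, l}" and kl: "k \<noteq> l"
    and d: "d k = 2" "d l = 2"
    and blk: "{e. e \<in> A \<and> \<kappa> e = k} = {a, b, c}" "a \<noteq> b" "a \<noteq> c" "b \<noteq> c"
    and card_l: "card {e \<in> A. \<kappa> e \<in> {l}} \<le> 3"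
  shows "has_zero A \<kappa> s"
proof -
  have abc: "a \<in> A" "\<kappa> a = k" "b \<in> A" "\<kappa> b = k" "c \<in> A" "\<kappa> c = k" using blk(1) by blast+
  have ne: "b \<noteq> a" "c \<noteq> a" "c \<noteq> b" using blk(2-4) by auto
  have cases: "e = a \<or> e = b \<or> e = c \<or> \<kappa> e = l" if "e \<in> A" for e
  proof -
    have "\<kappa> e = k \<or> \<kappa> e = l" using K that by blast
    then show ?thesis using blk(1) that by blast
  qed
  let ?L = "{e \<in> A. \<kappa> e \<in> {l}}"
  let ?K = "{e \<in> A. \<kappa> e \<in> {k}}"
  have finL: "finite ?L" using fin by simp
  have Keq: "?K = {a, b, c}" using blk(1) by simp
  have imgK: "\<kappa> ` ?K = {k}" unfolding Keq using abc by simp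
  have "l \<in> \<kappa> ` A" using K by simp
  then have imgL: "\<kappa> ` ?L = {l}" by auto
  define P where "P u = s b (\<lambda>e. if \<kappa> e \<in> {l} then u e else ((\<lambda>_. 0)(c := 1)) e)" for u
  define Q0 where "Q0 u = s a (\<lambda>e. if \<kappa> e \<in> {l} then u e else ((\<lambda>_. 0)(c := 1)) e)" for u
  define R where "R u = s a (\<lambda>e. if \<kappa> e \<in> {l} then u e else ((\<lambda>_. 0)(b := 1)) e)" for u
  define Q where "Q u = (-1) * Q0 u" for u
  have fP: "form ?L \<kappa> (\<lambda>_. 2) P"
    unfolding P_def[abs_def]
    by (rule form_degree_cong[OF form_merge[OF fin twisted_form_component[OF tw abc(3)]]], unfold imgL)
       (use kl d abc in auto)
  have fQ0: "form ?L \<kappa> (\<lambda>_. 2) Q0"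
    unfolding Q0_def[abs_def]
    by (rule form_degree_cong[OF form_merge[OF fin twisted_form_component[OF tw abc(1)]]], unfold imgL)
       (use kl d abc in auto)
  have fR: "form ?L \<kappa> (\<lambda>_. 2) R"
    unfolding R_def[abs_def]
    by (rule form_degree_cong[OF form_merge[OF fin twisted_form_component[OF tw abc(1)]]], unfold imgL)
       (use kl d abc in auto)
  have fQ: "form ?L \<kappa> (\<lambda>_. 2) Q" unfolding Q_def[abs_def] by (rule form_cmult[OF fQ0])
  define X where "X u = u(a := P u, b := Q u, c := R u)" for u
  have Xk: "X u a = P u" "X u b = Q u" "X u c = R u" for u using blk(2-4) by (auto simp: X_def)
  have Xl: "X u e = u e" if "\<kappa> e = l" for u e using that abc kl by (auto simp: X_def)
  \<comment> \<open>A coefficient of block \<open>l\<close> has degree 2 in \<open>k\<close>, which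
    becomes 4 by the substitution of quadratic forms, and degree 1 in \<open>l\<close>: together 5,
    one less than 6.\<close>
  have twX: "twisted ?L \<kappa> (\<lambda>_. 6) (\<lambda>h u. s h (X u))"
    unfolding twisted_def
  proof (intro conjI ballI allI)
    fix h assume "h \<in> ?L"
    then have h: "h \<in> A" "\<kappa> h = l" by auto
    note F = twisted_form_component[OF tw h(1)]
    show "form ?L \<kappa> (\<lambda>j. if j = \<kappa> h then 6 - 1 else 6) (\<lambda>u. s h (X u))"
    proof (rule formI)
      show "polyfun (\<lambda>u. s h (X u))"
        using form_polyfun[OF F] unfolding X_def[abs_def] fun_upd_def
        by (rule polyfun_subst) (intro polyfun_intros form_polyfun[OF fP] form_polyfun[OF fQ] form_polyfun[OF fR])
      fix u
      have "P (\<lambda>a. if a \<in> ?L then u a else 0) = P u" "Q (\<lambda>a. if a \<in> ?L then u a else 0) = Q u"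
        "R (\<lambda>a. if a \<in> ?L then u a else 0) = R u"
        by (rule form_restrict[OF fP] form_restrict[OF fQ] form_restrict[OF fR])+
      note restrict = this
      show "s h (X (\<lambda>a. if a \<in> ?L then u a else 0)) = s h (X u)"
      proof (rule form_cong[OF F])
        fix e assume e: "e \<in> A"
        from cases[OF e] show "X (\<lambda>a. if a \<in> ?L then u a else 0) e = X u e"
        proof (elim disjE)
          assume "\<kappa> e = l"
          then show ?thesis using e by (simp add: Xl)
        qed (simp_all only: Xk restrict)
      qed
      fix f :: "'b \<Rightarrow> complex"
      define g where "g j = (if j = k then (f l)\<^sup>2 else f j)" for j
      have "P (\<lambda>a. f (\<kappa> a) * u a) = (f l)\<^sup>2 * P u" "Q (\<lambda>a. f (\<kappa> a) * u a) = (f l)\<^sup>2 * Q u"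
        "R (\<lambda>a. f (\<kappa> a) * u a) = (f l)\<^sup>2 * R u"
        using form_scale[OF fP, of f u] form_scale[OF fQ, of f u] form_scale[OF fR, of f u]
        unfolding imgL by simp_all
      then have "X (\<lambda>a. f (\<kappa> a) * u a) e = g (\<kappa> e) * X u e" if "e \<in> A" for e
        using cases[OF that] Xk Xl abc kl by (auto simp: g_def)
      then have "s h (X (\<lambda>a. f (\<kappa> a) * u a)) = s h (\<lambda>e. g (\<kappa> e) * X u e)"
        by (rule form_cong[OF F])
      also have "\<dots> = ((f l)\<^sup>2)\<^sup>2 * f l * s h (X u)"
        using form_scale[OF F, of g "X u"] kl d h unfolding K by (simp add: g_def)
      also have "((f l)\<^sup>2)\<^sup>2 * f l = (\<Prod>j\<in>\<kappa> ` ?L. f j ^ (if j = \<kappa> h then 6 - 1 else 6))"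
        unfolding imgL h by (simp add: eval_nat_numeral)
      finally show "s h (X (\<lambda>a. f (\<kappa> a) * u a)) =
        (\<Prod>j\<in>\<kappa> ` ?L. f j ^ (if j = \<kappa> h then 6 - 1 else 6)) * s h (X u)" .
    qed
  next
    fix j u assume "j \<in> \<kappa> ` ?L"
    then have j: "j = l" "l \<in> \<kappa> ` A" using K by auto
    show "(\<Sum>a | a \<in> ?L \<and> \<kappa> a = j. u a * s a (X u)) = 0"
      unfolding twisted_radial[OF tw j(2), of "X u", symmetric]
      by (rule sum.cong) (use j Xl in auto)
  qed
  have "has_zero ?L \<kappa> (\<lambda>h u. s h (X u))"
    by (rule twisted_has_zero[OF finL twX _ blocks_nonzero_one]) auto
  then obtain y where y: "blocks_nonzero ?L \<kappa> y" "\<And>h. h \<in> ?L \<Longrightarrow> s h (X y) = 0"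
    unfolding has_zero_def by blast
  have "\<exists>h\<in>?L. \<kappa> h = l \<and> y h \<noteq> 0"
    using y(1) unfolding blocks_nonzero_def imgL by blast
  then obtain h0 where h0: "h0 \<in> ?L" "y h0 \<noteq> 0" by blast
  have PQR: "P y = s b (y(a := 0, b := 0, c := 1))" "Q y = - s a (y(a := 0, b := 0, c := 1))"
    "R y = s a (y(a := 0, b := 1, c := 0))"
  proof -
    have pt: "(if \<kappa> e \<in> {l} then y e else ((\<lambda>_. 0)(c := 1)) e) = (y(a := 0, b := 0, c := 1)) e"
      "(if \<kappa> e \<in> {l} then y e else ((\<lambda>_. 0)(b := 1)) e) = (y(a := 0, b := 1, c := 0)) e"
      if "e \<in> A" for e
      using cases[OF that] abc kl ne by (elim disjE; auto)+
    show "P y = s b (y(a := 0, b := 0, c := 1))" unfolding P_def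
      by (rule form_cong[OF twisted_form_component[OF tw abc(3)] pt(1)])
    have "Q0 y = s a (y(a := 0, b := 0, c := 1))" unfolding Q0_def
      by (rule form_cong[OF twisted_form_component[OF tw abc(1)] pt(1)])
    then show "Q y = - s a (y(a := 0, b := 0, c := 1))" by (simp add: Q_def)
    show "R y = s a (y(a := 0, b := 1, c := 0))" unfolding R_def
      by (rule form_cong[OF twisted_form_component[OF tw abc(1)] pt(2)])
  qed
  have cross: "s a u = u b * R y - u c * Q y" "s b u = u c * P y - u a * R y" "s c u = u a * Q y - u b * P y"
    if "\<And>e. e \<in> A \<Longrightarrow> \<kappa> e \<noteq> k \<Longrightarrow> u e = y e" for u
    unfolding PQR by (rule plane_cross_product[OF fin tw blk d(1), where u = u and w = y, OF that]; assumption)+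
  have nonzero: "blocks_nonzero A \<kappa> u"
    if "\<And>e. \<kappa> e = l \<Longrightarrow> u e = y e" "u a \<noteq> 0 \<or> u b \<noteq> 0 \<or> u c \<noteq> 0" for u
    unfolding blocks_nonzero_def K using that h0 abc by auto
  show ?thesis
  proof (cases "P y = 0 \<and> Q y = 0 \<and> R y = 0")
    case False
    \<comment> \<open>The kernel vector, taken as the point of the plane, kills block
      \<open>k\<close> because its cross product with itself is 0; block \<open>l\<close> vanishes
      by the choice of \<open>y\<close>.\<close>
    have "blocks_nonzero A \<kappa> (X y)" by (rule nonzero) (use Xk Xl False in auto)
    moreover have "s a (X y) = 0" "s b (X y) = 0" "s c (X y) = 0"
    proof -
      have "X y e = y e" if "e \<in> A" "\<kappa> e \<noteq> k" for e using cases[OF that(1)] that abc Xl by auto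
      from cross[where u = "X y", OF this] show "s a (X y) = 0" "s b (X y) = 0" "s c (X y) = 0"
        by (simp_all add: Xk)
    qed
    moreover have "s h (X y) = 0" if "h \<in> A" "\<kappa> h = l" for h using y(2) that by simp
    ultimately show ?thesis unfolding has_zero_def using cases by metis
  next
    case True
    \<comment> \<open>With kernel vector 0, block \<open>k\<close> vanishes on the whole plane over
      \<open>y\<close>. Since \<open>y h0 \<noteq> 0\<close>, the radial relation determines the
      coefficient at \<open>h0\<close> from the others, and at most two forms of degree 2 remain on
      the plane.\<close>
    have "\<exists>x. blocks_nonzero ?K \<kappa> x \<and> (\<forall>h\<in>?L - {h0}. s h (\<lambda>e. if \<kappa> e \<in> {k} then x e else y e) = 0)"
    proof (rule common_zero)
      have "card (?L - {h0}) < card ?L" using finL h0 by (intro card_Diff1_less)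
      moreover have "card ?K = 3" unfolding Keq using blk(2-4) by simp
      ultimately show "card (?L - {h0}) + card (\<kappa> ` ?K) \<le> card ?K" using card_l unfolding imgK by simp
      show "\<forall>h\<in>?L - {h0}. form ?K \<kappa> (\<lambda>j. if j = l then d j - 1 else d j)
          (\<lambda>x. s h (\<lambda>e. if \<kappa> e \<in> {k} then x e else y e))"
      proof
        fix h assume "h \<in> ?L - {h0}"
        then have h: "h \<in> A" "\<kappa> h = l" by auto
        show "form ?K \<kappa> (\<lambda>j. if j = l then d j - 1 else d j)
          (\<lambda>x. s h (\<lambda>e. if \<kappa> e \<in> {k} then x e else y e))"
          using form_merge[OF fin twisted_form_component[OF tw h(1)], of "{k}" y] unfolding h(2) .
      qed
    qed (use fin kl d imgK in auto)
    then obtain x where x: "blocks_nonzero ?K \<kappa> x"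
      "\<And>h. h \<in> ?L - {h0} \<Longrightarrow> s h (\<lambda>e. if \<kappa> e \<in> {k} then x e else y e) = 0"
      by blast
    define z where "z = (\<lambda>e. if \<kappa> e \<in> {k} then x e else y e)"
    have zl: "z e = y e" if "\<kappa> e \<noteq> k" for e using that by (simp add: z_def)
    have "\<exists>e\<in>?K. \<kappa> e = k \<and> x e \<noteq> 0" using x(1) unfolding blocks_nonzero_def imgK by blast
    then have "z a \<noteq> 0 \<or> z b \<noteq> 0 \<or> z c \<noteq> 0" unfolding Keq using abc by (auto simp: z_def)
    then have "blocks_nonzero A \<kappa> z" by (intro nonzero) (use zl kl in auto)
    moreover have zabc: "s a z = 0" "s b z = 0" "s c z = 0" using cross[where u = z, OF zl] True by simp_all
    moreover have zh: "s h z = 0" if "h \<in> ?L - {h0}" for h using x(2)[OF that] by (simp add: z_def)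
    moreover have "s h0 z = 0"
    proof -
      from twisted_radial[OF tw \<open>l \<in> \<kappa> ` A\<close>, of z]
      have "(\<Sum>e\<in>?L. z e * s e z) = 0" by simp
      then have "z h0 * s h0 z = 0" using finL h0(1) zh by (simp add: sum.remove)
      then show ?thesis using zl[of h0] h0 kl by auto
    qed
    ultimately have "s e z = 0" if "e \<in> A" for e
      using cases[OF that] that by (cases "e = h0") auto
    with \<open>blocks_nonzero A \<kappa> z\<close> show ?thesis unfolding has_zero_def by blast
  qed
qed

section \<open>Admissible degrees\<close>

definition line_block :: "'a set \<Rightarrow> ('a \<Rightarrow> 'k) \<Rightarrow> 'k \<Rightarrow> bool" where
  "line_block A \<kappa> k \<longleftrightarrow> (\<exists>a b. {e. e \<in> A \<and> \<kappa> e = k} = {a, b} \<and> a \<noteq> b)"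

definition plane_block :: "'a set \<Rightarrow> ('a \<Rightarrow> 'k) \<Rightarrow> 'k \<Rightarrow> bool" where
  "plane_block A \<kappa> k \<longleftrightarrow> (\<exists>a b c. {e. e \<in> A \<and> \<kappa> e = k} = {a, b, c} \<and> a \<noteq> b \<and> a \<noteq> c \<and> b \<noteq> c)"

lemma line_block_card: "line_block A \<kappa> k \<Longrightarrow> card {e \<in> A. \<kappa> e = k} = 2"
  unfolding line_block_def by (elim exE conjE) simp

lemma plane_block_card: "plane_block A \<kappa> k \<Longrightarrow> card {e \<in> A. \<kappa> e = k} = 3"
  unfolding plane_block_def by (elim exE conjE) simp

lemma line_block_restrict:
  "line_block A \<kappa> k \<Longrightarrow> k \<in> K' \<Longrightarrow> line_block {e \<in> A. \<kappa> e \<in> K'} \<kappa> k"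
proof -
  assume "k \<in> K'"
  then have "{e. e \<in> {e \<in> A. \<kappa> e \<in> K'} \<and> \<kappa> e = k} = {e. e \<in> A \<and> \<kappa> e = k}" by auto
  then show "line_block A \<kappa> k \<Longrightarrow> line_block {e \<in> A. \<kappa> e \<in> K'} \<kappa> k"
    unfolding line_block_def by simp
qed

lemma plane_block_restrict:
  "plane_block A \<kappa> k \<Longrightarrow> k \<in> K' \<Longrightarrow> plane_block {e \<in> A. \<kappa> e \<in> K'} \<kappa> k"
proof -
  assume "k \<in> K'"
  then have "{e. e \<in> {e \<in> A. \<kappa> e \<in> K'} \<and> \<kappa> e = k} = {e. e \<in> A \<and> \<kappa> e = k}" by auto
  then show "plane_block A \<kappa> k \<Longrightarrow> plane_block {e \<in> A. \<kappa> e \<in> K'} \<kappa> k"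
    unfolding plane_block_def by simp
qed

text \<open>Blocks of degree at most 1 vanish identically, so they may be frozen at 1 and a zero of
  the other blocks on that slice is a zero of the form.\<close>

lemma has_zero_restrict:
  assumes fin: "finite A" and tw: "twisted A \<kappa> d s"
    and low: "\<And>k. k \<in> \<kappa> ` A \<Longrightarrow> k \<notin> K' \<Longrightarrow> d k \<le> 1"
    and zero: "has_zero {a \<in> A. \<kappa> a \<in> K'} \<kappa> (\<lambda>a u. s a (\<lambda>b. if \<kappa> b \<in> K' then u b else 1))"
  shows "has_zero A \<kappa> s"
  using zero blocks_nonzero_one
  by (rule has_zero_merge) (use twisted_degree_le_1[OF fin tw] low in blast)

lemma all_low_has_zero:
  assumes fin: "finite A" and tw: "twisted A \<kappa> d s" and low: "\<And>k. k \<in> \<kappa> ` A \<Longrightarrow> d k \<le> 1"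
  shows "has_zero A \<kappa> s"
  using blocks_nonzero_one twisted_degree_le_1[OF fin tw _ low] unfolding has_zero_def by blast

lemma line_alone:
  assumes fin: "finite A" and tw: "twisted A \<kappa> d s" and nz: "\<not> has_zero A \<kappa> s"
    and i: "line_block A \<kappa> i" "d i \<ge> 2"
    and low: "\<And>k. k \<in> \<kappa> ` A \<Longrightarrow> k \<noteq> i \<Longrightarrow> d k \<le> 1 \<and> card {e \<in> A. \<kappa> e = k} \<ge> 2"
  shows "d i = 2 \<and> (\<forall>k\<in>\<kappa> ` A. k \<noteq> i \<longrightarrow> d k = 0)"
proof -
  obtain a b where ab: "{e. e \<in> A \<and> \<kappa> e = i} = {a, b}" "a \<noteq> b"
    using i(1) unfolding line_block_def by (elim exE conjE)
  have zero: "s e u = 0" if "e \<in> A" "\<kappa> e \<noteq> i" for e u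
    using twisted_degree_le_1[OF fin tw that(1)] low[of "\<kappa> e"] that by blast
  show ?thesis
  proof (intro conjI ballI impI)
    show "d i = 2" by (rule line_only_degree(1)[OF fin tw ab i(2) _ nz]) (rule zero)
    show "d k = 0" if "k \<in> \<kappa> ` A" "k \<noteq> i" for k
      by (rule line_only_degree(2)[OF fin tw ab i(2) _ nz that(2)]) (use zero low[OF that] in auto)
  qed
qed

lemma two_lines_others_low:
  assumes fin: "finite A" and tw: "twisted A \<kappa> d s"
    and ij: "line_block A \<kappa> i" "line_block A \<kappa> j" "i \<noteq> j" "d i \<ge> 2" "d j \<ge> 2"
    and low: "\<And>k. k \<in> \<kappa> ` A \<Longrightarrow> k \<noteq> i \<Longrightarrow> k \<noteq> j \<Longrightarrow> d k \<le> 1"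
  shows "has_zero A \<kappa> s"
proof -
  let ?A = "{a \<in> A. \<kappa> a \<in> {i, j}}"
  obtain a b where ab: "{e. e \<in> ?A \<and> \<kappa> e = i} = {a, b}" "a \<noteq> b"
    using line_block_restrict[OF ij(1) insertI1, of "{j}"] unfolding line_block_def by (elim exE conjE)
  obtain a' b' where ab': "{e. e \<in> ?A \<and> \<kappa> e = j} = {a', b'}" "a' \<noteq> b'"
    using line_block_restrict[OF ij(2) insertI2[OF singletonI], of i] unfolding line_block_def by (elim exE conjE)
  have "has_zero ?A \<kappa> (\<lambda>a u. s a (\<lambda>b. if \<kappa> b \<in> {i, j} then u b else 1))"
    by (rule two_lines_has_zero[OF _ twisted_merge[OF fin tw] _ ab ab' ij(3)]) (use fin ij in auto)
  then show ?thesis by (rule has_zero_restrict[OF fin tw, rotated]) (use low in auto)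
qed

theorem three_lines_degrees:
  assumes fin: "finite A" and tw: "twisted A \<kappa> d s" and nz: "\<not> has_zero A \<kappa> s"
    and K: "\<kappa> ` A = {i, j, k}" "i \<noteq> j" "i \<noteq> k" "j \<noteq> k"
    and lines: "line_block A \<kappa> i" "line_block A \<kappa> j" "line_block A \<kappa> k"
  shows "(d i = 2 \<and> d j = 0 \<and> d k = 0) \<or> (d i = 0 \<and> d j = 2 \<and> d k = 0) \<or> (d i = 0 \<and> d j = 0 \<and> d k = 2)"
proof -
  have card: "card {e \<in> A. \<kappa> e = l} \<ge> 2" if "l \<in> \<kappa> ` A" for l
    using that lines[THEN line_block_card] unfolding K by auto
  note alone = line_alone[OF fin tw nz]
  note two = two_lines_others_low[OF fin tw]
  have all: "has_zero A \<kappa> s" if d2: "d i \<ge> 2" "d j \<ge> 2" "d k \<ge> 2"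
  proof -
    have d2': "d l \<ge> 2" if "l \<in> \<kappa> ` A" for l using that d2 unfolding K by auto
    obtain a b where i: "{e. e \<in> A \<and> \<kappa> e = i} = {a, b}" "a \<noteq> b"
      using lines(1) unfolding line_block_def by (elim exE conjE)
    obtain a' b' where j: "{e. e \<in> A \<and> \<kappa> e = j} = {a', b'}" "a' \<noteq> b'"
      using lines(2) unfolding line_block_def by (elim exE conjE)
    obtain a'' b'' where k: "{e. e \<in> A \<and> \<kappa> e = k} = {a'', b''}" "a'' \<noteq> b''"
      using lines(3) unfolding line_block_def by (elim exE conjE)
    \<comment> \<open>If one degree differs from 2, the other two lines are used for the moves and
      the weights deal with the third.\<close>
    consider "d i = 2" "d j = 2" "d k = 2" | "d i \<noteq> 2" | "d j \<noteq> 2" | "d k \<noteq> 2" by blast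
    then show ?thesis
    proof cases
      case 1
      then show ?thesis by (rule three_lines_degree_2_has_zero[OF fin tw K _ _ _ i j k])
    next
      case 2
      then show ?thesis
        by (intro two_lines_has_zero[OF fin tw d2' j k K(4)]) (auto simp: K(1))
    next
      case 3
      then show ?thesis
        by (intro two_lines_has_zero[OF fin tw d2' i k K(3)]) (auto simp: K(1))
    next
      case 4
      then show ?thesis
        by (intro two_lines_has_zero[OF fin tw d2' i j K(2)]) (auto simp: K(1))
    qed
  qed
  have none: "has_zero A \<kappa> s" if "d i \<le> 1" "d j \<le> 1" "d k \<le> 1"
    by (rule all_low_has_zero[OF fin tw]) (use that in \<open>auto simp: K(1)\<close>)
  have i: ?thesis if "d i \<ge> 2" "d j \<le> 1" "d k \<le> 1"
    using alone[OF lines(1) that(1)] that card K by (auto simp: K(1))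
  have j: ?thesis if "d i \<le> 1" "d j \<ge> 2" "d k \<le> 1"
    using alone[OF lines(2) that(2)] that card K by (auto simp: K(1))
  have k: ?thesis if "d i \<le> 1" "d j \<le> 1" "d k \<ge> 2"
    using alone[OF lines(3) that(3)] that card K by (auto simp: K(1))
  have ij: "has_zero A \<kappa> s" if "d i \<ge> 2" "d j \<ge> 2" "d k \<le> 1"
    by (rule two[OF lines(1,2) K(2) that(1,2)]) (use that in \<open>auto simp: K(1)\<close>)
  have ik: "has_zero A \<kappa> s" if "d i \<ge> 2" "d j \<le> 1" "d k \<ge> 2"
    by (rule two[OF lines(1,3) K(3) that(1,3)]) (use that in \<open>auto simp: K(1)\<close>)
  have jk: "has_zero A \<kappa> s" if "d i \<le> 1" "d j \<ge> 2" "d k \<ge> 2"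
    by (rule two[OF lines(2,3) K(4) that(2,3)]) (use that in \<open>auto simp: K(1)\<close>)
  have "d l \<ge> 2 \<or> d l \<le> 1" for l by linarith
  then show ?thesis using all none i j k ij ik jk nz by metis
qed

lemma plane_others_low:
  assumes fin: "finite A" and tw: "twisted A \<kappa> d s" and k: "plane_block A \<kappa> k" "d k \<ge> 2"
    and low: "\<And>l. l \<in> \<kappa> ` A \<Longrightarrow> l \<noteq> k \<Longrightarrow> d l \<le> 1"
  shows "has_zero A \<kappa> s"
proof -
  let ?A = "{a \<in> A. \<kappa> a \<in> {k}}"
  obtain a b c where abc: "{e. e \<in> ?A \<and> \<kappa> e = k} = {a, b, c}" "a \<noteq> b" "a \<noteq> c" "b \<noteq> c"
    using plane_block_restrict[OF k(1) singletonI] unfolding plane_block_def by (elim exE conjE)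
  have "has_zero ?A \<kappa> (\<lambda>a u. s a (\<lambda>b. if \<kappa> b \<in> {k} then u b else 1))"
    by (rule plane_has_zero[OF _ twisted_merge[OF fin tw] _ abc]) (use fin k in auto)
  then show ?thesis by (rule has_zero_restrict[OF fin tw, rotated]) (use low in auto)
qed

theorem plane_line_degrees:
  assumes fin: "finite A" and tw: "twisted A \<kappa> d s" and nz: "\<not> has_zero A \<kappa> s"
    and K: "\<kappa> ` A = {k, l}" "k \<noteq> l" and blocks: "plane_block A \<kappa> k" "line_block A \<kappa> l"
  shows "d k = 0 \<and> d l = 2"
proof -
  have card: "card {e \<in> A. \<kappa> e = k} \<ge> 2" using plane_block_card[OF blocks(1)] by simp
  obtain a b c where abc: "{e. e \<in> A \<and> \<kappa> e = k} = {a, b, c}" "a \<noteq> b" "a \<noteq> c" "b \<noteq> c"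
    using blocks(1) unfolding plane_block_def by (elim exE conjE)
  obtain e f where ef: "{g. g \<in> A \<and> \<kappa> g = l} = {e, f}" "e \<noteq> f"
    using blocks(2) unfolding line_block_def by (elim exE conjE)
  have "has_zero A \<kappa> s" if "d k \<ge> 2"
  proof (cases "d l \<ge> 2")
    case True
    then have d2: "d j \<ge> 2" if "j \<in> \<kappa> ` A" for j using that \<open>d k \<ge> 2\<close> unfolding K by auto
    \<comment> \<open>A block of degree different from 2 is left to the weights; the other one gets
      its zero from its kernel vector if it is the plane, or from a move along the plane if it is
      the line.\<close>
    consider "d l \<noteq> 2" | "d k \<noteq> 2" | "d k = 2" "d l = 2" by blast
    then show ?thesis
    proof cases
      case 1
      then show ?thesis by (intro plane_has_zero[OF fin tw d2 abc]) (auto simp: K(1))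
    next
      case 2
      then show ?thesis
        by (intro line_and_block_has_zero[OF fin tw d2 ef K(2)[symmetric] card])
           (use that in \<open>auto simp: K(1)\<close>)
    next
      case 3
      have "card {e \<in> A. \<kappa> e \<in> {l}} \<le> 3" using line_block_card[OF blocks(2)] by simp
      with 3 show ?thesis by (intro plane_and_block_degree_2_has_zero[OF fin tw K _ _ abc])
    qed
  next
    case False
    then show ?thesis by (intro plane_others_low[OF fin tw blocks(1) that]) (auto simp: K(1))
  qed
  then have dk: "d k \<le> 1" using nz by linarith
  have "d l \<ge> 2"
  proof (rule ccontr)
    assume "\<not> d l \<ge> 2"
    then have "has_zero A \<kappa> s" using dk by (intro all_low_has_zero[OF fin tw]) (auto simp: K(1))
    with nz show False ..
  qed
  then show ?thesis
    using line_alone[OF fin tw nz blocks(2)] dk card K by auto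
qed

theorem two_planes_has_zero:
  assumes fin: "finite A" and tw: "twisted A \<kappa> d s"
    and K: "\<kappa> ` A = {k, l}" "k \<noteq> l" and blocks: "plane_block A \<kappa> k" "plane_block A \<kappa> l"
  shows "has_zero A \<kappa> s"
proof -
  obtain a b c where k: "{e. e \<in> A \<and> \<kappa> e = k} = {a, b, c}" "a \<noteq> b" "a \<noteq> c" "b \<noteq> c"
    using blocks(1) unfolding plane_block_def by (elim exE conjE)
  obtain a' b' c' where l: "{e. e \<in> A \<and> \<kappa> e = l} = {a', b', c'}" "a' \<noteq> b'" "a' \<noteq> c'" "b' \<noteq> c'"
    using blocks(2) unfolding plane_block_def by (elim exE conjE)
  consider "d k \<le> 1" "d l \<le> 1" | "d k \<ge> 2" "d l \<le> 1" | "d k \<le> 1" "d l \<ge> 2" | "d k \<ge> 2" "d l \<ge> 2"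
    by linarith
  then show ?thesis
  proof cases
    case 1
    then show ?thesis by (intro all_low_has_zero[OF fin tw]) (auto simp: K(1))
  next
    case 2
    then show ?thesis by (intro plane_others_low[OF fin tw blocks(1)]) (auto simp: K(1))
  next
    case 3
    then show ?thesis by (intro plane_others_low[OF fin tw blocks(2)]) (auto simp: K(1))
  next
    case 4
    then have d2: "d j \<ge> 2" if "j \<in> \<kappa> ` A" for j using that unfolding K by auto
    consider "d l \<noteq> 2" | "d k \<noteq> 2" | "d k = 2" "d l = 2" by blast
    then show ?thesis
    proof cases
      case 1
      then show ?thesis by (intro plane_has_zero[OF fin tw d2 k]) (auto simp: K(1))
    next
      case 2
      then show ?thesis by (intro plane_has_zero[OF fin tw d2 l]) (auto simp: K(1))
    next
      case 3
      have "card {e \<in> A. \<kappa> e \<in> {l}} \<le> 3" using plane_block_card[OF blocks(2)] by simp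
      with 3 show ?thesis by (intro plane_and_block_degree_2_has_zero[OF fin tw K _ _ k])
    qed
  qed
qed

section \<open>Evaluation of multihomogeneous polynomials\<close>

text \<open>Vectors are indexed by \<open>coord\<close> here, so that \<open>factor\<close> can
  serve as the block map of the abstract part.\<close>

definition ev :: "mpoly \<Rightarrow> (coord \<Rightarrow> complex) \<Rightarrow> complex" where
  "ev P u = eval_mpoly (\<lambda>i j. u (Z i j)) P"

lemma Z_factor_pos [simp]: "Z (factor p) (pos p) = p"
  by (cases p) simp

lemma eval_mpoly_ev: "eval_mpoly v P = ev P (\<lambda>p. v (factor p) (pos p))"
  by (simp add: ev_def)

definition monomial_value :: "(coord \<Rightarrow>\<^sub>0 nat) \<Rightarrow> (coord \<Rightarrow> complex) \<Rightarrow> complex" where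
  "monomial_value m u = (\<Prod>p\<in>Poly_Mapping.keys m. u p ^ Poly_Mapping.lookup m p)"

lemma ev_eq: "ev P u = (\<Sum>m\<in>Poly_Mapping.keys P. Poly_Mapping.lookup P m * monomial_value m u)"
  by (simp add: ev_def eval_mpoly_def monomial_value_def)

lemma monomial_value_superset:
  assumes "finite S" "Poly_Mapping.keys m \<subseteq> S"
  shows "monomial_value m u = (\<Prod>p\<in>S. u p ^ Poly_Mapping.lookup m p)"
  unfolding monomial_value_def
  by (rule prod.mono_neutral_left) (use assms in \<open>auto simp: in_keys_iff\<close>)

lemma monomial_value_add: "monomial_value (m + n) u = monomial_value m u * monomial_value n u"
proof -
  let ?S = "Poly_Mapping.keys m \<union> Poly_Mapping.keys n"
  have "Poly_Mapping.keys (m + n) \<subseteq> ?S" by (rule Poly_Mapping.keys_add)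
  then show ?thesis
    by (simp add: monomial_value_superset[of ?S] lookup_add power_add prod.distrib)
qed

lemma ev_superset:
  assumes "finite S" "Poly_Mapping.keys P \<subseteq> S"
  shows "ev P u = (\<Sum>m\<in>S. Poly_Mapping.lookup P m * monomial_value m u)"
  unfolding ev_eq by (rule sum.mono_neutral_left) (use assms in \<open>auto simp: in_keys_iff\<close>)

lemma ev_0 [simp]: "ev 0 u = 0"
  by (simp add: ev_eq)

lemma ev_add: "ev (P + Q) u = ev P u + ev Q u"
proof -
  let ?S = "Poly_Mapping.keys P \<union> Poly_Mapping.keys Q"
  have "Poly_Mapping.keys (P + Q) \<subseteq> ?S" by (rule Poly_Mapping.keys_add)
  then show ?thesis
    by (simp add: ev_superset[of ?S] lookup_add sum.distrib distrib_right)
qed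

lemma ev_uminus: "ev (- P) u = - ev P u"
  using ev_add[of P "- P" u] by (simp add: eq_neg_iff_add_eq_0 add.commute)

lemma ev_sum: "ev (\<Sum>i\<in>I. f i) u = (\<Sum>i\<in>I. ev (f i) u)"
  by (induction I rule: infinite_finite_induct) (simp_all add: ev_add)

lemma ev_single: "ev (Poly_Mapping.single m c) u = c * monomial_value m u"
  by (subst ev_superset[of "{m}"]) auto

lemma ev_mult: "ev (P * Q) u = ev P u * ev Q u"
proof -
  let ?s = "\<lambda>R m. Poly_Mapping.single m (Poly_Mapping.lookup R m) :: mpoly"
  let ?A = "Poly_Mapping.keys P" and ?B = "Poly_Mapping.keys Q"
  have "ev ((\<Sum>m\<in>?A. ?s P m) * (\<Sum>n\<in>?B. ?s Q n)) u = ev (\<Sum>m\<in>?A. ?s P m) u * ev (\<Sum>n\<in>?B. ?s Q n) u"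
    unfolding sum_product ev_sum mult_single ev_single monomial_value_add by (simp add: mult_ac)
  then show ?thesis unfolding mpoly_eq_sum_single[symmetric] .
qed

lemma ev_Const [simp]: "ev (Const c) u = c"
  by (simp add: Const_def ev_single monomial_value_def)

lemma ev_Var [simp]: "ev (Var p) u = u p"
  by (simp add: Var_def ev_single monomial_value_def)

lemma polyfun_ev: "polyfun (ev P)"
  unfolding ev_eq[abs_def] monomial_value_def by (intro polyfun_intros)

lemma finite_coords: "finite (coords ns)"
proof -
  have "coords ns = (\<lambda>(i, j). Z i j) ` (SIGMA i:{..<length ns}. {..ns ! i})"
    by (auto simp: coords_def)
  then show ?thesis by simp
qed

lemma factor_coords: "factor ` coords ns = {..<length ns}"
proof -
  have "i \<in> factor ` coords ns" if "i < length ns" for i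
    using that by (intro image_eqI[of _ _ "Z i 0"]) (auto simp: coords_def)
  then show ?thesis by (auto simp: coords_def)
qed

lemma coords_block: "i < length ns \<Longrightarrow> {p. p \<in> coords ns \<and> factor p = i} = Z i ` {..ns ! i}"
  by (auto simp: coords_def)

lemma inj_Z: "inj_on (Z i) S"
  by (rule inj_onI) simp

text \<open>The passage from integers to \<open>nat\<close> is sound: a negative entry leaves
  \<open>P\<close> without monomials, and the zero function is a form of every degree.\<close>

lemma form_ev:
  assumes "multihom ns e P"
  shows "form (coords ns) factor (\<lambda>i. nat (e ! i)) (ev P)"
proof (rule formI)
  show "polyfun (ev P)" by (rule polyfun_ev)
  have keys: "Poly_Mapping.keys m \<subseteq> coords ns" if "m \<in> Poly_Mapping.keys P" for m
    using assms that by (simp add: multihom_def)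
  have mv: "monomial_value m u = (\<Prod>p\<in>coords ns. u p ^ Poly_Mapping.lookup m p)"
    if "m \<in> Poly_Mapping.keys P" for m u
    by (rule monomial_value_superset[OF finite_coords keys[OF that]])
  show "ev P (\<lambda>a. if a \<in> coords ns then u a else 0) = ev P u" for u
    unfolding ev_eq by (rule sum.cong) (simp_all add: mv)
  fix c u
  show "ev P (\<lambda>a. c (factor a) * u a) = (\<Prod>k\<in>factor ` coords ns. c k ^ nat (e ! k)) * ev P u"
    unfolding ev_eq sum_distrib_left
  proof (rule sum.cong[OF refl])
    fix m assume m: "m \<in> Poly_Mapping.keys P"
    have "(\<Prod>p\<in>coords ns. c (factor p) ^ Poly_Mapping.lookup m p) =
        (\<Prod>i\<in>factor ` coords ns. \<Prod>p | p \<in> coords ns \<and> factor p = i. c (factor p) ^ Poly_Mapping.lookup m p)"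
      by (rule prod.group[symmetric]) (simp_all add: finite_coords)
    also have "\<dots> = (\<Prod>i\<in>factor ` coords ns. c i ^ nat (e ! i))"
    proof (rule prod.cong[OF refl])
      fix i assume "i \<in> factor ` coords ns"
      then have i: "i < length ns" by (simp add: factor_coords)
      have "(\<Prod>p | p \<in> coords ns \<and> factor p = i. c (factor p) ^ Poly_Mapping.lookup m p) =
          c i ^ (\<Sum>j\<le>ns ! i. Poly_Mapping.lookup m (Z i j))"
        unfolding coords_block[OF i] by (simp add: prod.reindex[OF inj_Z] power_sum)
      also have "(\<Sum>j\<le>ns ! i. Poly_Mapping.lookup m (Z i j)) = nat (e ! i)"
        using assms m i unfolding multihom_def by (metis nat_int)
      finally show "(\<Prod>p | p \<in> coords ns \<and> factor p = i. c (factor p) ^ Poly_Mapping.lookup m p) =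
          c i ^ nat (e ! i)" .
    qed
    finally show "Poly_Mapping.lookup P m * monomial_value m (\<lambda>a. c (factor a) * u a) =
        (\<Prod>k\<in>factor ` coords ns. c k ^ nat (e ! k)) * (Poly_Mapping.lookup P m * monomial_value m u)"
      unfolding mv[OF m] power_mult_distrib prod.distrib by (simp add: mult_ac)
  qed
qed

lemma multihom_negative:
  assumes "multihom ns e P" "i < length ns" "e ! i < 0"
  shows "P = 0"
proof -
  have "m \<notin> Poly_Mapping.keys P" for m
    using assms unfolding multihom_def
    by (metis of_nat_0_le_iff linorder_not_less)
  then have "Poly_Mapping.keys P = {}" by blast
  then show ?thesis by simp
qed

lemma twisted_form_coeff:
  assumes "twisted_form ns d \<omega>" "p \<in> coords ns"
  shows "multihom ns (d[factor p := d ! factor p - 1]) (\<omega> p)"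
  using assms unfolding twisted_form_def coords_def by auto

lemma twisted_ev:
  assumes tf: "twisted_form ns d \<omega>"
  shows "twisted (coords ns) factor (\<lambda>i. nat (d ! i)) (\<lambda>p. ev (\<omega> p))"
  unfolding twisted_def
proof (intro conjI ballI allI)
  have len: "length d = length ns" using tf by (simp add: twisted_form_def)
  fix p assume p: "p \<in> coords ns"
  have "form (coords ns) factor (\<lambda>i. nat (d[factor p := d ! factor p - 1] ! i)) (ev (\<omega> p))"
    by (rule form_ev[OF twisted_form_coeff[OF tf p]])
  then show "form (coords ns) factor (\<lambda>k. if k = factor p then nat (d ! k) - 1 else nat (d ! k)) (ev (\<omega> p))"
    by (rule form_degree_cong) (use p len in \<open>auto simp: factor_coords nth_list_update coords_def nat_diff_distrib'\<close>)
next
  fix i u assume "i \<in> factor ` coords ns"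
  then have i: "i < length ns" by (simp add: factor_coords)
  have "(\<Sum>p | p \<in> coords ns \<and> factor p = i. u p * ev (\<omega> p) u) = ev (\<Sum>j\<le>ns ! i. Var (Z i j) * \<omega> (Z i j)) u"
    unfolding coords_block[OF i] by (simp add: sum.reindex[OF inj_Z] ev_sum ev_mult)
  also have "\<dots> = 0" using tf i by (simp add: twisted_form_def)
  finally show "(\<Sum>p | p \<in> coords ns \<and> factor p = i. u p * ev (\<omega> p) u) = 0" .
qed

section \<open>Singular points\<close>

lemma has_zero_imp_Sing:
  assumes tf: "twisted_form ns d \<omega>" and zero: "has_zero (coords ns) factor (\<lambda>p. ev (\<omega> p))"
  shows "Sing ns (induced_by \<omega>) \<noteq> {}"
proof -
  obtain u where u: "blocks_nonzero (coords ns) factor u" "\<And>p. p \<in> coords ns \<Longrightarrow> ev (\<omega> p) u = 0"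
    using zero unfolding has_zero_def by blast
  \<comment> \<open>Cut off beyond \<open>ns ! i\<close>, as \<open>nonzero_vectors\<close> demands;
    the coefficients see only the coordinates in \<open>coords ns\<close>.\<close>
  define v where "v i j = (if j \<le> ns ! i then u (Z i j) else 0)" for i j
  define x where "x = mpoint ns v"
  have "v i \<in> nonzero_vectors (ns ! i)" if "i < length ns" for i
  proof -
    have "i \<in> factor ` coords ns" using that by (simp add: factor_coords)
    with u(1) have "\<exists>p\<in>coords ns. factor p = i \<and> u p \<noteq> 0" unfolding blocks_nonzero_def by (rule bspec)
    then obtain j where "j \<le> ns ! i" "u (Z i j) \<noteq> 0" by (auto simp: coords_def)
    then have "v i j \<noteq> 0" by (simp add: v_def)
    then have "v i \<noteq> (\<lambda>_. 0)" by metis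
    then show ?thesis by (simp add: nonzero_vectors_def v_def)
  qed
  then have "x \<in> mproj ns" by (auto simp: x_def mpoint_def mproj_def proj_space_def)
  moreover have "eval_mpoly w (\<omega>' p) = 0"
    if \<omega>': "\<omega>' \<in> induced_by \<omega>" and w: "w \<in> hom_coords ns x" and p: "p \<in> coords ns" for \<omega>' w p
  proof -
    obtain c where c: "\<omega>' = (\<lambda>p. Const c * \<omega> p)" using \<omega>' by (auto simp: induced_by_def)
    have "\<forall>i. \<exists>b. i < length ns \<longrightarrow> w i = (\<lambda>j. b * v i j)"
      using w by (auto simp: hom_coords_def x_def mpoint_def pclass_def)
    from choice[OF this] obtain b where b: "\<And>i. i < length ns \<Longrightarrow> w i = (\<lambda>j. b i * v i j)"
      by blast
    note F = form_ev[OF twisted_form_coeff[OF tf p]]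
    have "ev (\<omega> p) (\<lambda>q. w (factor q) (pos q)) = ev (\<omega> p) (\<lambda>q. b (factor q) * u q)"
      by (rule form_cong[OF F]) (auto simp: coords_def b v_def)
    also have "\<dots> = 0" using form_scale[OF F, of b u] u(2)[OF p] by simp
    finally show ?thesis by (simp add: eval_mpoly_ev c ev_mult)
  qed
  ultimately have "x \<in> Sing ns (induced_by \<omega>)" by (simp add: Sing_def)
  then show ?thesis by blast
qed

text \<open>In a factor where \<open>d\<close> is negative every coefficient has negative degree, so
  the form is zero. The case is separate because \<open>nat\<close> does not distinguish negative
  degrees from 0.\<close>

lemma negative_degree_has_zero:
  assumes tf: "twisted_form ns d \<omega>" and i: "i < length ns" "d ! i < 0"
  shows "has_zero (coords ns) factor (\<lambda>p. ev (\<omega> p))"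
proof -
  have len: "length d = length ns" using tf by (simp add: twisted_form_def)
  have "\<omega> p = 0" if "p \<in> coords ns" for p
    by (rule multihom_negative[OF twisted_form_coeff[OF tf that] i(1)])
       (use i len in \<open>cases "factor p = i"; simp\<close>)
  then show ?thesis using blocks_nonzero_one unfolding has_zero_def by fastforce
qed

section \<open>The fibrations over a line\<close>

text \<open>The pullback of a generator of the cotangent bundle of the line twisted by 2, which is
  trivial.\<close>

definition pencil :: "nat \<Rightarrow> coord \<Rightarrow> mpoly" where
  "pencil i = (\<lambda>p. Var (Z i 1) * dZ (Z i 0) p - Var (Z i 0) * dZ (Z i 1) p)"

lemma pencil_simps:
  "pencil i (Z i 0) = Var (Z i (Suc 0))" "pencil i (Z i (Suc 0)) = - Var (Z i 0)"
  "p \<noteq> Z i 0 \<Longrightarrow> p \<noteq> Z i (Suc 0) \<Longrightarrow> pencil i p = 0"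
  by (auto simp: pencil_def dZ_def)

lemma multihom_linear:
  assumes P: "multihom ns e P" and i: "i < length ns" "ns ! i = 1" "e ! i = 1"
    and e0: "\<And>k. k < length ns \<Longrightarrow> k \<noteq> i \<Longrightarrow> e ! k = 0"
  shows "\<exists>\<alpha> \<beta>. P = Const \<alpha> * Var (Z i 0) + Const \<beta> * Var (Z i 1)"
proof -
  let ?x = "Poly_Mapping.single (Z i 0) (1::nat)" and ?y = "Poly_Mapping.single (Z i 1) (1::nat)"
  have "m = ?x \<or> m = ?y" if m: "m \<in> Poly_Mapping.keys P" for m
  proof -
    have keys: "Poly_Mapping.keys m \<subseteq> coords ns"
      and deg: "\<And>k. k < length ns \<Longrightarrow> int (\<Sum>j\<le>ns ! k. Poly_Mapping.lookup m (Z k j)) = e ! k"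
      using P m by (auto simp: multihom_def)
    have "Poly_Mapping.lookup m (Z i 0) + Poly_Mapping.lookup m (Z i 1) = 1"
      using deg[OF i(1)] i(2,3) by (simp add: atMost_Suc)
    then consider "Poly_Mapping.lookup m (Z i 0) = 1" "Poly_Mapping.lookup m (Z i 1) = 0"
      | "Poly_Mapping.lookup m (Z i 0) = 0" "Poly_Mapping.lookup m (Z i 1) = 1" by linarith
    moreover have other: "Poly_Mapping.lookup m p = 0" if p: "p \<noteq> Z i 0" "p \<noteq> Z i 1" for p
    proof (cases "p \<in> coords ns")
      case True
      then obtain k j where kj: "p = Z k j" "k < length ns" "j \<le> ns ! k" by (auto simp: coords_def)
      show ?thesis
      proof (cases "k = i")
        case True
        then show ?thesis using kj p i(2) by (cases j) auto
      next
        case False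
        then have "int (\<Sum>j\<le>ns ! k. Poly_Mapping.lookup m (Z k j)) = int 0"
          unfolding deg[OF kj(2)] using e0[OF kj(2)] by simp
        then have "(\<Sum>j\<le>ns ! k. Poly_Mapping.lookup m (Z k j)) = 0" by (simp only: of_nat_eq_iff)
        then show ?thesis using kj by simp
      qed
    next
      case False
      then show ?thesis using keys by (auto simp: in_keys_iff)
    qed
    ultimately show ?thesis
    proof cases
      case 1
      then have "m = ?x" using other
        by (intro poly_mapping_eqI) (metis coord.inject lookup_single_eq lookup_single_not_eq)
      then show ?thesis ..
    next
      case 2
      then have "m = ?y" using other
        by (intro poly_mapping_eqI) (metis coord.inject lookup_single_eq lookup_single_not_eq)
      then show ?thesis ..
    qed
  qed
  then have sub: "Poly_Mapping.keys P \<subseteq> {?x, ?y}" by blast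
  have "?x \<noteq> ?y" by (metis coord.inject lookup_single_eq lookup_single_not_eq zero_neq_one)
  have "P = (\<Sum>m\<in>Poly_Mapping.keys P. Poly_Mapping.single m (Poly_Mapping.lookup P m))"
    by (rule mpoly_eq_sum_single)
  also have "\<dots> = (\<Sum>m\<in>{?x, ?y}. Poly_Mapping.single m (Poly_Mapping.lookup P m))"
    by (rule sum.mono_neutral_left) (use sub in \<open>auto simp: in_keys_iff\<close>)
  also have "\<dots> = Const (Poly_Mapping.lookup P ?x) * Var (Z i 0) + Const (Poly_Mapping.lookup P ?y) * Var (Z i 1)"
    using \<open>?x \<noteq> ?y\<close> by (simp add: Const_def Var_def mult_single)
  finally show ?thesis by blast
qed

lemma Const_mult: "Const (a * b) = Const a * Const b"
  by (simp add: Const_def mult_single)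

lemma Const_0 [simp]: "Const 0 = 0"
  by (simp add: Const_def)

lemma Const_uminus: "Const (- a) = - Const a"
  by (simp add: Const_def single_uminus)

lemma induced_by_scale:
  assumes "c \<noteq> 0" shows "induced_by (\<lambda>p. Const c * \<omega> p) = induced_by \<omega>"
proof -
  have 1: "(\<lambda>p. Const b * (Const c * \<omega> p)) = (\<lambda>p. Const (b * c) * \<omega> p)" for b
    by (simp add: Const_mult mult.assoc)
  have 2: "(\<lambda>p. Const b * \<omega> p) = (\<lambda>p. Const (b / c) * (Const c * \<omega> p))" for b
    using assms by (simp add: Const_mult[symmetric] mult.assoc[symmetric])
  show ?thesis
  proof (intro set_eqI iffI)
    fix \<eta> assume "\<eta> \<in> induced_by (\<lambda>p. Const c * \<omega> p)"
    then obtain b where "\<eta> = (\<lambda>p. Const b * (Const c * \<omega> p))" "b \<noteq> 0" by (auto simp: induced_by_def)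
    then show "\<eta> \<in> induced_by \<omega>"
      unfolding induced_by_def 1 using assms by (intro CollectI exI[of _ "b * c"]) simp
  next
    fix \<eta> assume "\<eta> \<in> induced_by \<omega>"
    then obtain b where b: "\<eta> = (\<lambda>p. Const b * \<omega> p)" "b \<noteq> 0" by (auto simp: induced_by_def)
    show "\<eta> \<in> induced_by (\<lambda>p. Const c * \<omega> p)"
      unfolding induced_by_def b(1) 2[of b] using assms b(2) by (intro CollectI exI[of _ "b / c"]) simp
  qed
qed

text \<open>Degree 0 in another factor leaves the coefficients there with degree -1, hence zero. The
  two coefficients left are linear in the coordinates of the line, and the radial relation reduces
  them to one constant.\<close>

lemma degree_2_0_pencil:
  assumes tf: "twisted_form ns d \<omega>" and nz: "\<not> has_zero (coords ns) factor (\<lambda>p. ev (\<omega> p))"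
    and i: "i < length ns" "ns ! i = 1" "d ! i = 2"
    and d0: "\<And>k. k < length ns \<Longrightarrow> k \<noteq> i \<Longrightarrow> d ! k = 0"
  shows "induced_by \<omega> = induced_by (pencil i)"
proof -
  have len: "length d = length ns" using tf by (simp add: twisted_form_def)
  have other: "\<omega> p = 0" if "p \<noteq> Z i 0" "p \<noteq> Z i 1" for p
  proof (cases "p \<in> coords ns")
    case True
    then obtain k j where kj: "p = Z k j" "k < length ns" "j \<le> ns ! k" by (auto simp: coords_def)
    then have "k \<noteq> i" using that i(2) by (cases j) auto
    then show ?thesis
      using multihom_negative[OF twisted_form_coeff[OF tf True] kj(2)] d0[OF kj(2)] kj len by simp
  next
    case False
    then show ?thesis using tf by (simp add: twisted_form_def)
  qed
  have in_coords: "Z i 0 \<in> coords ns" "Z i 1 \<in> coords ns" using i by (auto simp: coords_def)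
  have lin: "\<exists>\<alpha> \<beta>. \<omega> p = Const \<alpha> * Var (Z i 0) + Const \<beta> * Var (Z i 1)"
    if "p \<in> coords ns" "factor p = i" for p
    by (rule multihom_linear[OF twisted_form_coeff[OF tf that(1)] i(1,2)]) (use that i len d0 in auto)
  obtain \<alpha> \<beta> where 0: "\<omega> (Z i 0) = Const \<alpha> * Var (Z i 0) + Const \<beta> * Var (Z i 1)"
    using lin[OF in_coords(1)] by auto
  obtain \<gamma> \<delta> where 1: "\<omega> (Z i 1) = Const \<gamma> * Var (Z i 0) + Const \<delta> * Var (Z i 1)"
    using lin[OF in_coords(2)] by auto
  have "(\<Sum>j\<le>ns ! i. Var (Z i j) * \<omega> (Z i j)) = 0" using tf i(1) by (simp add: twisted_form_def)
  then have "Var (Z i 0) * \<omega> (Z i 0) + Var (Z i 1) * \<omega> (Z i 1) = 0"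
    using i(2) by (simp add: atMost_Suc add.commute)
  then have "ev (Var (Z i 0) * \<omega> (Z i 0) + Var (Z i 1) * \<omega> (Z i 1)) u = 0" for u by simp
  then have rad: "u (Z i 0) * (\<alpha> * u (Z i 0) + \<beta> * u (Z i 1)) + u (Z i 1) * (\<gamma> * u (Z i 0) + \<delta> * u (Z i 1)) = 0" for u
    unfolding 0 1 by (simp add: ev_add ev_mult)
  \<comment> \<open>The points (1, 0), (0, 1) and (1, 1) of the line separate the three coefficients
    of the quadratic identity.\<close>
  have "\<alpha> = 0" using rad[of "\<lambda>p. if p = Z i 0 then 1 else 0"] by simp
  moreover have "\<delta> = 0" using rad[of "\<lambda>p. if p = Z i 1 then 1 else 0"] by simp
  moreover have "\<gamma> = - \<beta>" using rad[of "\<lambda>_. 1"] \<open>\<alpha> = 0\<close> \<open>\<delta> = 0\<close> by (simp add: eq_neg_iff_add_eq_0 add.commute)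
  ultimately have \<omega>: "\<omega> = (\<lambda>p. Const \<beta> * pencil i p)"
    using 0 1 other by (intro ext, rename_tac p, case_tac "p = Z i 0 \<or> p = Z i 1")
      (auto simp: pencil_simps Const_uminus)
  have "\<beta> \<noteq> 0"
  proof
    assume "\<beta> = 0"
    then have "\<omega> p = 0" for p by (simp add: \<omega>)
    then have "has_zero (coords ns) factor (\<lambda>p. ev (\<omega> p))"
      using blocks_nonzero_one unfolding has_zero_def by fastforce
    with nz show False ..
  qed
  then show ?thesis unfolding \<omega> by (rule induced_by_scale)
qed

section \<open>Integrability and first integral of the pencil\<close>

lemma pd_Var: "pd p (Var q) = (if p = q then 1 else 0)"
  by (simp add: Var_def pd_single pd_term_def lookup_single when_def)

lemma pd_Const: "pd p (Const c) = 0"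
  by (simp add: Const_def pd_single pd_term_def)

lemma pd_uminus: "pd p (- P) = - pd p P"
  using pd_add[of p P "- P"] by (simp add: eq_neg_iff_add_eq_0 add.commute)

text \<open>The form and its exterior derivative involve only two coordinates, and an alternating
  3-form in two coordinates vanishes.\<close>

lemma pencil_integrable: "integrable_distribution (induced_by (pencil i))"
  unfolding integrable_distribution_def
proof
  fix \<omega> assume "\<omega> \<in> induced_by (pencil i)"
  then obtain c where \<omega>: "\<omega> = (\<lambda>p. Const c * pencil i p)" by (auto simp: induced_by_def)
  let ?S = "{Z i 0, Z i (Suc 0)}"
  have z: "\<omega> p = 0" if "p \<notin> ?S" for p using that by (simp add: \<omega> pencil_simps)
  have anti: "ext_deriv \<omega> q p = - ext_deriv \<omega> p q" for p q by (simp add: ext_deriv_def)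
  have self: "ext_deriv \<omega> p p = 0" for p by (simp add: ext_deriv_def)
  have dz: "ext_deriv \<omega> p q = 0" if p: "p \<notin> ?S" for p q
  proof -
    have "pd p (pencil i q) = 0"
      using p by (cases "q = Z i 0"; cases "q = Z i (Suc 0)") (auto simp: pencil_simps pd_Var pd_uminus)
    moreover have "pencil i p = 0" using p by (simp add: pencil_simps)
    ultimately show ?thesis by (simp add: ext_deriv_def \<omega> pd_mult pd_Const)
  qed
  have dz': "ext_deriv \<omega> q p = 0" if "p \<notin> ?S" for p q using dz[OF that, of q] by (simp add: anti[of q p])
  have "wedge12 \<omega> (ext_deriv \<omega>) p q r = 0" for p q r
  proof -
    consider "p \<notin> ?S" | "q \<notin> ?S" | "r \<notin> ?S" | "p = q" | "q = r" | "p = r" by blast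
    then show ?thesis
    proof cases
      case 6
      then show ?thesis using anti[of p q] by (simp add: wedge12_def self)
    qed (simp_all add: wedge12_def z dz dz' self)
  qed
  then show "wedge12 \<omega> (ext_deriv \<omega>) = (\<lambda>p q r. 0)" by (intro ext)
qed

lemma Var_nonzero: "Var p \<noteq> 0"
proof
  assume "Var p = 0"
  then have "ev (Var p) (\<lambda>_. 1) = ev 0 (\<lambda>_. 1)" by simp
  then show False by simp
qed

lemma multihom_Var:
  assumes "i < length ns" "j \<le> ns ! i"
  shows "multihom ns (map (\<lambda>k. if k = i then 1 else 0) [0..<length ns]) (Var (Z i j))"
proof -
  have "(\<Sum>l\<le>ns ! k. Poly_Mapping.lookup (Poly_Mapping.single (Z i j) (1::nat)) (Z k l)) = (if k = i then 1 else 0)" for k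
    using assms(2) by (auto simp: lookup_single when_def)
  then show ?thesis using assms by (auto simp: multihom_def Var_def coords_def)
qed

lemma pencil_first_integral:
  assumes i: "i < length ns" "ns ! i = 1"
  shows "rational_first_integral ns (induced_by (pencil i)) (Fract (Var (Z i 0)) (Var (Z i 1)))"
proof -
  let ?x = "Var (Z i 0)" and ?y = "Var (Z i (Suc 0))"
  have "multihom ns (map (\<lambda>k. if k = i then 1 else 0) [0..<length ns]) ?x"
    "multihom ns (map (\<lambda>k. if k = i then 1 else 0) [0..<length ns]) ?y"
    using i by (intro multihom_Var; simp)+
  then have rat: "Fract ?x ?y \<in> rational_functions ns"
    unfolding rational_functions_def
    by (intro CollectI exI[of _ ?x] exI[of _ ?y] exI[of _ "map (\<lambda>k. if k = i then 1 else 0) [0..<length ns]"])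
      (simp add: Var_nonzero)
  have nonconst: "Fract ?x ?y \<noteq> Fract (Const c) 1" for c
  proof
    assume "Fract ?x ?y = Fract (Const c) 1"
    then have "?x = Const c * ?y" by (simp add: eq_fract Var_nonzero)
    then have "ev ?x (\<lambda>p. if p = Z i 0 then 1 else 0) = ev (Const c * ?y) (\<lambda>p. if p = Z i 0 then 1 else 0)" by simp
    then show False by (simp add: ev_mult)
  qed
  \<comment> \<open>Up to the square of the denominator, the differential of the quotient is the
    pencil itself, so the wedge product vanishes by proportionality.\<close>
  have dP: "pd p ?x * ?y - ?x * pd p ?y = pencil i p" for p
    by (cases "p = Z i 0"; cases "p = Z i (Suc 0)") (auto simp: pd_Var pencil_simps)
  have df: "fract_pd p (Fract ?x ?y) = Fract (pencil i p) (?y * ?y)" for p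
    by (simp add: fract_pd_Fract Var_nonzero dP)
  have "wedge11 (\<lambda>p. Fract (\<omega> p) 1) (\<lambda>p. fract_pd p (Fract ?x ?y)) = (\<lambda>p q. 0)"
    if \<omega>: "\<omega> \<in> induced_by (pencil i)" for \<omega>
  proof -
    obtain c where c: "\<omega> = (\<lambda>p. Const c * pencil i p)" using \<omega> by (auto simp: induced_by_def)
    show ?thesis unfolding wedge11_def df c by (simp add: mult_ac)
  qed
  with rat nonconst show ?thesis by (simp add: rational_first_integral_def)
qed

section \<open>The pencil as the fibration by a projection\<close>

lemma affine_coord_pclass:
  assumes "w j \<noteq> 0" shows "affine_coord j l (pclass w) = w l / w j"
  unfolding affine_coord_def
proof (rule the_equality)
  show "\<forall>w'\<in>pclass w. w l / w j = w' l / w' j" by (auto simp: pclass_def)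
  show "r = w l / w j" if "\<forall>w'\<in>pclass w. r = w' l / w' j" for r using that pclass_self by blast
qed

text \<open>The chart formula holds near \<open>t = 0\<close>, where the denominator is nonzero, and
  this is enough for a derivative; the quotient rule has the determinant of \<open>u\<close> and
  \<open>v\<close> in the places \<open>l\<close>, \<open>j\<close> as numerator.\<close>

lemma affine_coord_deriv:
  fixes v u :: "nat \<Rightarrow> complex"
  assumes "v j \<noteq> 0"
  shows "((\<lambda>t. affine_coord j l (pclass (\<lambda>b. v b + t * u b))) has_field_derivative 0) (at 0) \<longleftrightarrow>
    u l * v j = v l * u j"
proof -
  have "((\<lambda>t. v j + t * u j) \<longlongrightarrow> v j + 0 * u j) (at 0)" by (intro tendsto_intros)
  then have "\<forall>\<^sub>F t in at 0. v j + t * u j \<noteq> 0"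
    using assms by (intro tendsto_imp_eventually_ne) auto
  then have "\<forall>\<^sub>F t in at 0. affine_coord j l (pclass (\<lambda>b. v b + t * u b)) = (v l + t * u l) / (v j + t * u j)"
    by (rule eventually_mono) (simp add: affine_coord_pclass)
  then have cong: "((\<lambda>t. affine_coord j l (pclass (\<lambda>b. v b + t * u b))) has_field_derivative D) (at 0) \<longleftrightarrow>
      ((\<lambda>t. (v l + t * u l) / (v j + t * u j)) has_field_derivative D) (at 0)" for D
    by (rule has_field_derivative_cong_eventually) (simp add: affine_coord_pclass assms)
  have deriv: "((\<lambda>t. (v l + t * u l) / (v j + t * u j)) has_field_derivative
      (u l * v j - v l * u j) / (v j * v j)) (at 0)"
    using assms by (auto intro!: derivative_eq_intros)
  show ?thesis unfolding cong
  proof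
    assume "((\<lambda>t. (v l + t * u l) / (v j + t * u j)) has_field_derivative 0) (at 0)"
    from DERIV_unique[OF this deriv] show "u l * v j = v l * u j" using assms by simp
  next
    assume "u l * v j = v l * u j"
    then show "((\<lambda>t. (v l + t * u l) / (v j + t * u j)) has_field_derivative 0) (at 0)"
      using deriv by simp
  qed
qed

text \<open>Both conditions say that the two-dimensional vectors \<open>v i\<close> and
  \<open>u i\<close> have determinant 0: the pencil evaluates to this determinant, and the
  derivative of the affine coordinate has it as numerator up to sign.\<close>

lemma pencil_fibration:
  assumes i: "i < length ns" "ns ! i = 1"
  shows "is_projection_fibration ns i (induced_by (pencil i))"
  unfolding is_projection_fibration_def
proof (intro ballI allI)
  fix x v u assume x: "x \<in> mproj ns" and v: "v \<in> hom_coords ns x"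
  have "x i \<in> proj_space 1" using x i unfolding mproj_def by (auto dest!: PiE_mem)
  moreover have "v i \<in> x i" using v i by (simp add: hom_coords_def)
  ultimately obtain w c where w: "w \<in> nonzero_vectors 1" "c \<noteq> 0" "v i = (\<lambda>j. c * w j)"
    by (auto simp: proj_space_def pclass_def)
  have "w 0 \<noteq> 0 \<or> w 1 \<noteq> 0"
  proof (rule ccontr)
    assume "\<not> ?thesis"
    then have "w j = 0" for j using w(1) by (cases j rule: linorder_cases[of _ 1]) (auto simp: nonzero_vectors_def)
    then have "w = (\<lambda>_. 0)" by (intro ext)
    with w(1) show False by (simp add: nonzero_vectors_def)
  qed
  then have nz: "v i 0 \<noteq> 0 \<or> v i (Suc 0) \<noteq> 0" using w by simp
  have sum: "(\<Sum>k<length ns. \<Sum>j\<le>ns ! k. eval_mpoly v (Const c * pencil i (Z k j)) * u k j) =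
      c * (v i (Suc 0) * u i 0 - v i 0 * u i (Suc 0))" for c
  proof -
    have "(\<Sum>k<length ns. \<Sum>j\<le>ns ! k. eval_mpoly v (Const c * pencil i (Z k j)) * u k j) =
        (\<Sum>k\<in>{i}. \<Sum>j\<le>ns ! k. eval_mpoly v (Const c * pencil i (Z k j)) * u k j)"
    proof (rule sum.mono_neutral_right)
      show "\<forall>k\<in>{..<length ns} - {i}. (\<Sum>j\<le>ns ! k. eval_mpoly v (Const c * pencil i (Z k j)) * u k j) = 0"
        by (auto simp: pencil_simps eval_mpoly_ev intro!: sum.neutral)
    qed (use i in auto)
    then show ?thesis
      using i(2) by (simp add: atMost_Suc eval_mpoly_ev ev_mult ev_uminus pencil_simps algebra_simps)
  qed
  have tangent: "tangent_to ns (induced_by (pencil i)) v u \<longleftrightarrow> v i (Suc 0) * u i 0 = v i 0 * u i (Suc 0)"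
  proof
    assume "tangent_to ns (induced_by (pencil i)) v u"
    moreover have "(\<lambda>p. Const 1 * pencil i p) \<in> induced_by (pencil i)"
      unfolding induced_by_def by (intro CollectI exI[of _ 1]) simp
    ultimately have "(\<Sum>k<length ns. \<Sum>j\<le>ns ! k. eval_mpoly v (Const 1 * pencil i (Z k j)) * u k j) = 0"
      unfolding tangent_to_def by (rule bspec)
    then show "v i (Suc 0) * u i 0 = v i 0 * u i (Suc 0)" unfolding sum by simp
  next
    assume "v i (Suc 0) * u i 0 = v i 0 * u i (Suc 0)"
    then show "tangent_to ns (induced_by (pencil i)) v u"
      unfolding tangent_to_def by (auto simp: induced_by_def sum)
  qed
  have "projection i (mpoint ns (\<lambda>a b. v a b + t * u a b)) = pclass (\<lambda>b. v i b + t * u i b)" for t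
    using i by (simp add: projection_def mpoint_def)
  then have "in_kernel_dprojection ns i v u \<longleftrightarrow>
      (\<forall>j\<le>1. v i j \<noteq> 0 \<longrightarrow> (\<forall>l\<le>1. u i l * v i j = v i l * u i j))"
    unfolding in_kernel_dprojection_def using i(2) by (simp add: affine_coord_deriv)
  \<comment> \<open>One of the two charts is available because \<open>v i\<close> is nonzero; for
    \<open>l = j\<close> the equation is trivial, and the other index gives the determinant.\<close>
  also have "\<dots> \<longleftrightarrow> v i (Suc 0) * u i 0 = v i 0 * u i (Suc 0)"
    using nz by (auto simp: le_Suc_eq mult.commute)
  finally show "tangent_to ns (induced_by (pencil i)) v u \<longleftrightarrow> in_kernel_dprojection ns i v u"
    unfolding tangent by simp
qed

section \<open>The factors as line and plane blocks\<close>

lemma coords_line_block: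
  assumes "i < length ns" "ns ! i = 1" shows "line_block (coords ns) factor i"
proof -
  have "{..1::nat} = {0, 1}" by auto
  then have "{p. p \<in> coords ns \<and> factor p = i} = {Z i 0, Z i 1}"
    using coords_block[OF assms(1)] assms(2) by simp
  then show ?thesis unfolding line_block_def by (intro exI[of _ "Z i 0"] exI[of _ "Z i 1"]) simp
qed

lemma coords_plane_block:
  assumes "i < length ns" "ns ! i = 2" shows "plane_block (coords ns) factor i"
proof -
  have "{..2::nat} = {0, 1, 2}" by auto
  then have "{p. p \<in> coords ns \<and> factor p = i} = {Z i 0, Z i 1, Z i 2}"
    using coords_block[OF assms(1)] assms(2) by simp
  then show ?thesis
    unfolding plane_block_def by (intro exI[of _ "Z i 0"] exI[of _ "Z i 1"] exI[of _ "Z i 2"]) simp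
qed

theorem corollary4p3:
  fixes ns :: "nat list" and d :: "int list" and D :: "(coord \<Rightarrow> mpoly) set"
  assumes "codim1_distribution ns d D"
    and "isolated_singularities ns D"
  shows
    "(ns = [1, 1, 1] \<and> regular ns D \<longrightarrow>
        d \<in> {[2, 0, 0], [0, 2, 0], [0, 0, 2]} \<and>
        (\<exists>i<3. D = induced_by (\<lambda>p. Var (Z i 1) * dZ (Z i 0) p - Var (Z i 0) * dZ (Z i 1) p) \<and>
               is_projection_fibration ns i D) \<and>
        integrable_distribution D \<and>
        (\<exists>f. rational_first_integral ns D f)) \<and>
     (ns = [2, 1] \<and> regular ns D \<longrightarrow>
        d = [0, 2] \<and>
        D = induced_by (\<lambda>p. Var (Z 1 1) * dZ (Z 1 0) p - Var (Z 1 0) * dZ (Z 1 1) p) \<and>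
        integrable_distribution D \<and>
        (\<exists>f. rational_first_integral ns D f) \<and>
        is_projection_fibration ns 1 D) \<and>
     (ns = [2, 2] \<longrightarrow> Sing ns D \<noteq> {})"
proof -
  obtain \<omega> where tf: "twisted_form ns d \<omega>" and D: "D = induced_by \<omega>"
    using assms(1) by (auto simp: codim1_distribution_def)
  note tw = twisted_ev[OF tf]
  have len: "length d = length ns" using tf by (simp add: twisted_form_def)
  have no_zero: "\<not> has_zero (coords ns) factor (\<lambda>p. ev (\<omega> p))" if "regular ns D"
    using has_zero_imp_Sing[OF tf] that unfolding regular_def D by blast
  \<comment> \<open>The abstract degrees are \<open>nat (d ! i)\<close>; excluding negative entries
    turns \<open>nat (d ! i) = 0\<close> into \<open>d ! i = 0\<close>.\<close>
  have nonneg: "d ! i \<ge> 0" if "regular ns D" "i < length ns" for i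
    using negative_degree_has_zero[OF tf that(2)] no_zero[OF that(1)] by fastforce
  have pencil: "D = induced_by (\<lambda>p. Var (Z i 1) * dZ (Z i 0) p - Var (Z i 0) * dZ (Z i 1) p)"
      "is_projection_fibration ns i D" "integrable_distribution D" "\<exists>f. rational_first_integral ns D f"
    if "regular ns D" "i < length ns" "ns ! i = 1" "d ! i = 2"
      "\<And>k. k < length ns \<Longrightarrow> k \<noteq> i \<Longrightarrow> d ! k = 0" for i
  proof -
    have Dp: "D = induced_by (pencil i)"
      unfolding D by (rule degree_2_0_pencil[OF tf no_zero[OF that(1)] that(2-5)])
    show "D = induced_by (\<lambda>p. Var (Z i 1) * dZ (Z i 0) p - Var (Z i 0) * dZ (Z i 1) p)"
      using Dp unfolding pencil_def .
    show "is_projection_fibration ns i D" unfolding Dp by (rule pencil_fibration[OF that(2,3)])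
    show "integrable_distribution D" unfolding Dp by (rule pencil_integrable)
    show "\<exists>f. rational_first_integral ns D f"
      unfolding Dp using pencil_first_integral[OF that(2,3)] by blast
  qed
  have three: "d \<in> {[2, 0, 0], [0, 2, 0], [0, 0, 2]} \<and>
      (\<exists>i<3. D = induced_by (\<lambda>p. Var (Z i 1) * dZ (Z i 0) p - Var (Z i 0) * dZ (Z i 1) p) \<and>
        is_projection_fibration ns i D) \<and>
      integrable_distribution D \<and> (\<exists>f. rational_first_integral ns D f)"
    if ns: "ns = [1, 1, 1]" and reg: "regular ns D"
  proof -
    have K: "factor ` coords ns = {0, 1, 2}" unfolding factor_coords ns by auto
    have nth: "ns ! i = 1" if "i < 3" for i using that unfolding ns by (auto simp: less_Suc_eq numeral_3_eq_3)
    have line: "line_block (coords ns) factor i" if "i < 3" for i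
      by (rule coords_line_block) (use that nth in \<open>simp_all add: ns\<close>)
    have degs: "(d ! 0 = 2 \<and> d ! 1 = 0 \<and> d ! 2 = 0) \<or> (d ! 0 = 0 \<and> d ! 1 = 2 \<and> d ! 2 = 0) \<or>
        (d ! 0 = 0 \<and> d ! 1 = 0 \<and> d ! 2 = 2)"
      using three_lines_degrees[OF finite_coords tw no_zero[OF reg] K _ _ _ line line line]
        nonneg[OF reg, of 0] nonneg[OF reg, of 1] nonneg[OF reg, of 2] by (auto simp: ns)
    have "length d = 3" using len ns by simp
    then have d3: "d = [d ! 0, d ! 1, d ! 2]"
      by (intro nth_equalityI) (auto simp: less_Suc_eq numeral_3_eq_3 numeral_2_eq_2)
    from degs have "\<exists>i<3. d ! i = 2 \<and> (\<forall>k<3. k \<noteq> i \<longrightarrow> d ! k = 0)"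
      by (simp add: numeral_3_eq_3 numeral_2_eq_2 All_less_Suc Ex_less_Suc) blast
    then obtain i where i: "i < 3" "d ! i = 2" "\<And>k. k < 3 \<Longrightarrow> k \<noteq> i \<Longrightarrow> d ! k = 0" by blast
    have "d \<in> {[2, 0, 0], [0, 2, 0], [0, 0, 2]}" using degs d3 by (elim disjE) simp_all
    moreover have l3: "length ns = 3" by (simp add: ns)
    ultimately show ?thesis
      using pencil[OF reg _ nth[OF i(1)] i(2)] i by auto
  qed
  have two: "d = [0, 2] \<and>
      D = induced_by (\<lambda>p. Var (Z 1 1) * dZ (Z 1 0) p - Var (Z 1 0) * dZ (Z 1 1) p) \<and>
      integrable_distribution D \<and> (\<exists>f. rational_first_integral ns D f) \<and> is_projection_fibration ns 1 D"
    if ns: "ns = [2, 1]" and reg: "regular ns D"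
  proof -
    have K: "factor ` coords ns = {0, 1}" unfolding factor_coords ns by auto
    have "plane_block (coords ns) factor 0" by (rule coords_plane_block) (simp_all add: ns)
    moreover have "line_block (coords ns) factor 1" by (rule coords_line_block) (simp_all add: ns)
    ultimately have "nat (d ! 0) = 0 \<and> nat (d ! 1) = 2"
      by (rule plane_line_degrees[OF finite_coords tw no_zero[OF reg] K zero_neq_one])
    then have degs: "d ! 0 = 0" "d ! 1 = 2" using nonneg[OF reg, of 0] by (auto simp: ns)
    have "length d = 2" using len ns by simp
    then have "d = [d ! 0, d ! 1]" by (intro nth_equalityI) (auto simp: less_Suc_eq numeral_2_eq_2)
    then have "d = [0, 2]" using degs by simp
    moreover have "1 < length ns" "ns ! 1 = 1" and "k < length ns \<Longrightarrow> k \<noteq> 1 \<Longrightarrow> d ! k = 0" for k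
      using degs by (auto simp: ns less_Suc_eq)
    ultimately show ?thesis using pencil[OF reg, of 1] degs(2) by blast
  qed
  have "Sing ns D \<noteq> {}" if ns: "ns = [2, 2]"
  proof -
    have K: "factor ` coords ns = {0, 1}" unfolding factor_coords ns by auto
    have "plane_block (coords ns) factor 0" by (rule coords_plane_block) (simp_all add: ns)
    moreover have "plane_block (coords ns) factor 1" by (rule coords_plane_block) (simp_all add: ns)
    ultimately have "has_zero (coords ns) factor (\<lambda>p. ev (\<omega> p))"
      by (rule two_planes_has_zero[OF finite_coords tw K zero_neq_one])
    then show ?thesis unfolding D by (rule has_zero_imp_Sing[OF tf])
  qed
  with three two show ?thesis by blast
qed

end
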